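(* Let $k$ be an algebraically closed field of characteristic zero. Let $X\subset\mathbb{P}^4$ be a cubic threefold with exactly six nodes, given by $$a_1f_1+a_2f_2+a_3f_3+a_4f_4+a_5f_5=0,\qquad a_1,\dots,a_5\in k,$$ where $f_1,\dots,f_5$ are the cubic forms listed in the context, so that the nodes of $X$ are the points $p_1,\dots,p_6$ listed there. Assume that none of the nodes of $X$ is fixed by $\mathrm{Aut}(X)$. Then, under the $\mathfrak{S}_6$-action on $\mathbb{P}^4$ specified in the context (through which $\mathrm{Aut}(X)\subseteq\mathfrak{S}_6$), one of the following holds: (1) $a_1+a_2+a_4+a_5=0$, and $\mathrm{Aut}(X)\simeq C_2=\langle(1,3)(2,5)(4,6)\rangle$. (2) $a_1+a_3=a_2-a_3+a_4+a_5=0$, and $\mathrm{Aut}(X)\simeq\mathfrak{S}_3=\langle(1,3)(2,5)(4,6),(1,4,5)(2,6,3)\rangle$. (3) $a_1+a_4=a_2+a_5=a_3-a_4=0$, and $\mathrm{Aut}(X)\simeq\mathfrak{S}_4=\langle(1,3)(2,5)(4,6),(3,4,5,6)\rangle$. (4) $a_1+a_4=a_2+a_5=a_3+a_4=0$, and $\mathrm{Aut}(X)\simeq\mathfrak{D}_4=\langle(3,5),(1,3,2,5)(4,6)\rangle$. (5) $a_1+a_4+2a_5=a_2-a_5=0$, and $\mathrm{Aut}(X)\simeq C_2^2=\langle(1,2)(3,5)(4,6),(1,3)(2,5)(4,6)\rangle$. (6) $a_1+a_4+2a_5=a_2-a_5=a_3-a_4-2a_5=0$, and $\mathrm{Aut}(X)\simeq\mathfrak{D}_6=\langle(1,3)(2,5)(4,6),(1,6,5,2,4,3)\rangle$.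 (7) $a_1=a_3=a_5=1$, $a_2=a_4=-1$, and $\mathrm{Aut}(X)\simeq\mathfrak{S}_3^2\rtimes C_2=\langle(1,3)(2,5)(4,6),(2,4),(1,5)(2,3,4,6)\rangle$. (8) $a_1=a_4=1$, $a_2=a_3=a_5=-1$, and $\mathrm{Aut}(X)\simeq\mathfrak{S}_5=\langle(1,3)(2,5)(4,6),(1,2,5,6,4)\rangle$.
   Context: A node is an ordinary double point. $\mathfrak{D}_n$ is the dihedral group of order $2n$. The points, which are in general linear position, are $p_1=[1:0:0:0:0]$, $p_2=[1:1:1:1:1]$, $p_3=[0:0:0:0:1]$, $p_4=[0:0:0:1:0]$, $p_5=[0:0:1:0:0]$, $p_6=[0:1:0:0:0]$. The cubic forms are $f_1=x_1x_2x_3-x_2x_3x_4-x_2x_3x_5-x_1x_4x_5+x_2x_4x_5+x_3x_4x_5$, $f_2=x_1x_2x_4-x_2x_3x_4-x_1x_4x_5+x_3x_4x_5$, $f_3=x_1x_2x_5-x_2x_3x_5-x_1x_4x_5+x_3x_4x_5$, $f_4=x_1x_3x_4-x_2x_3x_4-x_1x_4x_5+x_2x_4x_5$, $f_5=x_1x_3x_5-x_2x_3x_5-x_1x_4x_5+x_2x_4x_5$. The group $\mathfrak{S}_6$ acts on $\mathbb{P}^4$ by projective linear transformations permuting the points $p_1,\dots,p_6$ by permuting their indices; the action is generated by $\tau_{(12)}\colon(x_1,\dots,x_5)\mapsto(-x_1,-x_1+x_2,-x_1+x_3,-x_1+x_4,-x_1+x_5)$ and $\tau_{(1\cdots6)}\colon(x_1,\dots,x_5)\mapsto(-x_1+x_2,-x_1+x_3,-x_1+x_4,-x_1+x_5,-x_1)$,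 which act on indices as $(1,2)$ and $(1,2,3,4,5,6)$. Automorphisms of $X$ are restrictions of projective linear maps permuting the six nodes, so $\mathrm{Aut}(X)\subseteq\mathfrak{S}_6$.
   Formalization: The eight cases are asserted up to the S_6-action on P^4 and up to rescaling the equation: X is first moved by an element of S_6, and the conditions on a_1,...,a_5 and the listed subgroup refer to the moved cubic; read literally for the given coefficients the claim fails. *)

theory Defs
  imports
    "HOL-Analysis.Analysis"
    "HOL-Library.Poly_Mapping"
    "HOL-Computational_Algebra.Polynomial"
    "HOL-Combinatorics.Cycles"
    "HOL-Algebra.Bij"
    "HOL-Algebra.Sym_Groups"
    "HOL-Algebra.Elementary_Groups"
begin

section \<open>Projective space and its linear automorphisms\<close>

text \<open>A point of projective space is the class of a nonzero vector up to nonzero scalars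
  (the zero vector is not in the class).\<close>

definition proj_point :: "'a::field ^ 'n \<Rightarrow> ('a ^ 'n) set" where
  "proj_point v = {c *s v | c. c \<noteq> 0}"

definition proj_space :: "('a::field ^ 'n) set set" where
  "proj_space = {proj_point v | v. v \<noteq> 0}"

definition proj_map :: "'a::field ^ 'n ^ 'n \<Rightarrow> ('a ^ 'n) set \<Rightarrow> ('a ^ 'n) set" where
  "proj_map A = (\<lambda>L\<in>proj_space. (\<lambda>v. A *v v) ` L)"

definition PGL :: "(('a::field ^ 'n) set \<Rightarrow> ('a ^ 'n) set) set" where
  "PGL = {proj_map A | A. invertible A}"

text \<open>For the cubic threefolds considered here every automorphism is the restriction of a unique
  projective linear map, so the automorphism group is realised as the stabiliser of the
  point set \<open>X\<close> in PGL; the group operation is composition.\<close>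

definition Aut :: "('a::field ^ 'n) set set \<Rightarrow> (('a ^ 'n) set \<Rightarrow> ('a ^ 'n) set) monoid" where
  "Aut X = (BijGroup proj_space)\<lparr>carrier := {g \<in> PGL. g ` X = X}\<rparr>"


section \<open>Hypersurfaces, singular points and nodes\<close>

text \<open>Polynomials in variables indexed by \<open>'n\<close>: finitely supported maps from exponent vectors
  to coefficients, with the convolution product of \<^theory>\<open>HOL-Library.Poly_Mapping\<close>.\<close>

type_synonym ('n, 'a) mpoly = "('n \<Rightarrow>\<^sub>0 nat) \<Rightarrow>\<^sub>0 'a"

definition Const :: "'a \<Rightarrow> ('n, 'a::comm_ring_1) mpoly" where
  "Const c = Poly_Mapping.single 0 c"

definition Var :: "'n \<Rightarrow> ('n, 'a::comm_ring_1) mpoly" where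
  "Var i = Poly_Mapping.single (Poly_Mapping.single i 1) 1"

definition mpoly_eval :: "('n::finite, 'a::comm_ring_1) mpoly \<Rightarrow> 'a ^ 'n \<Rightarrow> 'a" where
  "mpoly_eval F x = (\<Sum>m\<in>Poly_Mapping.keys F.
     Poly_Mapping.lookup F m * (\<Prod>i\<in>UNIV. (x $ i) ^ Poly_Mapping.lookup m i))"

definition partial_deriv :: "'n \<Rightarrow> ('n, 'a::comm_ring_1) mpoly \<Rightarrow> ('n, 'a) mpoly" where
  "partial_deriv i F = (\<Sum>m\<in>Poly_Mapping.keys F.
     Poly_Mapping.single (m - Poly_Mapping.single i 1)
       (of_nat (Poly_Mapping.lookup m i) * Poly_Mapping.lookup F m))"

definition hypersurface :: "('n::finite, 'a::field) mpoly \<Rightarrow> ('a ^ 'n) set set" where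
  "hypersurface F = {proj_point v | v. v \<noteq> 0 \<and> mpoly_eval F v = 0}"

definition singular_at :: "('n::finite, 'a::field) mpoly \<Rightarrow> 'a ^ 'n \<Rightarrow> bool" where
  "singular_at F v \<longleftrightarrow>
     mpoly_eval F v = 0 \<and> (\<forall>i. mpoly_eval (partial_deriv i F) v = 0)"

text \<open>An ordinary double point: a singular point at which the Hessian of the dehomogenised
  equation is nondegenerate in an affine chart \<open>x\<^sub>j \<noteq> 0\<close> around the point. The tangent
  space of that chart is the space of all \<open>w\<close> with \<open>w $ j = 0\<close>. For homogeneous \<open>F\<close> the
  condition depends neither on the chart nor on the representative \<open>v\<close>.\<close>

definition ordinary_double_at :: "('n::finite, 'a::field) mpoly \<Rightarrow> 'a ^ 'n \<Rightarrow> bool" where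
  "ordinary_double_at F v \<longleftrightarrow> singular_at F v \<and>
     (\<exists>j. v $ j \<noteq> 0 \<and>
       (\<forall>w. w $ j = 0 \<and>
            (\<forall>u. u $ j = 0 \<longrightarrow>
              (\<Sum>i\<in>UNIV. \<Sum>k\<in>UNIV.
                 u $ i * mpoly_eval (partial_deriv i (partial_deriv k F)) v * w $ k) = 0)
          \<longrightarrow> w = 0))"

definition singular_locus :: "('n::finite, 'a::field) mpoly \<Rightarrow> ('a ^ 'n) set set" where
  "singular_locus F = {proj_point v | v. v \<noteq> 0 \<and> singular_at F v}"

definition nodes :: "('n::finite, 'a::field) mpoly \<Rightarrow> ('a ^ 'n) set set" where
  "nodes F = {proj_point v | v. v \<noteq> 0 \<and> ordinary_double_at F v}"


section \<open>The family of cubic threefolds\<close>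

text \<open>Coordinates are indexed by the numeral type \<open>5\<close>, in which the index \<open>5\<close> is \<open>0\<close>.\<close>

definition cubic :: "'a::comm_ring_1 ^ 5 \<Rightarrow> (5, 'a) mpoly" where
  "cubic a = (let x1 = Var 1; x2 = Var 2; x3 = Var 3; x4 = Var 4; x5 = Var 5;
     f1 = x1*x2*x3 - x2*x3*x4 - x2*x3*x5 - x1*x4*x5 + x2*x4*x5 + x3*x4*x5;
     f2 = x1*x2*x4 - x2*x3*x4 - x1*x4*x5 + x3*x4*x5;
     f3 = x1*x2*x5 - x2*x3*x5 - x1*x4*x5 + x3*x4*x5;
     f4 = x1*x3*x4 - x2*x3*x4 - x1*x4*x5 + x2*x4*x5;
     f5 = x1*x3*x5 - x2*x3*x5 - x1*x4*x5 + x2*x4*x5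
   in Const (a $ 1) * f1 + Const (a $ 2) * f2 + Const (a $ 3) * f3
    + Const (a $ 4) * f4 + Const (a $ 5) * f5)"

definition node_vec :: "nat \<Rightarrow> 'a::field ^ 5" where
  "node_vec i =
    (if i = 1 then axis 1 1
     else if i = 2 then (\<chi> _. 1)
     else if i = 3 then axis 5 1
     else if i = 4 then axis 4 1
     else if i = 5 then axis 3 1
     else axis 2 1)"

definition node :: "nat \<Rightarrow> ('a::field ^ 5) set" where
  "node i = proj_point (node_vec i)"

text \<open>The action of \<open>S\<^sub>6\<close> on \<open>P\<^sup>4\<close>: a permutation \<open>\<sigma>\<close> acts by the projective linear map
  sending \<open>node i\<close> to \<open>node (\<sigma> i)\<close>, which is unique because the six points are in general
  linear position.\<close>

definition permutes_nodes_by ::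
    "(('a::field ^ 5) set \<Rightarrow> ('a ^ 5) set) \<Rightarrow> (nat \<Rightarrow> nat) \<Rightarrow> bool" where
  "permutes_nodes_by g \<sigma> \<longleftrightarrow>
     \<sigma> permutes {1..6} \<and> (\<forall>i\<in>{1..6}. g (node i) = node (\<sigma> i))"

definition node_perm :: "(('a::field ^ 5) set \<Rightarrow> ('a ^ 5) set) \<Rightarrow> (nat \<Rightarrow> nat)" where
  "node_perm g = (THE \<sigma>. permutes_nodes_by g \<sigma>)"

text \<open>\<open>Aut X\<close>, embedded in \<open>S\<^sub>6\<close> by its action on the six points, is the subgroup generated
  by \<open>S\<close>.\<close>

definition Aut_acts_as :: "('a::field ^ 5) set set \<Rightarrow> (nat \<Rightarrow> nat) set \<Rightarrow> bool" where
  "Aut_acts_as X S \<longleftrightarrow> node_perm \<in> iso (Aut X) (subgroup_generated (sym_group 6) S)"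


section \<open>Abstract groups\<close>

definition semidirect_product ::
    "('g, 'x) monoid_scheme \<Rightarrow> ('h, 'y) monoid_scheme \<Rightarrow> ('h \<Rightarrow> 'g \<Rightarrow> 'g) \<Rightarrow> ('g \<times> 'h) monoid"
  where
  "semidirect_product G H \<phi> =
     \<lparr>carrier = carrier G \<times> carrier H,
      monoid.mult = (\<lambda>(g, h) (g', h'). (g \<otimes>\<^bsub>G\<^esub> \<phi> h g', h \<otimes>\<^bsub>H\<^esub> h')),
      one = (\<one>\<^bsub>G\<^esub>, \<one>\<^bsub>H\<^esub>)\<rparr>"

text \<open>The dihedral group of order \<open>2n\<close>.\<close>

definition dihedral_group :: "nat \<Rightarrow> (int \<times> int) monoid" where
  "dihedral_group n = semidirect_product (integer_mod_group n) (integer_mod_group 2)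
     (\<lambda>s r. if s = 0 then r else inv\<^bsub>integer_mod_group n\<^esub> r)"

text \<open>The cyclic group of order two exchanges the two factors.\<close>

definition sym3_squared_C2 :: "(((nat \<Rightarrow> nat) \<times> (nat \<Rightarrow> nat)) \<times> int) monoid" where
  "sym3_squared_C2 = semidirect_product (sym_group 3 \<times>\<times> sym_group 3) (integer_mod_group 2)
     (\<lambda>s (x, y). if s = 0 then (x, y) else (y, x))"


section \<open>Explicit generators of the action\<close>

definition tau_12 :: "'a::field ^ 5 ^ 5" where
  "tau_12 = (\<chi> i j. if j = 1 then -1 else if j = i then 1 else 0)"

definition tau_123456 :: "'a::field ^ 5 ^ 5" where
  "tau_123456 = (\<chi> i j. if j = 1 then -1 else if j = i + 1 then 1 else 0)"

lemma UNIV_5: "(UNIV :: 5 set) = {1, 2, 3, 4, 5}"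
proof -
  have "card {1, 2, 3, 4, 5 :: 5} = CARD(5)" by simp
  then show ?thesis by (metis card_subset_eq finite subset_UNIV)
qed

lemma forall_5: "(\<forall>i::5. P i) \<longleftrightarrow> P 1 \<and> P 2 \<and> P 3 \<and> P 4 \<and> P 5"
  by (metis UNIV_I UNIV_5 empty_iff insert_iff)

lemma sum_5: "sum f (UNIV :: 5 set) = f 1 + f 2 + f 3 + f 4 + f 5"
  unfolding UNIV_5 by (simp add: ac_simps)

lemma tau_12_mult: "tau_12 *v x =
    (\<chi> i. if i = 1 then - x $ 1 else - x $ 1 + x $ i)"
  unfolding vec_eq_iff tau_12_def matrix_vector_mult_def forall_5 sum_5 by simp

lemma tau_123456_mult: "tau_123456 *v x =
    (\<chi> i. if i = 5 then - x $ 1 else - x $ 1 + x $ (i + 1))"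
  unfolding vec_eq_iff tau_123456_def matrix_vector_mult_def forall_5 sum_5 by simp

lemma invertible_tau_12: "invertible tau_12"
  unfolding invertible_def
  by (intro exI[of _ tau_12])
     (simp add: vec_eq_iff tau_12_def matrix_matrix_mult_def mat_def forall_5 sum_5)

lemma invertible_tau_123456: "invertible tau_123456"
  unfolding invertible_def
  by (intro exI[of _ "\<chi> i j. if j = 5 then -1 else if i = j + 1 then 1 else 0"])
     (simp add: vec_eq_iff tau_123456_def matrix_matrix_mult_def mat_def forall_5 sum_5)

lemma proj_point_scale: "c \<noteq> 0 \<Longrightarrow> proj_point (c *s v) = proj_point v"
  unfolding proj_point_def
  by (auto simp: vector_smult_assoc) (metis mult_eq_0_iff nonzero_eq_divide_eq divide_eq_0_iff)

lemma proj_map_point: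
  assumes "v \<noteq> 0"
  shows "proj_map A (proj_point v) = proj_point (A *v v)"
proof -
  have "proj_point v \<in> proj_space"
    using assms unfolding proj_space_def by blast
  moreover have "(\<lambda>w. A *v w) ` proj_point v = proj_point (A *v v)"
    unfolding proj_point_def by (auto simp: image_Collect vector_scalar_commute) (metis vector_scalar_commute)
  ultimately show ?thesis unfolding proj_map_def by simp
qed

lemma node_vec_nonzero: "node_vec i \<noteq> 0"
  by (auto simp: node_vec_def vec_eq_iff axis_def)

lemma interval_6: "{1..6::nat} = {1, 2, 3, 4, 5, 6}"
  by auto

lemma permutes_nodes_byI:
  assumes "\<sigma> permutes {1..6}"
    and "\<And>i. i \<in> {1..6} \<Longrightarrow> \<exists>c. c \<noteq> 0 \<and> A *v node_vec i = c *s node_vec (\<sigma> i)"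
  shows "permutes_nodes_by (proj_map A) \<sigma>"
  unfolding permutes_nodes_by_def node_def
  using assms by (metis proj_map_point node_vec_nonzero proj_point_scale)

lemma tau_12_action:
  "(proj_map tau_12 :: ('a::field ^ 5) set \<Rightarrow> _) \<in> PGL \<and>
   permutes_nodes_by (proj_map (tau_12 :: 'a ^ 5 ^ 5)) (cycle_of_list [1, 2])"
proof
  show "(proj_map tau_12 :: ('a ^ 5) set \<Rightarrow> _) \<in> PGL"
    using invertible_tau_12 unfolding PGL_def by blast
  show "permutes_nodes_by (proj_map (tau_12 :: 'a ^ 5 ^ 5)) (cycle_of_list [1, 2])"
  proof (rule permutes_nodes_byI)
    show "cycle_of_list [1, 2] permutes {1..6::nat}"
      by (rule permutes_subset[OF cycle_permutes]) auto
    show "\<exists>c. c \<noteq> 0 \<and> tau_12 *v node_vec i = c *s (node_vec (cycle_of_list [1, 2] i) :: 'a ^ 5)"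
      if "i \<in> {1..6}" for i
      using that unfolding interval_6
      by (intro exI[of _ "if i \<le> 2 then - 1 else 1"])
         (auto simp: tau_12_mult node_vec_def vec_eq_iff forall_5 axis_def Transposition.transpose_def)
  qed
qed

lemma tau_123456_action:
  "(proj_map tau_123456 :: ('a::field ^ 5) set \<Rightarrow> _) \<in> PGL \<and>
   permutes_nodes_by (proj_map (tau_123456 :: 'a ^ 5 ^ 5)) (cycle_of_list [1, 2, 3, 4, 5, 6])"
proof
  show "(proj_map tau_123456 :: ('a ^ 5) set \<Rightarrow> _) \<in> PGL"
    using invertible_tau_123456 unfolding PGL_def by blast
  show "permutes_nodes_by (proj_map (tau_123456 :: 'a ^ 5 ^ 5)) (cycle_of_list [1, 2, 3, 4, 5, 6])"
  proof (rule permutes_nodes_byI)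
    show "cycle_of_list [1, 2, 3, 4, 5, 6] permutes {1..6::nat}"
      by (rule permutes_subset[OF cycle_permutes]) auto
    show "\<exists>c. c \<noteq> 0 \<and>
        tau_123456 *v node_vec i = c *s (node_vec (cycle_of_list [1, 2, 3, 4, 5, 6] i) :: 'a ^ 5)"
      if "i \<in> {1..6}" for i
      using that unfolding interval_6
      by (intro exI[of _ "if i \<le> 2 then - 1 else 1"])
         (auto simp: tau_123456_mult node_vec_def vec_eq_iff forall_5 axis_def Transposition.transpose_def)
  qed
qed

end

theory Submission
  imports Defs
begin

text \<open>A cubic of the family is given by six numbers \<open>y\<^sub>1, \<dots>, y\<^sub>6\<close> of sum zero such that its ten
  coefficients are, up to sign, the sums \<open>y\<^sub>i + y\<^sub>j + y\<^sub>k\<close>, one for each pair of complementary triples;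
  a vanishing sum would create a seventh singular point. The linear map that permutes the nodes by
  \<open>\<sigma>\<close> acts on \<open>y\<close>, up to a scalar, by the image of \<open>\<sigma>\<close> under an outer automorphism of the symmetric group
  of degree 6. The nodes are exactly the points \<open>r\<close> of \<open>X\<close> such that a line through \<open>r\<close> which meets \<open>X\<close> in two
  further points lies in \<open>X\<close>, so every projective map preserving the point set \<open>X\<close> permutes them. As
  cubics of the family with the same zeros are proportional, the automorphism group of \<open>X\<close> is the group of
  permutations that multiply \<open>y\<close> by a scalar. If the \<open>y\<^sub>i\<close> are pairwise distinct, this group fixes a
  node. Otherwise the coincidences among the \<open>y\<^sub>i\<close> leave, up to permutation and scaling, the eight
  cases.\<close>

section \<open>Evaluation and differentiation of polynomials\<close>

text \<open>An automorphism is only known to preserve a set of points. Its pullback of the equation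
  is not known to be a multiple of it, so neither gradients nor the nodes are visibly preserved.
  Trisecant lines describe the nodes by zeros alone; afterwards proportionality of two cubics of the
  family is read off from explicit zeros, so no Nullstellensatz enters. Algebraic closedness serves
  only to solve the quadratic equations along lines. That the outer automorphism is well defined is
  not checked on relations between generators: two matrices inducing the same permutation of the
  nodes are proportional, hence act in the same way on the cubics, and this action determines the
  permutation of the coordinates. For pairwise distinct \<open>y\<close> a permutation scaling
  \<open>y\<close> is determined by its scalar. Vanishing triple sums exclude all scalars except 1,
  -1 and, if some coordinate is zero, fifth roots of unity. The scalar -1 comes from a
  fixed-point-free involution, which corresponds to a transposition of nodes, and a nontrivial fifth
  root of unity comes from a 5-cycle, which corresponds to a 5-cycle of nodes. Each leaves a node in
  place.\<close>

lemma mpoly_eval_superset: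
  assumes "finite S" "Poly_Mapping.keys F \<subseteq> S"
  shows "mpoly_eval F x = (\<Sum>m\<in>S. Poly_Mapping.lookup F m * (\<Prod>i\<in>UNIV. (x $ i) ^ Poly_Mapping.lookup m i))"
  unfolding mpoly_eval_def
  by (rule sum.mono_neutral_left) (use assms in \<open>auto simp: in_keys_iff\<close>)

lemma mpoly_eval_add: "mpoly_eval (F + G) x = mpoly_eval F x + mpoly_eval G x"
proof -
  let ?S = "Poly_Mapping.keys F \<union> Poly_Mapping.keys G"
  have *: "finite ?S" "Poly_Mapping.keys (F + G) \<subseteq> ?S"
    by (auto simp: Poly_Mapping.keys_add)
  show ?thesis
    using mpoly_eval_superset[OF *] mpoly_eval_superset[OF *(1), of F] mpoly_eval_superset[OF *(1), of G]
    by (simp add: lookup_add sum.distrib distrib_right)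
qed

lemma mpoly_eval_single:
  "mpoly_eval (Poly_Mapping.single m c) x = c * (\<Prod>i\<in>UNIV. (x $ i) ^ Poly_Mapping.lookup m i)"
  by (cases "c = 0") (auto simp: mpoly_eval_def lookup_single)

lemma mpoly_eval_uminus: "mpoly_eval (- F) x = - mpoly_eval F x"
  by (simp add: mpoly_eval_def sum_negf)

lemma mpoly_eval_diff: "mpoly_eval (F - G) x = mpoly_eval F x - mpoly_eval G x"
  using mpoly_eval_add[of F "- G" x] by (simp add: mpoly_eval_uminus)

lemma poly_mapping_single_induct [case_names single add]:
  assumes "\<And>m c. P (Poly_Mapping.single m c)" "\<And>F G. P F \<Longrightarrow> P G \<Longrightarrow> P (F + G)"
  shows "P F"
proof (induction F rule: update_induct)
  case const
  show ?case using assms(1)[of undefined 0] by simp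
next
  case (update F m c)
  have "Poly_Mapping.update m c F = Poly_Mapping.single m c + F"
    using update(1) by (intro poly_mapping_eqI)
      (auto simp: lookup_add lookup_single when_def update.rep_eq in_keys_iff)
  then show ?case using assms update by simp
qed

lemma mpoly_eval_mult: "mpoly_eval (F * G) x = mpoly_eval F x * mpoly_eval G x"
proof (induction F rule: poly_mapping_single_induct)
  case (single m c)
  show ?case
  proof (induction G rule: poly_mapping_single_induct)
    case (single m' c')
    show ?case
      by (simp add: mult_single mpoly_eval_single lookup_add power_add prod.distrib algebra_simps)
  qed (simp add: distrib_left mpoly_eval_add)
qed (simp add: distrib_right mpoly_eval_add)

lemma mpoly_eval_Const: "mpoly_eval (Const c) x = c"
  by (simp add: Const_def mpoly_eval_single)

lemma mpoly_eval_Var: "mpoly_eval (Var i) x = x $ i"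
proof -
  have "(\<Prod>j\<in>UNIV. (x $ j) ^ Poly_Mapping.lookup (Poly_Mapping.single i 1) j)
      = (\<Prod>j\<in>UNIV. if j = i then x $ j else 1)"
    by (rule prod.cong) (auto simp: lookup_single when_def)
  then show ?thesis by (simp add: Var_def mpoly_eval_single)
qed

lemma partial_deriv_superset:
  assumes "finite S" "Poly_Mapping.keys F \<subseteq> S"
  shows "partial_deriv i F = (\<Sum>m\<in>S. Poly_Mapping.single (m - Poly_Mapping.single i 1)
       (of_nat (Poly_Mapping.lookup m i) * Poly_Mapping.lookup F m))"
  unfolding partial_deriv_def
  by (rule sum.mono_neutral_left) (use assms in \<open>auto simp: in_keys_iff\<close>)

lemma partial_deriv_add: "partial_deriv i (F + G) = partial_deriv i F + partial_deriv i G"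
proof -
  let ?S = "Poly_Mapping.keys F \<union> Poly_Mapping.keys G"
  have *: "finite ?S" "Poly_Mapping.keys (F + G) \<subseteq> ?S"
    by (auto simp: Poly_Mapping.keys_add)
  show ?thesis
    using partial_deriv_superset[OF *] partial_deriv_superset[OF *(1), of F]
      partial_deriv_superset[OF *(1), of G]
    by (simp add: lookup_add sum.distrib distrib_left single_add)
qed

lemma partial_deriv_single:
  "partial_deriv i (Poly_Mapping.single m c) =
    Poly_Mapping.single (m - Poly_Mapping.single i 1) (of_nat (Poly_Mapping.lookup m i) * c)"
  by (cases "c = 0") (auto simp: partial_deriv_def lookup_single)

lemma partial_deriv_uminus: "partial_deriv i (- F) = - partial_deriv i F"
  by (simp add: partial_deriv_def single_uminus flip: sum_negf)

lemma partial_deriv_diff: "partial_deriv i (F - G) = partial_deriv i F - partial_deriv i G"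
  using partial_deriv_add[of i F "- G"] by (simp add: partial_deriv_uminus)

lemma minus_single_add:
  fixes m m' :: "'n \<Rightarrow>\<^sub>0 nat"
  assumes "Poly_Mapping.lookup m i \<noteq> 0"
  shows "m + m' - Poly_Mapping.single i 1 = (m - Poly_Mapping.single i 1) + m'"
  using assms
  by (intro poly_mapping_eqI) (auto simp: lookup_add lookup_minus lookup_single when_def)

lemma partial_deriv_mult:
  "partial_deriv i (F * G) = partial_deriv i F * G + F * partial_deriv i G"
proof (induction F rule: poly_mapping_single_induct)
  case (single m c)
  show ?case
  proof (induction G rule: poly_mapping_single_induct)
    case (single m' c')
    \<comment> \<open>Subtraction of exponents is truncated, so the exponents agree only if the
      variable occurs in \<open>m\<close>; if it does not, the coefficient is zero. The same holds
      for \<open>m'\<close> below.\<close>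
    have 1: "Poly_Mapping.single (m + m' - Poly_Mapping.single i 1) (of_nat (Poly_Mapping.lookup m i) * c * c')
      = Poly_Mapping.single (m - Poly_Mapping.single i 1 + m') (of_nat (Poly_Mapping.lookup m i) * c * c')"
      using minus_single_add[of m i m'] by (cases "Poly_Mapping.lookup m i = 0") simp_all
    have 2: "Poly_Mapping.single (m + m' - Poly_Mapping.single i 1) (of_nat (Poly_Mapping.lookup m' i) * c * c')
      = Poly_Mapping.single (m + (m' - Poly_Mapping.single i 1)) (of_nat (Poly_Mapping.lookup m' i) * c * c')"
      using minus_single_add[of m' i m] by (cases "Poly_Mapping.lookup m' i = 0") (simp_all add: add.commute)
    show ?case
      using 1 2
      by (simp add: mult_single partial_deriv_single lookup_add distrib_left distrib_right
          single_add mult.assoc mult.left_commute[of c "of_nat _"])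
  qed (simp add: distrib_left partial_deriv_add add_ac)
qed (simp add: distrib_right partial_deriv_add add_ac)

lemma partial_deriv_Const: "partial_deriv i (Const c) = 0"
  by (simp add: Const_def partial_deriv_single)

lemma partial_deriv_Var: "partial_deriv i (Var j) = (if i = j then 1 else 0)"
  by (auto simp: Var_def partial_deriv_single lookup_single when_def)

lemma mpoly_eval_0: "mpoly_eval 0 x = 0" and mpoly_eval_1: "mpoly_eval 1 x = 1"
  using mpoly_eval_Const[of 0 x] mpoly_eval_Const[of 1 x]
  by (simp_all add: Const_def)

lemmas mpoly_eval_simps =
  mpoly_eval_add mpoly_eval_diff mpoly_eval_mult mpoly_eval_Const mpoly_eval_Var mpoly_eval_0 mpoly_eval_1
lemmas partial_deriv_simps =
  partial_deriv_add partial_deriv_diff partial_deriv_mult partial_deriv_Const partial_deriv_Var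

section \<open>Nodes and trisecant lines\<close>

text \<open>The equation as a function, with coefficients collected. Only squarefree monomials
  occur: a cubic singular at the five coordinate points has no others. The node with all coordinates
  1 ties the ten coefficients to five parameters.\<close>

definition cubic_form :: "'a::comm_ring_1 ^ 5 \<Rightarrow> 'a ^ 5 \<Rightarrow> 'a" where
  "cubic_form b v =
     b$1 * (v$1 * v$2 * v$3) + b$2 * (v$1 * v$2 * v$4) + b$3 * (v$1 * v$2 * v$5)
   + b$4 * (v$1 * v$3 * v$4) + b$5 * (v$1 * v$3 * v$5)
   - (b$1 + b$2 + b$3 + b$4 + b$5) * (v$1 * v$4 * v$5)
   - (b$1 + b$2 + b$4) * (v$2 * v$3 * v$4) - (b$1 + b$3 + b$5) * (v$2 * v$3 * v$5)
   + (b$1 + b$4 + b$5) * (v$2 * v$4 * v$5) + (b$1 + b$2 + b$3) * (v$3 * v$4 * v$5)"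

lemma mpoly_eval_cubic: "mpoly_eval (cubic b) v = cubic_form b v"
  by (simp add: cubic_def Let_def mpoly_eval_simps cubic_form_def algebra_simps)

definition cubic_grad :: "'a::comm_ring_1 ^ 5 \<Rightarrow> 'a ^ 5 \<Rightarrow> 5 \<Rightarrow> 'a" where
  "cubic_grad b v i = mpoly_eval (partial_deriv i (cubic b)) v"

lemma cubic_grad_simps:
  "cubic_grad b v 1 = b$1 * (v$2 * v$3) + b$2 * (v$2 * v$4) + b$3 * (v$2 * v$5)
     + b$4 * (v$3 * v$4) + b$5 * (v$3 * v$5) - (b$1 + b$2 + b$3 + b$4 + b$5) * (v$4 * v$5)"
  "cubic_grad b v 2 = b$1 * (v$1 * v$3) + b$2 * (v$1 * v$4) + b$3 * (v$1 * v$5)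
     - (b$1 + b$2 + b$4) * (v$3 * v$4) - (b$1 + b$3 + b$5) * (v$3 * v$5)
     + (b$1 + b$4 + b$5) * (v$4 * v$5)"
  "cubic_grad b v 3 = b$1 * (v$1 * v$2) + b$4 * (v$1 * v$4) + b$5 * (v$1 * v$5)
     - (b$1 + b$2 + b$4) * (v$2 * v$4) - (b$1 + b$3 + b$5) * (v$2 * v$5)
     + (b$1 + b$2 + b$3) * (v$4 * v$5)"
  "cubic_grad b v 4 = b$2 * (v$1 * v$2) + b$4 * (v$1 * v$3)
     - (b$1 + b$2 + b$3 + b$4 + b$5) * (v$1 * v$5)
     - (b$1 + b$2 + b$4) * (v$2 * v$3) + (b$1 + b$4 + b$5) * (v$2 * v$5)
     + (b$1 + b$2 + b$3) * (v$3 * v$5)"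
  "cubic_grad b v 5 = b$3 * (v$1 * v$2) + b$5 * (v$1 * v$3)
     - (b$1 + b$2 + b$3 + b$4 + b$5) * (v$1 * v$4)
     - (b$1 + b$3 + b$5) * (v$2 * v$3) + (b$1 + b$4 + b$5) * (v$2 * v$4)
     + (b$1 + b$2 + b$3) * (v$3 * v$4)"
  by (simp_all add: cubic_grad_def cubic_def Let_def mpoly_eval_simps partial_deriv_simps algebra_simps)

lemma singular_at_cubic_iff:
  "singular_at (cubic b) v \<longleftrightarrow> cubic_form b v = 0 \<and> (\<forall>i. cubic_grad b v i = 0)"
  by (simp add: singular_at_def mpoly_eval_cubic cubic_grad_def)

definition vec5 :: "'a \<Rightarrow> 'a \<Rightarrow> 'a \<Rightarrow> 'a \<Rightarrow> 'a \<Rightarrow> 'a ^ 5" where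
  "vec5 x1 x2 x3 x4 x5 =
     (\<chi> i. if i = 1 then x1 else if i = 2 then x2 else if i = 3 then x3 else if i = 4 then x4 else x5)"

lemma vec5_nth:
  "vec5 x1 x2 x3 x4 x5 $ 1 = x1" "vec5 x1 x2 x3 x4 x5 $ 2 = x2" "vec5 x1 x2 x3 x4 x5 $ 3 = x3"
  "vec5 x1 x2 x3 x4 x5 $ 4 = x4" "vec5 x1 x2 x3 x4 x5 $ 5 = x5"
  by (simp_all add: vec5_def)

lemma cubic_form_0: "cubic_form b 0 = 0"
  by (simp add: cubic_form_def)

lemma cubic_form_scale: "cubic_form b (s *s v) = s ^ 3 * cubic_form b v"
  by (simp add: cubic_form_def algebra_simps power3_eq_cube)

lemma cubic_form_scale_coeffs: "cubic_form (s *s b) v = s * cubic_form b v"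
  by (simp add: cubic_form_def algebra_simps)

text \<open>Taylor expansion of a homogeneous cubic. It is symmetric in \<open>v\<close> and
  \<open>r\<close>: the quadratic term in \<open>s\<close> is the first-order term with the two
  vectors exchanged, so no second derivatives are needed.\<close>

lemma cubic_form_expand:
  "cubic_form b (v + s *s r) = cubic_form b v + s * (\<Sum>i\<in>UNIV. r$i * cubic_grad b v i)
     + s^2 * (\<Sum>i\<in>UNIV. v$i * cubic_grad b r i) + s^3 * cubic_form b r"
proof -
  have tri: "(x + s * x') * (y + s * y') * (z + s * z') = x * y * z
      + s * (x' * (y * z) + y' * (x * z) + z' * (x * y))
      + s^2 * (x * (y' * z') + y * (x' * z') + z * (x' * y')) + s^3 * (x' * y' * z')"
    for x y z x' y' z' :: 'a
    by (simp add: algebra_simps power2_eq_square power3_eq_cube)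
  show ?thesis
    unfolding sum_5 cubic_grad_simps cubic_form_def vector_add_component vector_smult_component tri
    by (simp only: distrib_left distrib_right left_diff_distrib right_diff_distrib mult.assoc
        add.assoc diff_conv_add_uminus minus_add_distrib minus_minus mult_minus_left
        mult_minus_right) (simp add: algebra_simps)
qed

section \<open>Vanishing coefficients and additional singular points\<close>

definition coeffs_nonzero :: "'a::comm_ring_1 ^ 5 \<Rightarrow> bool" where
  "coeffs_nonzero b \<longleftrightarrow> b$1 \<noteq> 0 \<and> b$2 \<noteq> 0 \<and> b$3 \<noteq> 0 \<and> b$4 \<noteq> 0 \<and> b$5 \<noteq> 0
     \<and> b$1 + b$2 + b$3 + b$4 + b$5 \<noteq> 0 \<and> b$1 + b$2 + b$4 \<noteq> 0 \<and> b$1 + b$3 + b$5 \<noteq> 0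
     \<and> b$1 + b$4 + b$5 \<noteq> 0 \<and> b$1 + b$2 + b$3 \<noteq> 0"

lemma hypersurface_cubic_mem_iff:
  assumes "v \<noteq> 0"
  shows "proj_point v \<in> hypersurface (cubic b) \<longleftrightarrow> cubic_form b v = 0"
proof
  assume "proj_point v \<in> hypersurface (cubic b)"
  then obtain w where w: "proj_point v = proj_point w" "cubic_form b w = 0"
    by (auto simp: hypersurface_def mpoly_eval_cubic)
  have "v \<in> proj_point v" unfolding proj_point_def by (force intro: exI[of _ 1])
  then obtain c where "v = c *s w" using w(1) by (auto simp: proj_point_def)
  then show "cubic_form b v = 0" using w(2) by (simp add: cubic_form_scale)
qed (use assms in \<open>auto simp: hypersurface_def mpoly_eval_cubic\<close>)

lemma proj_point_eqD:
  assumes "proj_point v = proj_point w"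
  shows "\<exists>c. c \<noteq> 0 \<and> v = c *s w"
proof -
  have "v \<in> proj_point v" unfolding proj_point_def by (force intro: exI[of _ 1])
  then show ?thesis using assms by (auto simp: proj_point_def)
qed

lemma singular_not_node_absurd:
  fixes b :: "'a::field ^ 5"
  assumes "singular_locus (cubic b) = node ` {1..6}"
    and "v \<noteq> 0" "singular_at (cubic b) v"
  obtains i c where "i \<in> {1..6}" "c \<noteq> 0" "v = c *s node_vec i"
proof -
  have "proj_point v \<in> node ` {1..6}"
    using assms by (auto simp: singular_locus_def)
  then show ?thesis
    using proj_point_eqD[of v] that unfolding node_def by blast
qed

text \<open>At the sum of three distinct unit vectors every partial derivative is plus or minus the
  coefficient of the product of the corresponding three variables. If that coefficient vanishes, the
  point is singular, and its coordinates show that it is none of the six nodes.\<close>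

lemma coeffs_nonzeroI:
  fixes b :: "'a::field_char_0 ^ 5"
  assumes "singular_locus (cubic b) = node ` {1..6}"
  shows "coeffs_nonzero b"
proof -
  have *: "\<not> singular_at (cubic b) (vec5 x1 x2 x3 x4 x5)"
    if "(x1, x2, x3, x4, x5) \<in> {(1,1,1,0,0), (1,1,0,1,0), (1,1,0,0,1), (1,0,1,1,0), (1,0,1,0,1),
      (0,1,1,1,0), (0,1,1,0,1), (1,0,0,1,1), (0,1,0,1,1), (0,0,1,1,1)}"
    for x1 x2 x3 x4 x5 :: 'a
  proof
    let ?v = "vec5 x1 x2 x3 x4 x5"
    assume sing: "singular_at (cubic b) ?v"
    have nz: "?v \<noteq> 0"
      using that by (auto simp: vec_eq_iff forall_5 vec5_nth)
    obtain n c where n: "n \<in> {1..6}" "?v = c *s node_vec n"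
      using singular_not_node_absurd[OF assms nz sing] .
    show False
      using n that unfolding interval_6
      by (auto simp: node_vec_def vec_eq_iff forall_5 vec5_nth axis_def)
  qed
  note sing = singular_at_cubic_iff forall_5 cubic_grad_simps cubic_form_def vec5_nth
  show ?thesis
    unfolding coeffs_nonzero_def
  proof (intro conjI notI)
    assume "b$1 = 0"
    then have "singular_at (cubic b) (vec5 1 1 1 0 0)" by (simp add: sing)
    then show False using *[of 1 1 1 0 0] by simp
  next
    assume "b$2 = 0"
    then have "singular_at (cubic b) (vec5 1 1 0 1 0)" by (simp add: sing)
    then show False using *[of 1 1 0 1 0] by simp
  next
    assume "b$3 = 0"
    then have "singular_at (cubic b) (vec5 1 1 0 0 1)" by (simp add: sing)
    then show False using *[of 1 1 0 0 1] by simp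
  next
    assume "b$4 = 0"
    then have "singular_at (cubic b) (vec5 1 0 1 1 0)" by (simp add: sing)
    then show False using *[of 1 0 1 1 0] by simp
  next
    assume "b$5 = 0"
    then have "singular_at (cubic b) (vec5 1 0 1 0 1)" by (simp add: sing)
    then show False using *[of 1 0 1 0 1] by simp
  next
    assume "b$1 + b$2 + b$3 + b$4 + b$5 = 0"
    then have "b$5 = - (b$1 + b$2 + b$3 + b$4)" by (metis eq_neg_iff_add_eq_0 add.commute)
    then have "singular_at (cubic b) (vec5 1 0 0 1 1)" by (simp add: sing)
    then show False using *[of 1 0 0 1 1] by simp
  next
    assume "b$1 + b$2 + b$4 = 0"
    then have "b$4 = - (b$1 + b$2)" by (metis eq_neg_iff_add_eq_0 add.commute)
    then have "singular_at (cubic b) (vec5 0 1 1 1 0)" by (simp add: sing)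
    then show False using *[of 0 1 1 1 0] by simp
  next
    assume "b$1 + b$3 + b$5 = 0"
    then have "b$5 = - (b$1 + b$3)" by (metis eq_neg_iff_add_eq_0 add.commute)
    then have "singular_at (cubic b) (vec5 0 1 1 0 1)" by (simp add: sing)
    then show False using *[of 0 1 1 0 1] by simp
  next
    assume "b$1 + b$4 + b$5 = 0"
    then have "b$5 = - (b$1 + b$4)" by (metis eq_neg_iff_add_eq_0 add.commute)
    then have "singular_at (cubic b) (vec5 0 1 0 1 1)" by (simp add: sing)
    then show False using *[of 0 1 0 1 1] by simp
  next
    assume "b$1 + b$2 + b$3 = 0"
    then have "b$3 = - (b$1 + b$2)" by (metis eq_neg_iff_add_eq_0 add.commute)
    then have "singular_at (cubic b) (vec5 0 0 1 1 1)" by (simp add: sing)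
    then show False using *[of 0 0 1 1 1] by simp
  qed
qed

text \<open>The points \<open>v\<close> and \<open>v + s *s r\<close> are the two further
  intersections of a line through \<open>r\<close>. Only the zeros of \<open>F\<close> are
  mentioned, so the notion survives every linear bijection that matches zero sets, whatever it does
  to the equations; see \<open>trisecant_free_transform\<close>.\<close>

definition trisecant_free :: "('a::comm_ring_1 ^ 5 \<Rightarrow> 'a) \<Rightarrow> 'a ^ 5 \<Rightarrow> bool" where
  "trisecant_free F r \<longleftrightarrow> F r = 0 \<and>
     (\<forall>v s u. s \<noteq> 0 \<longrightarrow> F v = 0 \<longrightarrow> F (v + s *s r) = 0 \<longrightarrow> F (v + u *s r) = 0)"

lemma cubic_grad_node_vec: "cubic_grad b (node_vec n) i = 0"
proof -
  have "\<forall>i. cubic_grad b (node_vec n) i = 0"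
    unfolding forall_5 cubic_grad_simps by (simp add: node_vec_def axis_def)
  then show ?thesis by blast
qed

lemma cubic_form_node_vec: "cubic_form b (node_vec n) = 0"
  by (simp add: cubic_form_def node_vec_def axis_def)

text \<open>At a singular point the terms in \<open>s^2\<close> and \<open>s^3\<close> of
  \<open>cubic_form_expand\<close> vanish. An affine function of \<open>s\<close> with two zeros is
  zero.\<close>

lemma trisecant_free_node_vec:
  fixes b :: "'a::field ^ 5"
  shows "trisecant_free (cubic_form b) (node_vec n)"
  by (auto simp: trisecant_free_def cubic_form_expand cubic_grad_node_vec cubic_form_node_vec)

lemma cubic_form_line_poly:
  obtains P where "\<And>t. cubic_form b (v + t *s w) = poly P t"
proof
  fix t
  show "cubic_form b (v + t *s w) =
      poly [: cubic_form b v, \<Sum>i\<in>UNIV. w$i * cubic_grad b v i,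
         \<Sum>i\<in>UNIV. v$i * cubic_grad b w i, cubic_form b w :] t"
    unfolding cubic_form_expand by (simp add: algebra_simps power2_eq_square power3_eq_cube)
qed

text \<open>Most lines through a smooth point of the hypersurface meet it in two further points. If none
  did, the discriminant \<open>q\<^sup>2 - 4lF\<close> below would vanish identically, and
  then the cubic would contain the hyperplane \<open>l = 0\<close>.\<close>

lemma trisecant_free_vanish_on_tangent:
  fixes b :: "'k::{alg_closed_field, field_char_0} ^ 5"
  defines "F \<equiv> cubic_form b"
  assumes tf: "trisecant_free F r"
  defines "l \<equiv> \<lambda>v. \<Sum>i\<in>UNIV. v$i * cubic_grad b r i"
  assumes w: "l w \<noteq> 0" and v: "l v = 0"
  shows "F v = 0"
proof -
  define q where "q = (\<lambda>v. \<Sum>i\<in>UNIV. r$i * cubic_grad b v i)"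
  have Fr: "F r = 0" using tf by (simp add: trisecant_free_def)
  have exp: "F (v + s *s r) = F v + s * q v + s^2 * l v" for v s
    using Fr unfolding F_def by (simp add: cubic_form_expand q_def l_def)
  have disc: "q v ^ 2 = 4 * l v * F v" if lv: "l v \<noteq> 0" for v
  proof (rule ccontr)
    assume ne: "q v ^ 2 \<noteq> 4 * l v * F v"
    obtain e where e: "e ^ 2 = q v ^ 2 - 4 * l v * F v"
      using nth_root_exists[of 2] by (metis zero_less_numeral)
    have "e \<noteq> 0" using ne e by auto
    define s1 s2 where "s1 = (- q v + e) / (2 * l v)" and "s2 = (- q v - e) / (2 * l v)"
    have "s2 - s1 \<noteq> 0" using \<open>e \<noteq> 0\<close> lv by (simp add: s1_def s2_def field_simps)
    have root: "F v + s * q v + s^2 * l v = 0" if "s * (2 * l v) = - q v + e'" "e'^2 = e^2" for s e'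
    proof -
      have "4 * l v * (F v + s * q v + s^2 * l v) = (s * (2 * l v) + q v)^2 - (q v ^ 2 - 4 * l v * F v)"
        by algebra
      also have "\<dots> = 0" using that e by simp
      finally show ?thesis using lv by simp
    qed
    have 1: "F (v + s1 *s r) = 0"
      unfolding exp by (rule root[of _ e]) (use lv in \<open>simp_all add: s1_def\<close>)
    have 2: "F (v + s2 *s r) = 0"
      unfolding exp by (rule root[of _ "- e"]) (use lv in \<open>simp_all add: s2_def\<close>)
    have shift: "v + s1 *s r + (s - s1) *s r = v + s *s r" for s
      by simp
    have all: "F (v + s *s r) = 0" for s
      using tf \<open>s2 - s1 \<noteq> 0\<close> 1 2 shift unfolding trisecant_free_def by metis
    \<comment> \<open>The form is quadratic along the line, and its second difference recovers the
      leading coefficient \<open>l v\<close>, which would then be zero.\<close>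
    have "l v + l v = F (v + 1 *s r) + F (v + (-1) *s r) - 2 * F (v + 0 *s r)"
      unfolding exp by simp
    then have "l v + l v = 0" unfolding all by simp
    then show False using lv by simp
  qed
  obtain P where P: "\<And>t. F (v + t *s w) = poly P t"
    using cubic_form_line_poly unfolding F_def by metis
  obtain P1 where P1: "\<And>t. F ((v + r) + t *s w) = poly P1 t"
    using cubic_form_line_poly unfolding F_def by metis
  obtain P2 where P2: "\<And>t. F ((v - r) + t *s w) = poly P2 t"
    using cubic_form_line_poly unfolding F_def by metis
  \<comment> \<open>\<open>Q\<close> is \<open>q\<close> along the line through \<open>v\<close> in
    direction \<open>w\<close>. Since \<open>q\<close> is the odd part of the quadratic polynomial
    in \<open>s\<close>, it is half a difference of values of \<open>F\<close>, hence
    polynomial.\<close>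
  define Q where "Q = smult (1/2) (P1 - P2)"
  have q2: "2 * q v = F (v + r) - F (v - r)" for v
    using exp[of v 1] exp[of v "-1"] by simp
  have Q: "poly Q t = q (v + t *s w)" for t
    using q2[of "v + t *s w"] P1[of t] P2[of t]
    by (simp add: Q_def algebra_simps)
  have lt: "l (v + t *s w) = t * l w" for t
    using v by (simp add: l_def distrib_right sum.distrib mult.assoc flip: sum_distrib_left)
  \<comment> \<open>The discriminant identity is known only off the hyperplane, i.e. for nonzero
    \<open>t\<close>, but then holds as an identity of polynomials. So \<open>t\<close> divides the
    square of \<open>Q\<close>, hence \<open>Q\<close>; then \<open>t\<close> also divides
    \<open>P\<close>, and \<open>P\<close> at 0 is \<open>F v\<close>.\<close>
  have "poly (Q ^ 2) t = poly (smult (4 * l w) (pCons 0 P)) t" if "t \<noteq> 0" for t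
    using disc[of "v + t *s w"] that w by (simp add: Q lt P)
  then have "{t. t \<noteq> 0} \<subseteq> {t. poly (Q ^ 2 - smult (4 * l w) (pCons 0 P)) t = 0}"
    by auto
  moreover have "infinite {t::'k. t \<noteq> 0}"
    using infinite_UNIV_char_0[where 'a = 'k] by (metis (full_types) finite_Collect_not finite_insert finite.emptyI singleton_conv)
  ultimately have eq: "Q ^ 2 = smult (4 * l w) (pCons 0 P)"
    using poly_roots_finite finite_subset by (metis eq_iff_diff_eq_0)
  then have "poly (Q ^ 2) 0 = 0" by simp
  then obtain Q' where "Q = pCons 0 Q'"
    by (metis pCons_cases poly_pCons mult_zero_left add.right_neutral poly_power power_eq_0_iff)
  with eq have "pCons 0 (Q' * pCons 0 Q') = pCons 0 (smult (4 * l w) P)"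
    by (simp add: power2_eq_square)
  then have "poly (Q' * pCons 0 Q') 0 = poly (smult (4 * l w) P) 0"
    by (metis pCons_eq_iff)
  then show ?thesis using P[of 0] w by simp
qed

text \<open>Otherwise the cubic contains the hyperplane orthogonal to the gradient \<open>g\<close>.
  On the span of three unit vectors the cubic is a nonzero multiple of the product of three
  coordinates, and such a product vanishes on a linear section only if exactly one of the three
  entries of \<open>g\<close> is nonzero. These conditions for several triples are
  incompatible.\<close>

lemma trisecant_free_cubic_form_imp_grad_0:
  fixes b :: "'k::{alg_closed_field, field_char_0} ^ 5"
  assumes nz: "coeffs_nonzero b" and tf: "trisecant_free (cubic_form b) r"
  shows "cubic_grad b r i = 0"
proof (rule ccontr)
  assume i: "cubic_grad b r i \<noteq> 0"
  define g where "g = cubic_grad b r"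
  have "(\<Sum>j\<in>UNIV. (axis i 1 :: 'k ^ 5) $ j * cubic_grad b r j) = cubic_grad b r i"
    by (simp add: axis_def if_distrib[of "\<lambda>x. x * _"] cong: if_cong)
  then have van: "cubic_form b v = 0" if "(\<Sum>j\<in>UNIV. v$j * g j) = 0" for v
    using trisecant_free_vanish_on_tangent[OF tf, of "axis i 1" v] i that by (simp add: g_def)
  have lin: "(x \<noteq> 0 \<and> y = 0 \<and> z = 0) \<or> (x = 0 \<and> y \<noteq> 0 \<and> z = 0) \<or> (x = 0 \<and> y = 0 \<and> z \<noteq> 0)"
    if *: "\<And>p q r. p * x + q * y + r * z = 0 \<Longrightarrow> p * q * r = 0" for x y z :: 'k
  proof -
    \<comment> \<open>At most one value of \<open>p\<close> annihilates \<open>p * x + z\<close>, so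
      1 or 2 will do, and \<open>q\<close> is then determined and nonzero. Thus two nonzero
      coefficients give a kernel vector without zero entries.\<close>
    have two: "\<exists>p q. p \<noteq> 0 \<and> q \<noteq> 0 \<and> p * x + q * y + z = 0" if "x \<noteq> 0" "y \<noteq> 0" for x y z :: 'k
    proof -
      have "\<exists>p. p \<noteq> 0 \<and> p * x + z \<noteq> 0"
      proof (cases "x + z = 0")
        case True
        have "2 * x + z = x + (x + z)" by simp
        then have "2 * x + z \<noteq> 0" using True that by (metis add.right_neutral)
        then show ?thesis by (intro exI[of _ 2]) auto
      next
        case False
        then show ?thesis by (intro exI[of _ 1]) auto
      qed
      then obtain p where p: "p \<noteq> 0" "p * x + z \<noteq> 0" by blast
      have "p * x + (- (p * x + z) / y) * y + z = 0" using that by simp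
      moreover have "- (p * x + z) / y \<noteq> 0" using that p by (metis divide_eq_0_iff neg_equal_0_iff_equal)
      ultimately show ?thesis using p by blast
    qed
    have "\<not> (x = 0 \<and> y = 0 \<and> z = 0)" using *[of 1 1 1] by auto
    moreover have "\<not> (x \<noteq> 0 \<and> y \<noteq> 0)"
    proof
      assume "x \<noteq> 0 \<and> y \<noteq> 0"
      then obtain p q where "p \<noteq> 0" "q \<noteq> 0" "p * x + q * y + z = 0" using two[of x y z] by auto
      then show False using *[of p q 1] by simp
    qed
    moreover have "\<not> (x \<noteq> 0 \<and> z \<noteq> 0)"
    proof
      assume "x \<noteq> 0 \<and> z \<noteq> 0"
      then obtain p r where "p \<noteq> 0" "r \<noteq> 0" "p * x + r * z + y = 0" using two[of x z y] by auto
      then show False using *[of p 1 r] by (simp add: add_ac)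
    qed
    moreover have "\<not> (y \<noteq> 0 \<and> z \<noteq> 0)"
    proof
      assume "y \<noteq> 0 \<and> z \<noteq> 0"
      then obtain q r where "q \<noteq> 0" "r \<noteq> 0" "q * y + r * z + x = 0" using two[of y z x] by auto
      then show False using *[of 1 q r] by (simp add: add_ac)
    qed
    ultimately show ?thesis by blast
  qed
  have v: "p * q * r = 0" if "cubic_form b (vec5 x1 x2 x3 x4 x5) = c * (p * q * r)" "c \<noteq> 0"
      "x1 * g 1 + x2 * g 2 + x3 * g 3 + x4 * g 4 + x5 * g 5 = 0" for p q r x1 x2 x3 x4 x5 c
    using van[of "vec5 x1 x2 x3 x4 x5"] that by (simp add: sum_5 vec5_nth)
  have nzc: "b$1 \<noteq> 0" "- (b$1 + b$2 + b$3 + b$4 + b$5) \<noteq> 0" "- (b$1 + b$2 + b$4) \<noteq> 0"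
    "- (b$1 + b$3 + b$5) \<noteq> 0" "b$1 + b$4 + b$5 \<noteq> 0"
    using nz unfolding coeffs_nonzero_def neg_equal_0_iff_equal by blast+
  note s = cubic_form_def vec5_nth
  have "(g 1 \<noteq> 0 \<and> g 2 = 0 \<and> g 3 = 0) \<or> (g 1 = 0 \<and> g 2 \<noteq> 0 \<and> g 3 = 0) \<or> (g 1 = 0 \<and> g 2 = 0 \<and> g 3 \<noteq> 0)"
  proof (rule lin)
    fix p q r assume "p * g 1 + q * g 2 + r * g 3 = 0"
    then show "p * q * r = 0"
      by (intro v[of p q r 0 0 "b$1", OF _ nzc(1)]) (simp_all add: s del: minus_add_distrib)
  qed
  moreover
  have "(g 1 \<noteq> 0 \<and> g 4 = 0 \<and> g 5 = 0) \<or> (g 1 = 0 \<and> g 4 \<noteq> 0 \<and> g 5 = 0) \<or> (g 1 = 0 \<and> g 4 = 0 \<and> g 5 \<noteq> 0)"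
  proof (rule lin)
    fix p q r assume "p * g 1 + q * g 4 + r * g 5 = 0"
    then show "p * q * r = 0"
      by (intro v[of p 0 0 q r "- (b$1 + b$2 + b$3 + b$4 + b$5)", OF _ nzc(2)]) (simp_all add: s del: minus_add_distrib)
  qed
  moreover
  have "(g 2 \<noteq> 0 \<and> g 3 = 0 \<and> g 4 = 0) \<or> (g 2 = 0 \<and> g 3 \<noteq> 0 \<and> g 4 = 0) \<or> (g 2 = 0 \<and> g 3 = 0 \<and> g 4 \<noteq> 0)"
  proof (rule lin)
    fix p q r assume "p * g 2 + q * g 3 + r * g 4 = 0"
    then show "p * q * r = 0"
      by (intro v[of 0 p q r 0 "- (b$1 + b$2 + b$4)", OF _ nzc(3)]) (simp_all add: s del: minus_add_distrib)
  qed
  moreover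
  have "(g 2 \<noteq> 0 \<and> g 3 = 0 \<and> g 5 = 0) \<or> (g 2 = 0 \<and> g 3 \<noteq> 0 \<and> g 5 = 0) \<or> (g 2 = 0 \<and> g 3 = 0 \<and> g 5 \<noteq> 0)"
  proof (rule lin)
    fix p q r assume "p * g 2 + q * g 3 + r * g 5 = 0"
    then show "p * q * r = 0"
      by (intro v[of 0 p q 0 r "- (b$1 + b$3 + b$5)", OF _ nzc(4)]) (simp_all add: s del: minus_add_distrib)
  qed
  moreover
  have "(g 2 \<noteq> 0 \<and> g 4 = 0 \<and> g 5 = 0) \<or> (g 2 = 0 \<and> g 4 \<noteq> 0 \<and> g 5 = 0) \<or> (g 2 = 0 \<and> g 4 = 0 \<and> g 5 \<noteq> 0)"
  proof (rule lin)
    fix p q r assume "p * g 2 + q * g 4 + r * g 5 = 0"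
    then show "p * q * r = 0"
      by (intro v[of 0 p 0 q r "b$1 + b$4 + b$5", OF _ nzc(5)]) (simp_all add: s del: minus_add_distrib)
  qed
  \<comment> \<open>If \<open>g 1\<close> is nonzero, all other entries vanish and the triple 2, 3,
    4 has no nonzero entry. If \<open>g 1\<close> is zero, one of \<open>g 2\<close>,
    \<open>g 3\<close> and one of \<open>g 4\<close>, \<open>g 5\<close> is nonzero, which puts two
    nonzero entries into the triple 2, 3, 4 or 2, 3, 5.\<close>
  ultimately show False by argo
qed

section \<open>Triple sums as coefficients\<close>

lemma four_term_ratio:
  fixes c1 c2 c3 c4 d1 d2 d3 d4 :: "'a::field_char_0"
  assumes nz: "c1 \<noteq> 0" "c2 \<noteq> 0" "c3 \<noteq> 0" "c4 \<noteq> 0"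
    and zeros: "\<And>x1 x2 x3 x4. c1 * (x2 * x3 * x4) + c2 * (x1 * x3 * x4) + c3 * (x1 * x2 * x4) + c4 * (x1 * x2 * x3) = 0
      \<Longrightarrow> d1 * (x2 * x3 * x4) + d2 * (x1 * x3 * x4) + d3 * (x1 * x2 * x4) + d4 * (x1 * x2 * x3) = 0"
  shows "d2 / c2 = d1 / c1 \<and> d3 / c3 = d1 / c1 \<and> d4 / c4 = d1 / c1"
proof -
  \<comment> \<open>With \<open>x\<^sub>m = e\<^sub>m c\<^sub>m\<close> and signs \<open>e\<^sub>m\<close> of sum zero both sides become linear
    in the reciprocals of the \<open>x\<^sub>m\<close>.\<close>
  have *: "e1 * (d1 / c1) + e2 * (d2 / c2) + e3 * (d3 / c3) + e4 * (d4 / c4) = 0"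
    if e: "e1 + e2 + e3 + e4 = 0" "e1 ^ 2 = 1" "e2 ^ 2 = 1" "e3 ^ 2 = 1" "e4 ^ 2 = 1" for e1 e2 e3 e4 :: 'a
  proof -
    have "c1 * c2 * c3 * c4 * (e2 * e3 * e4 + e1 * e3 * e4 + e1 * e2 * e4 + e1 * e2 * e3) = 0"
    proof -
      have "e2 * e3 * e4 + e1 * e3 * e4 + e1 * e2 * e4 + e1 * e2 * e3 = 0"
        using e by algebra
      then show ?thesis by simp
    qed
    then have "c1 * ((e2 * c2) * (e3 * c3) * (e4 * c4)) + c2 * ((e1 * c1) * (e3 * c3) * (e4 * c4))
        + c3 * ((e1 * c1) * (e2 * c2) * (e4 * c4)) + c4 * ((e1 * c1) * (e2 * c2) * (e3 * c3)) = 0"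
      by (simp add: algebra_simps)
    from zeros[OF this]
    have "e1 * d1 * (c2 * c3 * c4) + e2 * d2 * (c1 * c3 * c4) + e3 * d3 * (c1 * c2 * c4)
      + e4 * d4 * (c1 * c2 * c3) = 0"
      using e by algebra
    then show ?thesis using nz by (simp add: field_simps)
  qed
  have "d1 / c1 + d2 / c2 = d3 / c3 + d4 / c4" "d1 / c1 + d3 / c3 = d2 / c2 + d4 / c4"
    "d1 / c1 + d4 / c4 = d2 / c2 + d3 / c3"
    using *[of 1 1 "-1" "-1"] *[of 1 "-1" 1 "-1"] *[of 1 "-1" "-1" 1] by (simp_all add: algebra_simps)
  then show ?thesis by algebra
qed

text \<open>On the coordinate hyperplanes where the fifth or the fourth coordinate vanishes, the
  cubic has four squarefree terms in four variables, so \<open>four_term_ratio\<close> applies. Both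
  sections contain the coefficient \<open>b$1\<close>, which links the two common ratios.\<close>

lemma same_zeros_imp_proportional:
  fixes b d :: "'a::field_char_0 ^ 5"
  assumes "coeffs_nonzero b" "coeffs_nonzero d"
    and zeros: "\<And>v. cubic_form b v = 0 \<Longrightarrow> cubic_form d v = 0"
  shows "\<exists>c. c \<noteq> 0 \<and> d = c *s b"
proof -
  have nz: "b$1 \<noteq> 0" "b$2 \<noteq> 0" "b$3 \<noteq> 0" "b$4 \<noteq> 0" "b$5 \<noteq> 0"
    "- (b$1 + b$2 + b$4) \<noteq> 0" "- (b$1 + b$3 + b$5) \<noteq> 0"
    using assms(1) unfolding coeffs_nonzero_def neg_equal_0_iff_equal by blast+
  have e1: "cubic_form b (vec5 x1 x2 x3 x4 0) = - (b$1 + b$2 + b$4) * (x2 * x3 * x4)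
      + b$4 * (x1 * x3 * x4) + b$2 * (x1 * x2 * x4) + b$1 * (x1 * x2 * x3)"
    and e2: "cubic_form b (vec5 x1 x2 x3 0 x4) = - (b$1 + b$3 + b$5) * (x2 * x3 * x4)
      + b$5 * (x1 * x3 * x4) + b$3 * (x1 * x2 * x4) + b$1 * (x1 * x2 * x3)"
    for x1 x2 x3 x4 and b :: "'a ^ 5"
    by (simp_all add: cubic_form_def vec5_nth algebra_simps)
  have "d$4 / b$4 = (- (d$1 + d$2 + d$4)) / (- (b$1 + b$2 + b$4)) \<and>
      d$2 / b$2 = (- (d$1 + d$2 + d$4)) / (- (b$1 + b$2 + b$4)) \<and>
      d$1 / b$1 = (- (d$1 + d$2 + d$4)) / (- (b$1 + b$2 + b$4))"
    by (rule four_term_ratio) (use nz zeros in \<open>unfold e1[symmetric], blast+\<close>)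
  moreover have "d$5 / b$5 = (- (d$1 + d$3 + d$5)) / (- (b$1 + b$3 + b$5)) \<and>
      d$3 / b$3 = (- (d$1 + d$3 + d$5)) / (- (b$1 + b$3 + b$5)) \<and>
      d$1 / b$1 = (- (d$1 + d$3 + d$5)) / (- (b$1 + b$3 + b$5))"
    by (rule four_term_ratio) (use nz zeros in \<open>unfold e2[symmetric], blast+\<close>)
  ultimately have "d$2 / b$2 = d$1 / b$1" "d$3 / b$3 = d$1 / b$1" "d$4 / b$4 = d$1 / b$1"
    "d$5 / b$5 = d$1 / b$1" by metis+
  then have "d = (d$1 / b$1) *s b"
    using nz(1-5) unfolding vec_eq_iff forall_5 vector_smult_component by (metis nonzero_divide_eq_eq)
  moreover have "d$1 / b$1 \<noteq> 0" using assms nz by (simp add: coeffs_nonzero_def)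
  ultimately show ?thesis by blast
qed

text \<open>The cubics of the family form a five-dimensional representation of the symmetric group
  of degree 6. These sums identify it, up to signs of permutations, with the vectors of sum zero in
  the permutation representation twisted by an outer automorphism; \<open>realizes_adj\<close> is
  the verification.\<close>

definition ycoeffs :: "(nat \<Rightarrow> 'a::comm_ring_1) \<Rightarrow> 'a ^ 5" where
  "ycoeffs y = vec5 (y 3 + y 4 + y 5) (y 1 + y 5 + y 6) (y 2 + y 3 + y 6) (y 1 + y 2 + y 3) (y 1 + y 4 + y 6)"

lemma sum_interval_6: "sum f {1..6::nat} = f 1 + f 2 + f 3 + f 4 + f 5 + f 6"
  unfolding interval_6 by (simp add: add_ac)

lemma ball_interval_6: "(\<forall>i\<in>{1..6::nat}. P i) \<longleftrightarrow> P 1 \<and> P 2 \<and> P 3 \<and> P 4 \<and> P 5 \<and> P 6"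
  unfolding interval_6 by simp

lemma ycoeffs_proportionalD:
  fixes y z :: "nat \<Rightarrow> 'a::field_char_0"
  assumes "sum y {1..6} = 0" "sum z {1..6} = 0" "ycoeffs z = c *s ycoeffs y" "i \<in> {1..6}"
  shows "z i = c * y i"
proof -
  define w where "w i = z i - c * y i" for i
  have w0: "w 1 + w 2 + w 3 + w 4 + w 5 + w 6 = 0"
    using assms(1,2) unfolding w_def sum_interval_6 by algebra
  have eqs: "w 3 + w 4 + w 5 = 0" "w 1 + w 5 + w 6 = 0" "w 2 + w 3 + w 6 = 0" "w 1 + w 2 + w 3 = 0"
    "w 1 + w 4 + w 6 = 0"
    using assms(3) unfolding w_def vec_eq_iff forall_5 ycoeffs_def vector_smult_component vec5_nth
    by algebra+
  have "3 * w 1 = 0" "3 * w 2 = 0" "3 * w 3 = 0" "3 * w 4 = 0" "3 * w 5 = 0" "3 * w 6 = 0"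
    using w0 eqs by algebra+
  then have "\<forall>i\<in>{1..6}. w i = 0" unfolding ball_interval_6 by simp
  then show ?thesis using assms(4) unfolding w_def by fastforce
qed

lemma ex_ycoeffs:
  fixes b :: "'a::field_char_0 ^ 5"
  obtains y where "sum y {1..6} = 0" "ycoeffs y = b"
proof
  \<comment> \<open>\<open>s\<close> stands for \<open>y 1 + y 6\<close>. In terms of it the
    equations for \<open>b$2\<close>, \<open>b$5\<close>, \<open>b$1\<close> and \<open>b$4\<close>
    are solved one after the other, and the equation for \<open>b$3\<close> becomes the stated value
    of \<open>3 * s\<close>.\<close>
  define s where "s = (2 * b$2 + b$3 + b$4 + 2 * b$5) / 3"
  define y :: "nat \<Rightarrow> 'a" where "y i = (if i = 1 then b$2 + b$4 + b$5 - s
    else if i = 2 then - b$1 - s else if i = 3 then b$1 - b$2 - b$5 + 2 * s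
    else if i = 4 then b$5 - s else if i = 5 then b$2 - s else 2 * s - b$2 - b$4 - b$5)" for i
  have y: "y 1 = b$2 + b$4 + b$5 - s" "y 2 = - b$1 - s" "y 3 = b$1 - b$2 - b$5 + 2 * s"
    "y 4 = b$5 - s" "y 5 = b$2 - s" "y 6 = 2 * s - b$2 - b$4 - b$5"
    by (simp_all add: y_def)
  have s: "3 * s = 2 * b$2 + b$3 + b$4 + 2 * b$5" by (simp add: s_def)
  show "sum y {1..6} = 0" unfolding sum_interval_6 y by simp
  show "ycoeffs y = b"
    unfolding ycoeffs_def vec_eq_iff forall_5 vec5_nth y using s
    by (simp add: algebra_simps)
qed

lemma cubic_form_eq_imp_eq:
  fixes b d :: "'a::comm_ring_1 ^ 5"
  assumes "\<And>v. cubic_form b v = cubic_form d v"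
  shows "b = d"
  using assms[of "vec5 1 1 1 0 0"] assms[of "vec5 1 1 0 1 0"] assms[of "vec5 1 1 0 0 1"]
    assms[of "vec5 1 0 1 1 0"] assms[of "vec5 1 0 1 0 1"]
  by (simp add: vec_eq_iff forall_5 cubic_form_def vec5_nth)

definition no_zero_triple :: "(nat \<Rightarrow> 'a::comm_ring_1) \<Rightarrow> bool" where
  "no_zero_triple y \<longleftrightarrow> (\<forall>T. T \<subseteq> {1..6} \<and> card T = 3 \<longrightarrow> sum y T \<noteq> 0)"

lemma no_zero_tripleD:
  assumes "no_zero_triple y" "distinct [i, j, k]" "i \<in> {1..6}" "j \<in> {1..6}" "k \<in> {1..6}"
  shows "y i + y j + y k \<noteq> 0"
proof -
  have "sum y {i, j, k} \<noteq> 0"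
    using assms(1)[unfolded no_zero_triple_def, rule_format, of "{i, j, k}"] assms(2-)
    by (auto simp: card_insert_if)
  then show ?thesis using assms(2) by (simp add: add.assoc)
qed

lemma ycoeffs_triples:
  fixes y :: "nat \<Rightarrow> 'a::field"
  assumes "sum y {1..6} = 0"
  defines "b \<equiv> ycoeffs y"
  shows "b$1 = y 3 + y 4 + y 5" "b$2 = y 1 + y 5 + y 6" "b$3 = y 2 + y 3 + y 6"
    "b$4 = y 1 + y 2 + y 3" "b$5 = y 1 + y 4 + y 6"
    "b$1 + b$2 + b$3 + b$4 + b$5 = y 1 + y 3 + y 6" "b$1 + b$2 + b$4 = y 1 + y 3 + y 5"
    "b$1 + b$3 + b$5 = y 3 + y 4 + y 6" "b$1 + b$4 + b$5 = y 1 + y 3 + y 4"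
    "b$1 + b$2 + b$3 = y 3 + y 5 + y 6"
proof -
  have y6: "y 6 = - (y 1 + y 2 + y 3 + y 4 + y 5)"
    using assms(1) unfolding sum_interval_6 by (metis eq_neg_iff_add_eq_0 add.commute)
  show "b$1 = y 3 + y 4 + y 5" "b$2 = y 1 + y 5 + y 6" "b$3 = y 2 + y 3 + y 6"
    "b$4 = y 1 + y 2 + y 3" "b$5 = y 1 + y 4 + y 6"
    "b$1 + b$2 + b$3 + b$4 + b$5 = y 1 + y 3 + y 6" "b$1 + b$2 + b$4 = y 1 + y 3 + y 5"
    "b$1 + b$3 + b$5 = y 3 + y 4 + y 6" "b$1 + b$4 + b$5 = y 1 + y 3 + y 4"
    "b$1 + b$2 + b$3 = y 3 + y 5 + y 6"
    by (simp_all add: b_def ycoeffs_def vec5_nth y6)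
qed

lemma coeffs_nonzero_ycoeffs_iff:
  fixes y :: "nat \<Rightarrow> 'a::field"
  assumes y0: "sum y {1..6} = 0"
  shows "coeffs_nonzero (ycoeffs y) \<longleftrightarrow> no_zero_triple y"
proof
  show "coeffs_nonzero (ycoeffs y)" if t: "no_zero_triple y"
    \<comment> \<open>The longest sums are rewritten first, because rewriting the single entries
      earlier would destroy the left-hand sides of the other equations.\<close>
    unfolding coeffs_nonzero_def ycoeffs_triples(6)[OF y0]
    unfolding ycoeffs_triples(7-10)[OF y0] unfolding ycoeffs_triples(1-5)[OF y0]
    by (intro conjI no_zero_tripleD[OF t]) auto
  show "no_zero_triple y" if "coeffs_nonzero (ycoeffs y)"
    unfolding no_zero_triple_def
  proof (intro allI impI)
    fix T assume T: "T \<subseteq> {1..6::nat} \<and> card T = 3"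
    \<comment> \<open>A triple becomes six truth values with three of them true. Of the twenty
      triples, ten are coefficients, and \<open>compl\<close> turns the other ten into negatives of
      these.\<close>
    define f where "f m \<longleftrightarrow> m \<in> T" for m
    have fin: "T = {m \<in> {1..6}. f m}" using T by (auto simp: f_def)
    have "card T = sum (\<lambda>m. if f m then 1 else 0) {1..6}"
      unfolding fin by (simp add: sum.If_cases Int_def)
    then have c: "of_bool (f 1) + of_bool (f 2) + of_bool (f 3) + of_bool (f 4) + of_bool (f 5) + of_bool (f 6) = (3::nat)"
      using T unfolding sum_interval_6 of_bool_def by simp
    have "sum y T = sum (\<lambda>m. if f m then y m else 0) {1..6}"
      unfolding fin by (simp add: sum.If_cases Int_def)
    then have s: "sum y T = (if f 1 then y 1 else 0) + (if f 2 then y 2 else 0) + (if f 3 then y 3 else 0)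
       + (if f 4 then y 4 else 0) + (if f 5 then y 5 else 0) + (if f 6 then y 6 else 0)"
      unfolding sum_interval_6 .
    note nz = that[unfolded coeffs_nonzero_def ycoeffs_triples(6)[OF y0],
      unfolded ycoeffs_triples(7-10)[OF y0], unfolded ycoeffs_triples(1-5)[OF y0]]
    have compl: "y 1 + y 2 + y 6 = - (y 3 + y 4 + y 5)" "y 2 + y 3 + y 4 = - (y 1 + y 5 + y 6)"
      "y 1 + y 4 + y 5 = - (y 2 + y 3 + y 6)" "y 4 + y 5 + y 6 = - (y 1 + y 2 + y 3)"
      "y 2 + y 3 + y 5 = - (y 1 + y 4 + y 6)" "y 2 + y 4 + y 5 = - (y 1 + y 3 + y 6)"
      "y 2 + y 4 + y 6 = - (y 1 + y 3 + y 5)" "y 1 + y 2 + y 5 = - (y 3 + y 4 + y 6)"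
      "y 2 + y 5 + y 6 = - (y 1 + y 3 + y 4)" "y 1 + y 2 + y 4 = - (y 3 + y 5 + y 6)"
      using y0 unfolding sum_interval_6 by algebra+
    show "sum y T \<noteq> 0"
      unfolding s using c
      by (cases "f 1"; cases "f 2"; cases "f 3"; cases "f 4"; cases "f 5"; cases "f 6";
          (simp only: if_True if_False add_0_left add_0_right compl neg_equal_0_iff_equal nz of_bool_eq
            simp_thms | simp)+)
  qed
qed

section \<open>The outer automorphism of the symmetric group\<close>

abbreviation (input) swap :: "'a \<Rightarrow> 'a \<Rightarrow> 'a \<Rightarrow> 'a" where
  "swap \<equiv> Transposition.transpose"

text \<open>One-line notation, so that products and equality of permutations become computations
  with lists.\<close>

definition perm6 :: "nat list \<Rightarrow> nat \<Rightarrow> nat" where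
  "perm6 xs i = (if i \<in> {1..6} then xs ! (i - 1) else i)"

lemma perm6_simps:
  "perm6 [a, b, c, d, e, f] 1 = a" "perm6 [a, b, c, d, e, f] 2 = b" "perm6 [a, b, c, d, e, f] 3 = c"
  "perm6 [a, b, c, d, e, f] 4 = d" "perm6 [a, b, c, d, e, f] 5 = e" "perm6 [a, b, c, d, e, f] 6 = f"
  by (simp_all add: perm6_def nth_Cons')

lemma perm6_permutes:
  assumes "length xs = 6" "set xs = {1..6}"
  shows "perm6 xs permutes {1..6}"
proof (rule bij_imp_permutes)
  have "perm6 xs ` {1..6} = set xs"
  proof -
    have "{1..6::nat} = Suc ` {..<6}" by (simp add: image_Suc_lessThan)
    then have "perm6 xs ` {1..6} = (\<lambda>i. xs ! i) ` {..<length xs}"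
      using assms(1) by (auto simp: perm6_def image_image)
    then show ?thesis by (auto simp: set_conv_nth)
  qed
  then show "bij_betw (perm6 xs) {1..6} {1..6}"
    using assms(2) by (simp add: bij_betw_def eq_card_imp_inj_on)
qed (auto simp: perm6_def)

lemma perm6_comp:
  assumes "length ys = 6" "set ys \<subseteq> {1..6}"
  shows "perm6 xs \<circ> perm6 ys = perm6 (map (\<lambda>k. xs ! (k - 1)) ys)"
proof
  fix i :: nat
  have "ys ! (i - 1) \<in> {1..6}" if "i \<in> {1..6}"
    using assms that nth_mem[of "i - 1" ys] by fastforce
  then show "(perm6 xs \<circ> perm6 ys) i = perm6 (map (\<lambda>k. xs ! (k - 1)) ys) i"
    using assms(1) by (auto simp: perm6_def)
qed

lemma permutes_6_eqI:
  assumes "p permutes {1..6}" "q permutes {1..6}" "\<And>i. i \<in> {1..6} \<Longrightarrow> p i = q i"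
  shows "p = q"
proof
  fix i
  show "p i = q i"
    using assms(3) permutes_not_in[OF assms(1)] permutes_not_in[OF assms(2)] by (cases "i \<in> {1..6}") auto
qed

lemma permutes_6_eq_perm6:
  assumes "p permutes {1..6::nat}"
  shows "p = perm6 [p 1, p 2, p 3, p 4, p 5, p 6]"
proof
  fix i :: nat
  show "p i = perm6 [p 1, p 2, p 3, p 4, p 5, p 6] i"
  proof (cases "i \<in> {1..6}")
    case True
    then show ?thesis unfolding interval_6 using perm6_simps[of "p 1" "p 2" "p 3" "p 4" "p 5" "p 6"] by auto
  next
    case False
    then show ?thesis using assms by (auto simp: perm6_def permutes_not_in)
  qed
qed

text \<open>Each value is a product of three disjoint transpositions. Values for neighbouring
  \<open>k\<close> have no transposition in common, so their product has order 3; all other pairs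
  share exactly one and commute. This is the pattern of the adjacent transpositions
  themselves.\<close>

definition adj_image :: "nat \<Rightarrow> nat \<Rightarrow> nat" where
  "adj_image k = perm6 ([[6,3,2,5,4,1], [4,5,6,1,2,3], [5,3,2,6,1,4], [6,5,4,3,2,1], [4,3,2,1,6,5]] ! (k - 1))"

text \<open>The graph of an outer automorphism of \<open>S\<^sub>6\<close>, from permutations of the nodes to
  permutations of the coordinates \<open>y\<close>, generated by the images of the adjacent transpositions.\<close>

inductive outer :: "(nat \<Rightarrow> nat) \<Rightarrow> (nat \<Rightarrow> nat) \<Rightarrow> bool" where
  outer_id: "outer id id"
| outer_step: "outer \<sigma> \<pi> \<Longrightarrow> k \<in> {1..5} \<Longrightarrow> outer (swap k (Suc k) \<circ> \<sigma>) (adj_image k \<circ> \<pi>)"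

lemma interval_5: "{1..5::nat} = {1, 2, 3, 4, 5}"
  by auto

lemma adj_image_permutes:
  assumes "k \<in> {1..5}"
  shows "adj_image k permutes {1..6}"
proof -
  define L :: "nat list" where
    "L = [[6,3,2,5,4,1], [4,5,6,1,2,3], [5,3,2,6,1,4], [6,5,4,3,2,1], [4,3,2,1,6,5]] ! (k - 1)"
  have "length L = 6 \<and> set L = {1..6}"
    using assms L_def unfolding interval_5 interval_6 by (elim insertE) auto
  then show ?thesis unfolding adj_image_def L_def[symmetric] by (intro perm6_permutes) auto
qed

lemma outer_permutes:
  assumes "outer \<sigma> \<pi>"
  shows "\<sigma> permutes {1..6}" "\<pi> permutes {1..6}"
  using assms
proof induction
  case (outer_step \<sigma> \<pi> k)
  { case 1 show ?case using outer_step by (intro permutes_compose permutes_swap_id) auto }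
  { case 2 show ?case using outer_step by (intro permutes_compose adj_image_permutes) auto }
qed (simp_all add: permutes_id)

lemma outer_comp: "outer \<sigma> \<pi> \<Longrightarrow> outer \<sigma>' \<pi>' \<Longrightarrow> outer (\<sigma> \<circ> \<sigma>') (\<pi> \<circ> \<pi>')"
  by (induction rule: outer.induct) (auto simp: comp_assoc outer.intros)

text \<open>The same word evaluated in \<open>adj_lists\<close> and in
  \<open>adj_image_lists\<close> yields a pair related by \<open>outer\<close>; simplification
  thereby computes the outer automorphism on any permutation given as a word. The head of the word
  is the factor applied last.\<close>

fun word_image :: "nat list list \<Rightarrow> nat list \<Rightarrow> nat list" where
  "word_image gs [] = [1,2,3,4,5,6]"
| "word_image gs (k # w) = map (\<lambda>i. gs ! (k - 1) ! (i - 1)) (word_image gs w)"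

abbreviation adj_lists :: "nat list list" where
  "adj_lists \<equiv> [[2,1,3,4,5,6], [1,3,2,4,5,6], [1,2,4,3,5,6], [1,2,3,5,4,6], [1,2,3,4,6,5]]"

abbreviation adj_image_lists :: "nat list list" where
  "adj_image_lists \<equiv> [[6,3,2,5,4,1], [4,5,6,1,2,3], [5,3,2,6,1,4], [6,5,4,3,2,1], [4,3,2,1,6,5]]"

lemma word_image_set:
  assumes "set w \<subseteq> {1..5}" "gs = adj_lists \<or> gs = adj_image_lists"
  shows "length (word_image gs w) = 6 \<and> set (word_image gs w) \<subseteq> {1..6}"
  using assms(1)
proof (induction w)
  case (Cons k w)
  then have IH: "length (word_image gs w) = 6" "set (word_image gs w) \<subseteq> {1..6}" "k \<in> {1..5}" by auto
  have "gs ! (k - 1) ! (i - 1) \<in> {1..6}" if "i \<in> {1..6}" for i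
    using that IH(3) assms(2) unfolding interval_5 interval_6 by auto
  then show ?case using IH by auto
qed (auto simp: interval_6)

lemma outer_word:
  assumes "set w \<subseteq> {1..5}"
  shows "outer (perm6 (word_image adj_lists w)) (perm6 (word_image adj_image_lists w))"
  using assms
proof (induction w)
  case Nil
  have "perm6 [1,2,3,4,5,6] = id"
    using permutes_6_eq_perm6[OF permutes_id] by simp
  then show ?case using outer_id by (simp only: word_image.simps)
next
  case (Cons k w)
  then have k: "k \<in> {1..5}" "set w \<subseteq> {1..5}" by auto
  have "swap k (Suc k) = perm6 (adj_lists ! (k - 1))"
    using permutes_6_eq_perm6[OF permutes_swap_id[of k _ "Suc k"]] k(1) unfolding interval_5
    by (auto simp: Transposition.transpose_def eval_nat_numeral)
  then show ?case
    using outer_step[OF Cons.IH[OF k(2)] k(1)] word_image_set[OF k(2)]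
    by (simp add: perm6_comp adj_image_def)
qed

section \<open>Matrices realizing pairs of permutations\<close>

definition maps_nodes :: "'a::field ^ 5 ^ 5 \<Rightarrow> (nat \<Rightarrow> nat) \<Rightarrow> bool" where
  "maps_nodes A \<sigma> \<longleftrightarrow> (\<forall>i\<in>{1..6}. \<exists>c. c \<noteq> 0 \<and> A *v node_vec i = c *s node_vec (\<sigma> i))"

text \<open>The scalar \<open>c\<close> must not depend on \<open>y\<close> or \<open>v\<close>: it
  absorbs signs and the choice of the matrix within its projective class. The cubic is pulled back,
  so the composition order agrees with that of \<open>outer\<close>.\<close>

definition realizes :: "'a::field ^ 5 ^ 5 \<Rightarrow> (nat \<Rightarrow> nat) \<Rightarrow> (nat \<Rightarrow> nat) \<Rightarrow> bool" where
  "realizes A \<sigma> \<pi> \<longleftrightarrow> invertible A \<and> maps_nodes A \<sigma> \<and>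
     (\<exists>c. c \<noteq> 0 \<and> (\<forall>y v. sum y {1..6} = 0 \<longrightarrow>
        cubic_form (ycoeffs y) (A *v v) = c * cubic_form (ycoeffs (y \<circ> \<pi>)) v))"

text \<open>Nodes 3, 4, 5, 6 are the unit vectors 5, 4, 3, 2, so the last three matrices exchange
  coordinates. The first two exchange node 2, the vector of ones, with unit vector 1 or 5; the first
  is \<open>tau_12\<close>.\<close>

definition adj_matrix :: "nat \<Rightarrow> 'a::field ^ 5 ^ 5" where
  "adj_matrix k = (if k = 1 then \<chi> i j. if j = 1 then -1 else if j = i then 1 else 0
     else if k = 2 then \<chi> i j. if j = 5 then -1 else if j = i then 1 else 0
     else if k = 3 then \<chi> i j. if j = swap 4 5 i then 1 else 0
     else if k = 4 then \<chi> i j. if j = swap 3 4 i then 1 else 0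
     else \<chi> i j. if j = swap 2 3 i then 1 else 0)"

lemma adj_matrix_mult:
  "adj_matrix 1 *v x = vec5 (- x$1) (x$2 - x$1) (x$3 - x$1) (x$4 - x$1) (x$5 - x$1)"
  "adj_matrix 2 *v x = vec5 (x$1 - x$5) (x$2 - x$5) (x$3 - x$5) (x$4 - x$5) (- x$5)"
  "adj_matrix 3 *v x = vec5 (x$1) (x$2) (x$3) (x$5) (x$4)"
  "adj_matrix 4 *v x = vec5 (x$1) (x$2) (x$4) (x$3) (x$5)"
  "adj_matrix 5 *v x = vec5 (x$1) (x$3) (x$2) (x$4) (x$5)"
  unfolding vec_eq_iff adj_matrix_def matrix_vector_mult_def forall_5 sum_5 vec5_nth
  by (simp_all add: Transposition.transpose_def)

lemma sum_comp_permutes: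
  assumes "\<pi> permutes S"
  shows "sum (y \<circ> \<pi>) S = sum y S"
  using sum.permute[OF assms, of y] by simp

lemma maps_nodes_comp:
  fixes A B :: "'a::field ^ 5 ^ 5"
  assumes A: "maps_nodes A \<sigma>" and B: "maps_nodes B \<tau>" and \<tau>: "\<tau> permutes {1..6}"
  shows "maps_nodes (A ** B) (\<sigma> \<circ> \<tau>)"
  unfolding maps_nodes_def
proof
  fix i :: nat assume i: "i \<in> {1..6}"
  obtain e where e: "e \<noteq> 0" "B *v node_vec i = e *s node_vec (\<tau> i)"
    using B i unfolding maps_nodes_def by meson
  have "\<tau> i \<in> {1..6}" using permutes_in_image[OF \<tau>] i by blast
  then obtain f where f: "f \<noteq> 0" "A *v node_vec (\<tau> i) = f *s node_vec (\<sigma> (\<tau> i))"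
    using A unfolding maps_nodes_def by meson
  have "(A ** B) *v node_vec i = (e * f) *s node_vec ((\<sigma> \<circ> \<tau>) i)"
    unfolding matrix_vector_mul_assoc[symmetric] e vector_scalar_commute f comp_def
      vector_smult_assoc ..
  then show "\<exists>c. c \<noteq> 0 \<and> (A ** B) *v node_vec i = c *s node_vec ((\<sigma> \<circ> \<tau>) i)"
    using e f by (metis mult_eq_0_iff)
qed

lemma realizes_comp:
  assumes "realizes A \<sigma> \<pi>" "realizes B \<sigma>' \<pi>'" "\<sigma>' permutes {1..6}" "\<pi> permutes {1..6}"
  shows "realizes (A ** B) (\<sigma> \<circ> \<sigma>') (\<pi> \<circ> \<pi>')"
proof -
  obtain c d where c: "c \<noteq> 0" "\<And>y v. sum y {1..6} = 0 \<Longrightarrow>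
        cubic_form (ycoeffs y) (A *v v) = c * cubic_form (ycoeffs (y \<circ> \<pi>)) v"
    and d: "d \<noteq> 0" "\<And>y v. sum y {1..6} = 0 \<Longrightarrow>
        cubic_form (ycoeffs y) (B *v v) = d * cubic_form (ycoeffs (y \<circ> \<pi>')) v"
    using assms(1,2) unfolding realizes_def by blast
  have mapsA: "maps_nodes A \<sigma>" and mapsB: "maps_nodes B \<sigma>'"
    using assms(1,2) by (simp_all add: realizes_def)
  have "cubic_form (ycoeffs y) ((A ** B) *v v) = (c * d) * cubic_form (ycoeffs (y \<circ> (\<pi> \<circ> \<pi>'))) v"
    if "sum y {1..6} = 0" for y v
  proof -
    have "sum (y \<circ> \<pi>) {1..6} = 0" using that sum_comp_permutes[OF assms(4), of y] by metis
    then show ?thesis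
      using c(2)[OF that, of "B *v v"] d(2)[of "y \<circ> \<pi>" v]
      by (simp only: matrix_vector_mul_assoc comp_assoc mult.assoc)
  qed
  moreover have "maps_nodes (A ** B) (\<sigma> \<circ> \<sigma>')" by (rule maps_nodes_comp[OF mapsA mapsB assms(3)])
  moreover have "invertible (A ** B)"
    using assms(1,2) invertible_mult unfolding realizes_def by blast
  ultimately show ?thesis
    unfolding realizes_def using c(1) d(1) by (metis mult_eq_0_iff)
qed

lemma realizes_id: "realizes (mat 1) id id"
proof -
  have "maps_nodes (mat 1 :: 'a ^ 5 ^ 5) id"
    unfolding maps_nodes_def by (auto intro!: exI[of _ 1])
  moreover have "invertible (mat 1 :: 'a ^ 5 ^ 5)"
    unfolding invertible_def by (intro exI[of _ "mat 1"]) simp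
  ultimately show ?thesis unfolding realizes_def by (auto intro!: exI[of _ 1])
qed

lemma node_vec_eq_vec5:
  "node_vec 1 = vec5 1 0 0 0 0" "node_vec 2 = vec5 1 1 1 1 1" "node_vec 3 = vec5 0 0 0 0 1"
  "node_vec 4 = vec5 0 0 0 1 0" "node_vec 5 = vec5 0 0 1 0 0" "node_vec 6 = vec5 0 1 0 0 0"
  by (simp_all add: node_vec_def vec_eq_iff forall_5 vec5_nth axis_def)

lemma adj_image_eq:
  "adj_image 1 = perm6 [6,3,2,5,4,1]" "adj_image 2 = perm6 [4,5,6,1,2,3]"
  "adj_image 3 = perm6 [5,3,2,6,1,4]" "adj_image 4 = perm6 [6,5,4,3,2,1]"
  "adj_image 5 = perm6 [4,3,2,1,6,5]"
  by (simp_all add: adj_image_def)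

text \<open>The finite computation behind the outer automorphism. The factor -1 shows that the
  cubics also carry the sign of the permutation, which is harmless up to scalars.\<close>

lemma realizes_adj:
  assumes "k \<in> {1..5}"
  shows "realizes (adj_matrix k :: 'a::field ^ 5 ^ 5) (swap k (Suc k)) (adj_image k)"
proof -
  have "(adj_matrix k :: 'a ^ 5 ^ 5) ** adj_matrix k = mat 1"
    unfolding matrix_eq using assms unfolding interval_5
    by (auto simp: adj_matrix_mult vec_eq_iff forall_5 vec5_nth simp flip: matrix_vector_mul_assoc
        simp del: One_nat_def)
  then have inv: "invertible (adj_matrix k :: 'a ^ 5 ^ 5)"
    unfolding invertible_def by blast
  have "\<exists>c. c \<noteq> 0 \<and> (adj_matrix k :: 'a ^ 5 ^ 5) *v node_vec i = c *s node_vec (swap k (Suc k) i)"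
    if "i \<in> {1..6}" for i
  proof -
    have k: "k \<in> {1, 2, 3, 4, 5}" "i \<in> {1, 2, 3, 4, 5, 6}"
      using that assms unfolding interval_5 interval_6 by auto
    have t: "swap k (Suc k) i = (if i = k then k + 1 else if i = k + 1 then k else i)"
      by (simp add: Transposition.transpose_def)
    define c :: 'a where "c = (if k \<le> 2 \<and> i \<in> {k, k + 1} then -1 else 1)"
    have "(adj_matrix k :: 'a ^ 5 ^ 5) *v node_vec i = c *s node_vec (swap k (Suc k) i)"
      unfolding t c_def using k
      by (elim insertE emptyE; simp only: refl)
         (simp_all add: adj_matrix_mult node_vec_eq_vec5 vec_eq_iff forall_5 vec5_nth del: One_nat_def)
    moreover have "c \<noteq> 0" by (simp add: c_def)
    ultimately show ?thesis by blast
  qed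
  then have nodes: "maps_nodes (adj_matrix k :: 'a ^ 5 ^ 5) (swap k (Suc k))"
    unfolding maps_nodes_def by blast
  have "cubic_form (ycoeffs y) (adj_matrix k *v v) = (- 1) * cubic_form (ycoeffs (y \<circ> adj_image k)) v"
    if y0: "sum y {1..6} = 0" for y and v :: "'a ^ 5"
  proof -
    have y6: "y 6 = - (y 1 + y 2 + y 3 + y 4 + y 5)"
      using y0 unfolding sum_interval_6 by (metis eq_neg_iff_add_eq_0 add.commute)
    have z0: "sum (y \<circ> adj_image k) {1..6} = 0"
      using y0 adj_image_permutes[OF assms] by (simp only: sum_comp_permutes)
    have form: "cubic_form (ycoeffs z) v =
        (z 3 + z 4 + z 5) * (v$1 * v$2 * v$3) + (z 1 + z 5 + z 6) * (v$1 * v$2 * v$4)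
        + (z 2 + z 3 + z 6) * (v$1 * v$2 * v$5) + (z 1 + z 2 + z 3) * (v$1 * v$3 * v$4)
        + (z 1 + z 4 + z 6) * (v$1 * v$3 * v$5) - (z 1 + z 3 + z 6) * (v$1 * v$4 * v$5)
        - (z 1 + z 3 + z 5) * (v$2 * v$3 * v$4) - (z 3 + z 4 + z 6) * (v$2 * v$3 * v$5)
        + (z 1 + z 3 + z 4) * (v$2 * v$4 * v$5) + (z 3 + z 5 + z 6) * (v$3 * v$4 * v$5)"
      if "sum z {1..6} = 0" for z and v :: "'a ^ 5"
      unfolding cubic_form_def ycoeffs_triples(6)[OF that] unfolding ycoeffs_triples(7-10)[OF that]
      unfolding ycoeffs_triples(1-5)[OF that] ..
    have k: "k = 1 \<or> k = 2 \<or> k = 3 \<or> k = 4 \<or> k = 5" using assms unfolding interval_5 by auto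
    from k show ?thesis
    proof (elim disjE)
      assume k: "k = 1"
      show ?thesis
        unfolding form[OF y0] form[OF z0]
        unfolding k adj_matrix_mult vec5_nth comp_apply adj_image_eq perm6_simps y6
        by algebra
    next
      assume k: "k = 2"
      show ?thesis
        unfolding form[OF y0] form[OF z0]
        unfolding k adj_matrix_mult vec5_nth comp_apply adj_image_eq perm6_simps y6
        by algebra
    next
      assume k: "k = 3"
      show ?thesis
        unfolding form[OF y0] form[OF z0]
        unfolding k adj_matrix_mult vec5_nth comp_apply adj_image_eq perm6_simps y6
        by algebra
    next
      assume k: "k = 4"
      show ?thesis
        unfolding form[OF y0] form[OF z0]
        unfolding k adj_matrix_mult vec5_nth comp_apply adj_image_eq perm6_simps y6
        by algebra
    next
      assume k: "k = 5"
      show ?thesis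
        unfolding form[OF y0] form[OF z0]
        unfolding k adj_matrix_mult vec5_nth comp_apply adj_image_eq perm6_simps y6
        by algebra
    qed
  qed
  then show ?thesis using inv nodes unfolding realizes_def by (metis neg_equal_0_iff_equal one_neq_zero)
qed

lemma outer_realized:
  assumes "outer \<sigma> \<pi>"
  obtains A :: "'a::field ^ 5 ^ 5" where "realizes A \<sigma> \<pi>"
proof -
  have "\<exists>A :: 'a ^ 5 ^ 5. realizes A \<sigma> \<pi>" using assms
  proof induction
    case outer_id
    show ?case using realizes_id by blast
  next
    case (outer_step \<sigma> \<pi> k)
    then show ?case
      using realizes_comp[OF realizes_adj] outer_permutes(1) adj_image_permutes by blast
  qed
  then show ?thesis using that by blast
qed

lemma vec5_decompose:
  fixes v :: "'a::field ^ 5"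
  shows "v = v$1 *s node_vec 1 + v$2 *s node_vec 6 + v$3 *s node_vec 5 + v$4 *s node_vec 4 + v$5 *s node_vec 3"
  unfolding vec_eq_iff forall_5 node_vec_eq_vec5 by (simp add: vec5_nth)

lemma matrix_vector_mult_decompose:
  fixes A :: "'a::field ^ 5 ^ 5"
  shows "A *v v = v$1 *s (A *v node_vec 1) + v$2 *s (A *v node_vec 6) + v$3 *s (A *v node_vec 5)
    + v$4 *s (A *v node_vec 4) + v$5 *s (A *v node_vec 3)"
  by (subst vec5_decompose[of v]) (simp only: matrix_vector_right_distrib vector_scalar_commute)

text \<open>The six nodes are in general position: node 2 is the sum of the other five, which form a
  basis. Expanding the image of node 2 in two ways forces the six scalars between \<open>A\<close>
  and \<open>B\<close> to agree.\<close>

lemma maps_nodes_unique: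
  fixes A B :: "'a::field ^ 5 ^ 5"
  assumes "maps_nodes A \<sigma>" "maps_nodes B \<sigma>" "invertible B"
  obtains c where "\<And>v. A *v v = c *s (B *v v)"
proof -
  have "\<exists>c. A *v node_vec i = c *s (B *v node_vec i)" if "i \<in> {1..6}" for i
  proof -
    obtain a b where "A *v node_vec i = a *s node_vec (\<sigma> i)" "b \<noteq> 0" "B *v node_vec i = b *s node_vec (\<sigma> i)"
      using assms(1,2) \<open>i \<in> {1..6}\<close> unfolding maps_nodes_def by meson
    then have "A *v node_vec i = (a / b) *s (B *v node_vec i)" by (simp add: vector_smult_assoc)
    then show ?thesis by blast
  qed
  then have "\<forall>i\<in>{1..6}. \<exists>c. A *v node_vec i = c *s (B *v node_vec i)" by blast
  then obtain c where c: "\<And>i. i \<in> {1..6} \<Longrightarrow> A *v node_vec i = c i *s (B *v node_vec i)"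
    by (metis (no_types, lifting) bchoice)
  define w where "w = vec5 (c 1) (c 6) (c 5) (c 4) (c 3)"
  have n2: "node_vec 2 $ j = (1::'a)" for j by (simp add: node_vec_def)
  have Aw: "A *v node_vec 2 = B *v w"
    unfolding matrix_vector_mult_decompose[of A "node_vec 2"] matrix_vector_mult_decompose[of B w]
    by (simp add: n2 w_def vec5_nth c)
  also have "A *v node_vec 2 = B *v (c 2 *s node_vec 2)"
    by (simp add: c vector_scalar_commute)
  finally have "B *v (c 2 *s node_vec 2) = B *v w" .
  then have w: "w = c 2 *s node_vec 2"
    using inj_matrix_vector_mult[OF assms(3)] by (metis injD)
  have "c i = c 2" if "i \<in> {1, 3, 4, 5, 6}" for i
    using that arg_cong[OF w, of "\<lambda>v. v$1"] arg_cong[OF w, of "\<lambda>v. v$2"] arg_cong[OF w, of "\<lambda>v. v$3"]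
      arg_cong[OF w, of "\<lambda>v. v$4"] arg_cong[OF w, of "\<lambda>v. v$5"]
    by (auto simp: w_def vec5_nth n2)
  then have "A *v node_vec i = c 2 *s (B *v node_vec i)" if "i \<in> {1, 3, 4, 5, 6}" for i
    using c[of i] that by fastforce
  then have "A *v v = c 2 *s (B *v v)" for v
    unfolding matrix_vector_mult_decompose[of A v] matrix_vector_mult_decompose[of B v]
    by (simp add: vector_add_ldistrib vector_smult_assoc mult.commute)
  then show ?thesis using that by blast
qed

text \<open>Realizations of both pairs over the rationals are proportional, because they induce the
  same \<open>\<sigma>\<close>. Hence \<open>y \<circ> \<pi>\<close> is a fixed multiple of
  \<open>y \<circ> \<pi>'\<close> for every \<open>y\<close> of sum zero, and test vectors separate
  the two permutations. No relations between the generators are verified.\<close>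

lemma outer_functional:
  assumes "outer \<sigma> \<pi>" "outer \<sigma> \<pi>'"
  shows "\<pi> = \<pi>'"
proof -
  obtain A B :: "rat ^ 5 ^ 5" where A: "realizes A \<sigma> \<pi>" and B: "realizes B \<sigma> \<pi>'"
    using outer_realized assms by metis
  obtain c where c: "\<And>v. A *v v = c *s (B *v v)"
    using maps_nodes_unique A B unfolding realizes_def by metis
  have "c \<noteq> 0"
  proof
    assume "c = 0"
    then have "A *v node_vec 1 = 0" using c by simp
    then have "node_vec 1 = (0 :: rat ^ 5)"
      using A inj_matrix_vector_mult[of A] unfolding realizes_def by (metis injD matrix_vector_mult_0_right)
    then show False using node_vec_nonzero by blast
  qed
  obtain a b where a: "a \<noteq> 0" "\<And>y v. sum y {1..6} = 0 \<Longrightarrow>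
        cubic_form (ycoeffs y) (A *v v) = a * cubic_form (ycoeffs (y \<circ> \<pi>)) v"
    and b: "b \<noteq> 0" "\<And>y v. sum y {1..6} = 0 \<Longrightarrow>
        cubic_form (ycoeffs y) (B *v v) = b * cubic_form (ycoeffs (y \<circ> \<pi>')) v"
    using A B unfolding realizes_def by blast
  define m where "m = c ^ 3 * b / a"
  have m: "m \<noteq> 0" using a b \<open>c \<noteq> 0\<close> by (simp add: m_def)
  note pi = outer_permutes(2)[OF assms(1)] outer_permutes(2)[OF assms(2)]
  have ratio: "y (\<pi> i) = m * y (\<pi>' i)" if y: "sum y {1..6} = 0" and i: "i \<in> {1..6}" for y i
  proof -
    have "cubic_form (ycoeffs (y \<circ> \<pi>)) v = cubic_form (m *s ycoeffs (y \<circ> \<pi>')) v" for v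
      using a(2)[OF y, of v] b(2)[OF y, of v] a(1)
      by (simp add: c cubic_form_scale cubic_form_scale_coeffs m_def field_simps)
    then have "ycoeffs (y \<circ> \<pi>) = m *s ycoeffs (y \<circ> \<pi>')" by (rule cubic_form_eq_imp_eq)
    moreover have "sum (y \<circ> \<pi>) {1..6} = 0" "sum (y \<circ> \<pi>') {1..6} = 0"
      unfolding sum_comp_permutes[OF pi(1)] sum_comp_permutes[OF pi(2)] by (rule y)+
    ultimately show ?thesis using ycoeffs_proportionalD[of "y \<circ> \<pi>'" "y \<circ> \<pi>" m i] i by simp
  qed
  show ?thesis
  proof (rule permutes_6_eqI[OF pi])
    fix i :: nat assume i: "i \<in> {1..6}"
    have im: "\<pi> i \<in> {1..6}" "\<pi>' i \<in> {1..6}"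
      using i by (simp_all only: permutes_in_image[OF pi(1)] permutes_in_image[OF pi(2)])
    have key: "\<pi> i = \<pi>' i \<or> \<pi> i = j" if j: "j \<in> {1..6}" "j \<noteq> \<pi>' i" for j
    proof (rule ccontr)
      assume neg: "\<not> ?thesis"
      \<comment> \<open>A difference of two unit vectors has sum zero. It is 1 at
        \<open>\<pi>' i\<close> and 0 at \<open>\<pi> i\<close>, against the fixed nonzero
        ratio.\<close>
      define y :: "nat \<Rightarrow> rat" where "y k = of_bool (k = \<pi>' i) - of_bool (k = j)" for k
      have "sum y {1..6} = 0"
        using im(2) j(1) unfolding y_def by (simp add: sum_subtractf of_bool_def del: One_nat_def)
      from ratio[OF this i] show False using neg m j(2) by (simp add: y_def)
    qed
    have "card {\<pi>' i, \<pi> i} \<le> 2" by (simp add: card_insert_if)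
    then have "\<not> {1..6} \<subseteq> {\<pi>' i, \<pi> i}"
      using card_mono[of "{\<pi>' i, \<pi> i}" "{1..6}"] by fastforce
    then obtain j where "j \<in> {1..6}" "j \<noteq> \<pi>' i" "j \<noteq> \<pi> i" by blast
    then show "\<pi> i = \<pi>' i" using key by blast
  qed
qed

text \<open>Closure under composition suffices, since conjugating adjacent transpositions by each
  other produces all transpositions.\<close>

lemma permutes_6_in_submonoid:
  assumes adj: "\<And>k. k \<in> {1..5} \<Longrightarrow> swap k (Suc k) \<in> K"
    and comp: "\<And>p q. p \<in> K \<Longrightarrow> q \<in> K \<Longrightarrow> p \<circ> q \<in> K" and id: "id \<in> K"
    and p: "p permutes {1..6}"
  shows "p \<in> K"
proof -
  have up: "swap a (a + Suc d) \<in> K" if "1 \<le> a" "a + Suc d \<le> 6" for a d :: nat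
    using that
  proof (induction d)
    case 0
    then show ?case using adj[of a] by simp
  next
    case (Suc d)
    let ?b = "a + Suc d"
    have IH: "swap a ?b \<in> K" and b: "swap ?b (Suc ?b) \<in> K"
      using Suc adj[of ?b] by auto
    have "swap a ?b \<circ> swap ?b (Suc ?b) \<circ> swap a ?b
        = swap a (Suc ?b)"
      by (rule transpose_comp_triple) auto
    then show ?case using comp[OF comp[OF IH b] IH] by simp
  qed
  have tr: "swap a b \<in> K" if "a \<in> {1..6}" "b \<in> {1..6}" "a \<noteq> b" for a b :: nat
  proof (cases "a < b")
    case True
    then show ?thesis using up[of a "b - a - 1"] that by auto
  next
    case False
    then show ?thesis using up[of b "a - b - 1"] that by (auto simp: transpose_commute)
  qed
  show ?thesis
    using p finite_atLeastAtMost
  proof (induction rule: permutes_induct)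
    case id
    show ?case by (rule assms(3))
  next
    case (swap a b p)
    then show ?case using comp[OF tr] by blast
  qed
qed

lemma outer_total:
  assumes "\<sigma> permutes {1..6}"
  shows "\<exists>\<pi>. outer \<sigma> \<pi>"
proof -
  have "\<sigma> \<in> {\<sigma>. \<exists>\<pi>. outer \<sigma> \<pi>}"
  proof (rule permutes_6_in_submonoid[OF _ _ _ assms])
    show "swap k (Suc k) \<in> {\<sigma>. \<exists>\<pi>. outer \<sigma> \<pi>}" if "k \<in> {1..5}" for k
      using outer_step[OF outer_id that] by auto
  qed (auto intro: outer_comp outer_id)
  then show ?thesis by blast
qed

lemma outer_surj:
  assumes "\<pi> permutes {1..6}"
  shows "\<exists>\<sigma>. outer \<sigma> \<pi>"
proof -
  have "\<pi> \<in> {\<pi>. \<exists>\<sigma>. outer \<sigma> \<pi>}"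
  proof (rule permutes_6_in_submonoid[OF _ _ _ assms])
    fix k :: nat assume k: "k \<in> {1..5}"
    \<comment> \<open>Words for node permutations whose image on the coordinates is the adjacent
      transposition. They describe products of three disjoint transpositions; \<open>[5,3,1]\<close>
      shows this directly.\<close>
    define w :: "nat list" where
      "w = [[4,5,2,3,4,1,2], [5,3,1], [2,3,4,5,3,4,3,1,2], [4,5,3,4,1], [5,2,3,1,2]] ! (k - 1)"
    have w: "set w \<subseteq> {1..5}"
      using k w_def unfolding interval_5 by (elim insertE) auto
    have "perm6 (word_image adj_image_lists w) = swap k (Suc k)"
      using permutes_6_eq_perm6[OF permutes_swap_id[of k _ "Suc k"]] k w_def unfolding interval_5
      by (auto simp: Transposition.transpose_def eval_nat_numeral)
    then show "swap k (Suc k) \<in> {\<pi>. \<exists>\<sigma>. outer \<sigma> \<pi>}"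
      using outer_word[OF w] by auto
  qed (auto intro: outer_comp outer_id)
  then show ?thesis by blast
qed

definition outer_aut :: "(nat \<Rightarrow> nat) \<Rightarrow> (nat \<Rightarrow> nat)" where
  "outer_aut \<sigma> = (THE \<pi>. outer \<sigma> \<pi>)"

lemma outer_aut_eqI: "outer \<sigma> \<pi> \<Longrightarrow> outer_aut \<sigma> = \<pi>"
  unfolding outer_aut_def using outer_functional by blast

lemma outer_outer_aut: "\<sigma> permutes {1..6} \<Longrightarrow> outer \<sigma> (outer_aut \<sigma>)"
  using outer_total outer_aut_eqI by blast

text \<open>Bijectivity comes from surjectivity, since the group is finite.\<close>

lemma outer_aut_iso: "outer_aut \<in> iso (sym_group 6) (sym_group 6)"
proof -
  let ?P = "{p. p permutes {1..6::nat}}"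
  have surj: "outer_aut ` ?P = ?P"
  proof
    show "outer_aut ` ?P \<subseteq> ?P" using outer_outer_aut outer_permutes(2) by blast
    show "?P \<subseteq> outer_aut ` ?P"
    proof
      fix \<pi> :: "nat \<Rightarrow> nat" assume "\<pi> \<in> ?P"
      then obtain \<sigma> where "outer \<sigma> \<pi>" using outer_surj by blast
      then show "\<pi> \<in> outer_aut ` ?P" using outer_aut_eqI outer_permutes(1) by (metis image_eqI mem_Collect_eq)
    qed
  qed
  moreover have "finite ?P" by (rule finite_permutations) simp
  ultimately have "bij_betw outer_aut ?P ?P"
    by (simp add: bij_betw_def eq_card_imp_inj_on)
  moreover have "outer_aut (\<sigma> \<circ> \<tau>) = outer_aut \<sigma> \<circ> outer_aut \<tau>" if "\<sigma> permutes {1..6}" "\<tau> permutes {1..6}" for \<sigma> \<tau>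
    using that by (intro outer_aut_eqI outer_comp outer_outer_aut)
  ultimately show ?thesis
    using surj by (auto simp: iso_def hom_def sym_group_def)
qed

section \<open>Automorphisms as scaling symmetries\<close>

definition stab :: "(nat \<Rightarrow> 'a::field) \<Rightarrow> (nat \<Rightarrow> nat) set" where
  "stab y = {\<pi>. \<pi> permutes {1..6} \<and> (\<exists>c. \<forall>i\<in>{1..6}. y (\<pi> i) = c * y i)}"

text \<open>What remains of the geometric hypotheses: the trisecant-free points are nodes. In this
  form the condition transports along zero sets, hence along permutations and scalings of
  \<open>y\<close>, and makes sense over any field.\<close>

definition nodal :: "(nat \<Rightarrow> 'a::field) \<Rightarrow> bool" where
  "nodal y \<longleftrightarrow> sum y {1..6} = 0 \<and> no_zero_triple y \<and>
     (\<forall>r. r \<noteq> 0 \<longrightarrow> trisecant_free (cubic_form (ycoeffs y)) r \<longrightarrow>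
       (\<exists>i\<in>{1..6}. \<exists>c. r = c *s node_vec i))"

lemma nodal_trisecant_freeD:
  assumes "nodal y" "r \<noteq> 0" "trisecant_free (cubic_form (ycoeffs y)) r"
  obtains i c where "i \<in> {1..6}" "r = c *s node_vec i"
  using assms unfolding nodal_def by meson

lemma nodalI:
  fixes y :: "nat \<Rightarrow> 'k::{alg_closed_field, field_char_0}"
  assumes y0: "sum y {1..6} = 0" and sing: "singular_locus (cubic (ycoeffs y)) = node ` {1..6}"
  shows "nodal y"
proof -
  have nz: "coeffs_nonzero (ycoeffs y)" using coeffs_nonzeroI[OF sing] .
  have "\<exists>i\<in>{1..6}. \<exists>c. r = c *s node_vec i"
    if "r \<noteq> 0" and tf: "trisecant_free (cubic_form (ycoeffs y)) r" for r
  proof -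
    have "singular_at (cubic (ycoeffs y)) r"
      using tf trisecant_free_cubic_form_imp_grad_0[OF nz tf]
      by (simp add: singular_at_cubic_iff trisecant_free_def)
    then show ?thesis using singular_not_node_absurd[OF sing \<open>r \<noteq> 0\<close>] by metis
  qed
  then show ?thesis using y0 nz coeffs_nonzero_ycoeffs_iff[OF y0] unfolding nodal_def by blast
qed

section \<open>Transport of zero sets along invertible matrices\<close>

lemma invertible_mult_eq_0_iff:
  fixes A :: "'a::field ^ 'n ^ 'n"
  assumes "invertible A"
  shows "A *v v = 0 \<longleftrightarrow> v = 0"
  using inj_matrix_vector_mult[OF assms] by (metis injD matrix_vector_mult_0_right)

lemma invertible_mult_surj:
  fixes A :: "'a::field ^ 'n ^ 'n"
  assumes "invertible A"
  obtains v where "A *v v = w"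
  using assms by (metis invertible_def matrix_vector_mul_assoc matrix_vector_mul_lid)

lemma trisecant_free_transform:
  fixes A :: "'a::field ^ 5 ^ 5"
  assumes A: "invertible A" and FG: "\<And>v. F v = 0 \<longleftrightarrow> G (A *v v) = 0"
  shows "trisecant_free G (A *v r) \<longleftrightarrow> trisecant_free F r"
proof -
  have eq: "G (A *v v + s *s (A *v r)) = 0 \<longleftrightarrow> F (v + s *s r) = 0" for v s
    unfolding FG by (simp add: matrix_vector_right_distrib vector_scalar_commute)
  show ?thesis
    unfolding trisecant_free_def
  proof (intro conj_cong[OF FG[symmetric]] iffI allI impI)
    fix v s u
    assume "\<forall>v s u. s \<noteq> 0 \<longrightarrow> G v = 0 \<longrightarrow> G (v + s *s (A *v r)) = 0 \<longrightarrow> G (v + u *s (A *v r)) = 0"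
      and "s \<noteq> 0" "F v = 0" "F (v + s *s r) = 0"
    then show "F (v + u *s r) = 0" using eq FG by metis
  next
    fix v s u
    assume *: "\<forall>v s u. s \<noteq> 0 \<longrightarrow> F v = 0 \<longrightarrow> F (v + s *s r) = 0 \<longrightarrow> F (v + u *s r) = 0"
      and "s \<noteq> 0" "G v = 0" "G (v + s *s (A *v r)) = 0"
    moreover obtain v' where "A *v v' = v" using invertible_mult_surj[OF A] .
    ultimately show "G (v + u *s (A *v r)) = 0" using eq FG by metis
  qed
qed

lemma proj_map_image_hypersurface_iff:
  fixes A :: "'a::field ^ 5 ^ 5"
  assumes A: "invertible A"
  shows "proj_map A ` hypersurface (cubic b) = hypersurface (cubic d) \<longleftrightarrow>
    (\<forall>v. cubic_form b v = 0 \<longleftrightarrow> cubic_form d (A *v v) = 0)"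
proof
  assume eq: "proj_map A ` hypersurface (cubic b) = hypersurface (cubic d)"
  show "\<forall>v. cubic_form b v = 0 \<longleftrightarrow> cubic_form d (A *v v) = 0"
  proof
    fix v
    show "cubic_form b v = 0 \<longleftrightarrow> cubic_form d (A *v v) = 0"
    proof (cases "v = 0")
      case True
      then show ?thesis by (simp add: cubic_form_0)
    next
      case False
      then have Av: "A *v v \<noteq> 0" using invertible_mult_eq_0_iff[OF A] by blast
      have "proj_point (A *v v) \<in> proj_map A ` hypersurface (cubic b) \<longleftrightarrow> proj_point v \<in> hypersurface (cubic b)"
      proof
        assume "proj_point (A *v v) \<in> proj_map A ` hypersurface (cubic b)"
        then obtain w where w: "w \<noteq> 0" "cubic_form b w = 0" "proj_point (A *v v) = proj_map A (proj_point w)"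
          by (auto simp: hypersurface_def mpoly_eval_cubic)
        then obtain c where "c \<noteq> 0" "A *v v = c *s (A *v w)"
          using proj_point_eqD proj_map_point by metis
        then have "A *v v = A *v (c *s w)" by (simp add: vector_scalar_commute)
        then have "v = c *s w" using inj_matrix_vector_mult[OF A] by (metis injD)
        then show "proj_point v \<in> hypersurface (cubic b)"
          using w(2) False by (simp add: hypersurface_cubic_mem_iff cubic_form_scale)
      next
        assume "proj_point v \<in> hypersurface (cubic b)"
        then show "proj_point (A *v v) \<in> proj_map A ` hypersurface (cubic b)"
          using proj_map_point[OF False, of A] by (metis image_eqI)
      qed
      then show ?thesis
        unfolding eq using hypersurface_cubic_mem_iff[OF False] hypersurface_cubic_mem_iff[OF Av] by metis
    qed
  qed
next
  assume eq: "\<forall>v. cubic_form b v = 0 \<longleftrightarrow> cubic_form d (A *v v) = 0"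
  show "proj_map A ` hypersurface (cubic b) = hypersurface (cubic d)"
  proof
    show "proj_map A ` hypersurface (cubic b) \<subseteq> hypersurface (cubic d)"
    proof
      fix L assume "L \<in> proj_map A ` hypersurface (cubic b)"
      then obtain v where v: "v \<noteq> 0" "cubic_form b v = 0" "L = proj_map A (proj_point v)"
        by (auto simp: hypersurface_def mpoly_eval_cubic)
      then have "L = proj_point (A *v v)" "A *v v \<noteq> 0"
        using proj_map_point invertible_mult_eq_0_iff[OF A] by auto
      then show "L \<in> hypersurface (cubic d)" using hypersurface_cubic_mem_iff eq v(2) by metis
    qed
    show "hypersurface (cubic d) \<subseteq> proj_map A ` hypersurface (cubic b)"
    proof
      fix L assume "L \<in> hypersurface (cubic d)"
      then obtain w where w: "w \<noteq> 0" "cubic_form d w = 0" "L = proj_point w"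
        by (auto simp: hypersurface_def mpoly_eval_cubic)
      obtain v where v: "A *v v = w" using invertible_mult_surj[OF A] .
      then have "v \<noteq> 0" using w(1) invertible_mult_eq_0_iff[OF A] by auto
      have "cubic_form b v = 0" using eq w(2) v by metis
      then have "proj_point v \<in> hypersurface (cubic b)"
        using hypersurface_cubic_mem_iff[OF \<open>v \<noteq> 0\<close>] by blast
      moreover have "L = proj_map A (proj_point v)"
        unfolding proj_map_point[OF \<open>v \<noteq> 0\<close>] v by (rule w(3))
      ultimately show "L \<in> proj_map A ` hypersurface (cubic b)" by blast
    qed
  qed
qed

lemma node_vec_nth_nonzero:
  "(node_vec n :: 'a::field ^ 5) $ m \<noteq> 0 \<longleftrightarrow> n = 2 \<or> (n = 1 \<and> m = 1) \<or> (n = 3 \<and> m = 5)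
     \<or> (n = 4 \<and> m = 4) \<or> (n = 5 \<and> m = 3) \<or> (n \<notin> {1, 2, 3, 4, 5} \<and> m = 2)"
  by (simp add: node_vec_def axis_def)

lemma node_vec_inj:
  assumes eq: "node_vec i = c *s (node_vec j :: 'a::field ^ 5)" and ij: "i \<in> {1..6}" "j \<in> {1..6}"
  shows "i = j"
proof -
  have "c \<noteq> 0" using eq node_vec_nonzero[of i] by auto
  then have supp: "(node_vec i :: 'a ^ 5) $ m \<noteq> 0 \<longleftrightarrow> (node_vec j :: 'a ^ 5) $ m \<noteq> 0" for m
    unfolding eq by simp
  have "i \<in> {1, 2, 3, 4, 5, 6}" "j \<in> {1, 2, 3, 4, 5, 6}" using ij unfolding interval_6 .
  then show ?thesis
    using supp[of 1] supp[of 2] supp[of 3] supp[of 4] supp[of 5] unfolding node_vec_nth_nonzero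
    by (elim insertE emptyE) simp_all
qed

lemma realizesD:
  assumes "realizes A \<sigma> \<pi>"
  shows "invertible A" "maps_nodes A \<sigma>"
    and "sum y {1..6} = 0 \<Longrightarrow> cubic_form (ycoeffs (y \<circ> \<pi>)) v = 0 \<longleftrightarrow> cubic_form (ycoeffs y) (A *v v) = 0"
proof -
  show "invertible A" "maps_nodes A \<sigma>" using assms by (simp_all add: realizes_def)
  show "cubic_form (ycoeffs (y \<circ> \<pi>)) v = 0 \<longleftrightarrow> cubic_form (ycoeffs y) (A *v v) = 0"
    if "sum y {1..6} = 0"
    using assms that unfolding realizes_def by (metis mult_eq_0_iff)
qed

lemma no_zero_triple_comp:
  assumes "no_zero_triple y" "\<pi> permutes {1..6}"
  shows "no_zero_triple (y \<circ> \<pi>)"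
  unfolding no_zero_triple_def
proof (intro allI impI)
  fix T :: "nat set" assume T: "T \<subseteq> {1..6} \<and> card T = 3"
  have inj: "inj_on \<pi> T" using permutes_inj_on[OF assms(2)] .
  have "sum (y \<circ> \<pi>) T = sum y (\<pi> ` T)" using sum.reindex[OF inj, of y] by simp
  moreover have "\<pi> ` T \<subseteq> {1..6}" "card (\<pi> ` T) = 3"
    using T permutes_in_image[OF assms(2)] card_image[OF inj] by auto
  ultimately show "sum (y \<circ> \<pi>) T \<noteq> 0" using assms(1) by (auto simp: no_zero_triple_def)
qed

text \<open>A realization of the pair carries the threefold of \<open>y \<circ> \<pi>\<close> to
  that of \<open>y\<close>. A trisecant-free point goes to a node, and every node is the image of a
  node, so the point was a node.\<close>

lemma nodal_comp:
  fixes y :: "nat \<Rightarrow> 'a::field"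
  assumes y: "nodal y" and o: "outer \<sigma> \<pi>"
  shows "nodal (y \<circ> \<pi>)"
proof -
  obtain A :: "'a ^ 5 ^ 5" where A: "realizes A \<sigma> \<pi>" using outer_realized[OF o] .
  have y0: "sum y {1..6} = 0" using y by (simp add: nodal_def)
  note zeros = realizesD(3)[OF A y0]
  have sing: "\<exists>i\<in>{1..6}. \<exists>c. r = c *s node_vec i"
    if "r \<noteq> 0" and tf: "trisecant_free (cubic_form (ycoeffs (y \<circ> \<pi>))) r" for r
  proof -
    have "trisecant_free (cubic_form (ycoeffs y)) (A *v r)"
      using trisecant_free_transform[of A "cubic_form (ycoeffs (y \<circ> \<pi>))" "cubic_form (ycoeffs y)" r,
          OF realizesD(1)[OF A] zeros] tf by blast
    moreover have "A *v r \<noteq> 0" using invertible_mult_eq_0_iff[OF realizesD(1)[OF A]] that by blast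
    ultimately obtain i c where i: "i \<in> {1..6}" "A *v r = c *s node_vec i"
      using nodal_trisecant_freeD[OF y] by metis
    obtain j where j: "j \<in> {1..6}" "\<sigma> j = i"
      using i(1) permutes_image[OF outer_permutes(1)[OF o]] by (metis imageE)
    obtain d where d: "d \<noteq> 0" "A *v node_vec j = d *s node_vec i"
      using realizesD(2)[OF A, unfolded maps_nodes_def, rule_format, OF j(1)] unfolding j(2) by metis
    have "A *v r = A *v ((c / d) *s node_vec j)"
      using d i(2) by (simp add: vector_scalar_commute vector_smult_assoc)
    then have "r = (c / d) *s node_vec j"
      using inj_matrix_vector_mult[OF realizesD(1)[OF A]] by (metis injD)
    then show ?thesis using j by blast
  qed
  have "sum (y \<circ> \<pi>) {1..6} = 0"
    unfolding sum_comp_permutes[OF outer_permutes(2)[OF o]] by (rule y0)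
  moreover have "no_zero_triple (y \<circ> \<pi>)"
    using y by (intro no_zero_triple_comp outer_permutes(2)[OF o]) (simp add: nodal_def)
  ultimately show ?thesis
    unfolding nodal_def by (intro conjI allI impI sing)
qed

lemma sum_zero_nodal: "nodal y \<Longrightarrow> sum y {1..6} = 0"
  by (simp add: nodal_def)

lemma nodal_coeffs_nonzero:
  fixes y :: "nat \<Rightarrow> 'a::field"
  assumes "nodal y"
  shows "coeffs_nonzero (ycoeffs y)"
  using assms coeffs_nonzero_ycoeffs_iff by (auto simp: nodal_def)

lemma maps_nodes_of_automorphism:
  fixes A :: "'a::field ^ 5 ^ 5"
  assumes y: "nodal y" and A: "invertible A"
    and zeros: "\<And>v. cubic_form (ycoeffs y) v = 0 \<longleftrightarrow> cubic_form (ycoeffs y) (A *v v) = 0"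
  obtains \<sigma> where "\<sigma> permutes {1..6}" "maps_nodes A \<sigma>"
proof -
  have ex: "\<exists>j. j \<in> {1..6} \<and> (\<exists>c. c \<noteq> 0 \<and> A *v node_vec i = c *s node_vec j)" for i
  proof -
    have nz: "A *v node_vec i \<noteq> 0"
      using invertible_mult_eq_0_iff[OF A] node_vec_nonzero by blast
    have "trisecant_free (cubic_form (ycoeffs y)) (A *v node_vec i)"
      using trisecant_free_transform[of A "cubic_form (ycoeffs y)" "cubic_form (ycoeffs y)" "node_vec i", OF A zeros]
        trisecant_free_node_vec by blast
    then obtain j c where jc: "j \<in> {1..6}" "A *v node_vec i = c *s node_vec j"
      using nodal_trisecant_freeD[OF y nz] by metis
    then have "c \<noteq> 0" using nz by auto
    then show ?thesis using jc by blast
  qed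
  define \<sigma> where "\<sigma> i = (if i \<in> {1..6}
      then SOME j. j \<in> {1..6} \<and> (\<exists>c. c \<noteq> 0 \<and> A *v node_vec i = c *s node_vec j) else i)" for i
  have \<sigma>: "\<sigma> i \<in> {1..6} \<and> (\<exists>c. c \<noteq> 0 \<and> A *v node_vec i = c *s node_vec (\<sigma> i))" if "i \<in> {1..6}" for i
    unfolding \<sigma>_def if_P[OF that] by (rule someI_ex[OF ex[of i]])
  have "inj_on \<sigma> {1..6}"
  proof (rule inj_onI)
    fix i j assume ij: "i \<in> {1..6}" "j \<in> {1..6}" "\<sigma> i = \<sigma> j"
    obtain c d where cd: "c \<noteq> 0" "A *v node_vec i = c *s node_vec (\<sigma> i)"
      "d \<noteq> 0" "A *v node_vec j = d *s node_vec (\<sigma> i)"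
      using \<sigma>[OF ij(1)] \<sigma>[OF ij(2)] unfolding ij(3) by blast
    then have "A *v node_vec i = A *v ((c / d) *s node_vec j)"
      by (simp add: vector_scalar_commute vector_smult_assoc)
    then have "node_vec i = (c / d) *s (node_vec j :: 'a ^ 5)"
      using inj_matrix_vector_mult[OF A] by (metis injD)
    then show "i = j" using node_vec_inj ij by blast
  qed
  moreover have "\<sigma> ` {1..6} \<subseteq> {1..6}" using \<sigma> by blast
  ultimately have "bij_betw \<sigma> {1..6} {1..6}"
    by (simp add: bij_betw_def endo_inj_surj)
  then have "\<sigma> permutes {1..6}"
    by (rule bij_imp_permutes) (simp only: \<sigma>_def if_False)
  moreover have "maps_nodes A \<sigma>" using \<sigma> unfolding maps_nodes_def by blast
  ultimately show ?thesis using that by blast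
qed

text \<open>With scalar zero \<open>y\<close> would vanish on the image of a triple, so a triple sum
  would be zero.\<close>

lemma nodal_scale_nonzero:
  fixes y :: "nat \<Rightarrow> 'a::field"
  assumes "nodal y" "\<pi> permutes {1..6}" and c: "\<And>i. i \<in> {1..6} \<Longrightarrow> y (\<pi> i) = c * y i"
  shows "c \<noteq> 0"
proof
  assume "c = 0"
  then have "y (\<pi> 1) + y (\<pi> 2) + y (\<pi> 3) = 0" using c[of 1] c[of 2] c[of 3] by simp
  moreover have "no_zero_triple (y \<circ> \<pi>)" using assms no_zero_triple_comp by (auto simp: nodal_def)
  then have "(y \<circ> \<pi>) 1 + (y \<circ> \<pi>) 2 + (y \<circ> \<pi>) 3 \<noteq> 0" by (rule no_zero_tripleD) auto
  ultimately show False by simp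
qed

lemma cubic_form_ycoeffs_scale:
  assumes "\<And>i. i \<in> {1..6} \<Longrightarrow> z i = c * y i"
  shows "cubic_form (ycoeffs z) v = c * cubic_form (ycoeffs y) v"
proof -
  have "ycoeffs z = c *s ycoeffs y"
    unfolding ycoeffs_def vec_eq_iff forall_5 vec5_nth vector_smult_component
    by (simp add: assms distrib_left)
  then show ?thesis by (simp add: cubic_form_scale_coeffs)
qed

section \<open>Automorphisms as permutations of the nodes\<close>

definition threefold :: "(nat \<Rightarrow> 'a::field) \<Rightarrow> ('a ^ 5) set set" where
  "threefold y = hypersurface (cubic (ycoeffs y))"

definition node_stab :: "(nat \<Rightarrow> 'a::field) \<Rightarrow> (nat \<Rightarrow> nat) set" where
  "node_stab y = {\<sigma>. \<sigma> permutes {1..6} \<and> outer_aut \<sigma> \<in> stab y}"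

text \<open>An automorphism permutes the nodes by some \<open>\<sigma>\<close>, hence is
  proportional to a realization of \<open>\<sigma>\<close> and its outer image \<open>\<pi>\<close>.
  So the cubics of \<open>y\<close> and \<open>y \<circ> \<pi>\<close> have common zeros, and they
  are proportional exactly when \<open>\<pi>\<close> multiplies \<open>y\<close> by a scalar. The
  converse runs the same way backwards.\<close>

lemma Aut_carrier_iff:
  fixes y :: "nat \<Rightarrow> 'a::field_char_0"
  assumes y: "nodal y"
  shows "g \<in> carrier (Aut (threefold y)) \<longleftrightarrow>
    (\<exists>A \<sigma>. \<sigma> \<in> node_stab y \<and> invertible A \<and> maps_nodes A \<sigma> \<and> g = proj_map A)" (is "?L \<longleftrightarrow> ?R")
proof
  note y0 = sum_zero_nodal[OF y]
  assume ?L
  then have g: "g \<in> PGL" "g ` threefold y = threefold y" by (simp_all add: Aut_def)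
  then obtain A where A: "invertible A" "g = proj_map A" unfolding PGL_def by blast
  note AX = g(2)[unfolded A(2)]
  then have zeros: "cubic_form (ycoeffs y) v = 0 \<longleftrightarrow> cubic_form (ycoeffs y) (A *v v) = 0" for v
    using AX unfolding threefold_def proj_map_image_hypersurface_iff[OF A(1)] by metis
  obtain \<sigma> where \<sigma>: "\<sigma> permutes {1..6}" "maps_nodes A \<sigma>"
    using maps_nodes_of_automorphism[OF y A(1) zeros] .
  define \<pi> where "\<pi> = outer_aut \<sigma>"
  have o: "outer \<sigma> \<pi>" unfolding \<pi>_def by (rule outer_outer_aut[OF \<sigma>(1)])
  obtain B :: "'a ^ 5 ^ 5" where B: "realizes B \<sigma> \<pi>" using outer_realized[OF o] .
  obtain c where c: "\<And>v. B *v v = c *s (A *v v)"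
    using maps_nodes_unique[OF realizesD(2)[OF B] \<sigma>(2) A(1)] by blast
  have "cubic_form (ycoeffs (y \<circ> \<pi>)) v = 0" if "cubic_form (ycoeffs y) v = 0" for v
    using realizesD(3)[OF B y0, of v] zeros[of v] that by (simp add: c cubic_form_scale)
  moreover have y\<pi>: "nodal (y \<circ> \<pi>)" using nodal_comp[OF y o] .
  ultimately obtain d where "ycoeffs (y \<circ> \<pi>) = d *s ycoeffs y"
    using same_zeros_imp_proportional nodal_coeffs_nonzero[OF y] nodal_coeffs_nonzero[OF y\<pi>] by blast
  then have "\<forall>i\<in>{1..6}. y (\<pi> i) = d * y i"
    using ycoeffs_proportionalD[OF y0 sum_zero_nodal[OF y\<pi>]] by simp
  then have "\<pi> \<in> stab y" using outer_permutes(2)[OF o] by (auto simp: stab_def)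
  then show ?R using \<sigma> A unfolding node_stab_def \<pi>_def by blast
next
  note y0 = sum_zero_nodal[OF y]
  assume ?R
  then obtain A \<sigma> where A: "\<sigma> \<in> node_stab y" "invertible A" "maps_nodes A \<sigma>" "g = proj_map A" by blast
  define \<pi> where "\<pi> = outer_aut \<sigma>"
  have o: "outer \<sigma> \<pi>" using A(1) outer_outer_aut by (simp add: node_stab_def \<pi>_def)
  obtain d where d: "\<And>i. i \<in> {1..6} \<Longrightarrow> y (\<pi> i) = d * y i"
    using A(1) unfolding node_stab_def stab_def \<pi>_def by blast
  have "d \<noteq> 0" using nodal_scale_nonzero[OF y outer_permutes(2)[OF o] d] .
  obtain B :: "'a ^ 5 ^ 5" where B: "realizes B \<sigma> \<pi>" using outer_realized[OF o] .
  obtain c where c: "\<And>v. A *v v = c *s (B *v v)"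
    using maps_nodes_unique[OF A(3) realizesD(2)[OF B] realizesD(1)[OF B]] by blast
  have "c \<noteq> 0" using c[of "node_vec 1"] invertible_mult_eq_0_iff[OF A(2)] node_vec_nonzero by fastforce
  have "cubic_form (ycoeffs y) v = 0 \<longleftrightarrow> cubic_form (ycoeffs y) (A *v v) = 0" for v
    using realizesD(3)[OF B y0, of v] cubic_form_ycoeffs_scale[of "y \<circ> \<pi>" d y v] d \<open>c \<noteq> 0\<close> \<open>d \<noteq> 0\<close>
    by (simp add: c cubic_form_scale)
  then have "proj_map A ` threefold y = threefold y"
    unfolding threefold_def proj_map_image_hypersurface_iff[OF A(2)] by blast
  moreover have "proj_map A \<in> PGL" using A(2) unfolding PGL_def by blast
  ultimately show ?L by (simp add: Aut_def A(4))
qed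

lemma node_inj:
  assumes "node i = (node j :: ('a::field ^ 5) set)" "i \<in> {1..6}" "j \<in> {1..6}"
  shows "i = j"
  using proj_point_eqD[OF assms(1)[unfolded node_def]] node_vec_inj assms(2,3) by blast

lemma proj_map_node:
  assumes "maps_nodes A \<sigma>" "i \<in> {1..6}"
  shows "proj_map A (node i) = node (\<sigma> i)"
  using assms unfolding maps_nodes_def node_def
  by (metis node_vec_nonzero proj_map_point proj_point_scale)

lemma node_perm_eqI:
  fixes A :: "'a::field ^ 5 ^ 5"
  assumes "maps_nodes A \<sigma>" "\<sigma> permutes {1..6}"
  shows "node_perm (proj_map A) = \<sigma>"
  unfolding node_perm_def
proof (rule the_equality)
  show "permutes_nodes_by (proj_map A) \<sigma>"
    unfolding permutes_nodes_by_def using assms proj_map_node by blast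
  fix \<tau> assume \<tau>: "permutes_nodes_by (proj_map A) \<tau>"
  show "\<tau> = \<sigma>"
  proof (rule permutes_6_eqI)
    show "\<tau> permutes {1..6}" using \<tau> by (simp add: permutes_nodes_by_def)
    fix i :: nat assume i: "i \<in> {1..6}"
    have "node (\<tau> i) = (node (\<sigma> i) :: ('a ^ 5) set)"
      using \<tau> i proj_map_node[OF assms(1) i] by (simp only: permutes_nodes_by_def)
    moreover have "\<tau> i \<in> {1..6}" "\<sigma> i \<in> {1..6}"
      using i \<tau> assms(2) unfolding permutes_nodes_by_def by (simp_all only: permutes_in_image)
    ultimately show "\<tau> i = \<sigma> i" by (rule node_inj)
  qed (rule assms(2))
qed

text \<open>The multiplication of \<open>BijGroup\<close> is composition only between members of
  \<open>Bij\<close>; this makes products in \<open>Aut\<close> computable.\<close>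

lemma proj_map_Bij:
  fixes A :: "'a::field ^ 'n ^ 'n"
  assumes A: "invertible A"
  shows "proj_map A \<in> Bij proj_space"
proof -
  have nz: "A *v v \<noteq> 0 \<longleftrightarrow> v \<noteq> 0" for v using invertible_mult_eq_0_iff[OF A] by blast
  have "inj_on (proj_map A) proj_space"
  proof (rule inj_onI)
    fix L M :: "('a ^ 'n) set" assume "L \<in> proj_space" "M \<in> proj_space" and eq: "proj_map A L = proj_map A M"
    then obtain v w where v: "v \<noteq> 0" "L = proj_point v" and w: "w \<noteq> 0" "M = proj_point w"
      by (auto simp: proj_space_def)
    then obtain c where c: "c \<noteq> 0" "A *v v = c *s (A *v w)"
      using eq proj_map_point proj_point_eqD by metis
    then have "A *v v = A *v (c *s w)" by (simp add: vector_scalar_commute)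
    then have "v = c *s w" using inj_matrix_vector_mult[OF A] by (metis injD)
    then show "L = M" using v w c proj_point_scale by metis
  qed
  moreover have "proj_map A ` proj_space = proj_space"
  proof
    show "proj_map A ` proj_space \<subseteq> proj_space"
      using nz proj_map_point[of _ A] unfolding proj_space_def by fastforce
    show "proj_space \<subseteq> proj_map A ` proj_space"
    proof
      fix L :: "('a ^ 'n) set" assume "L \<in> proj_space"
      then obtain w where w: "w \<noteq> 0" "L = proj_point w" by (auto simp: proj_space_def)
      obtain v where v: "A *v v = w" using invertible_mult_surj[OF A] .
      then have "v \<noteq> 0" using w nz by blast
      moreover have "L = proj_map A (proj_point v)" using proj_map_point[OF \<open>v \<noteq> 0\<close>, of A] v w by simp
      ultimately show "L \<in> proj_map A ` proj_space" unfolding proj_space_def by blast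
    qed
  qed
  moreover have "proj_map A \<in> extensional proj_space" by (simp add: proj_map_def)
  ultimately show ?thesis by (simp add: Bij_def bij_betw_def)
qed

lemma proj_map_compose:
  fixes A B :: "'a::field ^ 'n ^ 'n"
  assumes "invertible B"
  shows "compose proj_space (proj_map A) (proj_map B) = proj_map (A ** B)"
proof
  fix L :: "('a ^ 'n) set"
  show "compose proj_space (proj_map A) (proj_map B) L = proj_map (A ** B) L"
  proof (cases "L \<in> proj_space")
    case True
    then obtain v where v: "v \<noteq> 0" "L = proj_point v" by (auto simp: proj_space_def)
    then have "B *v v \<noteq> 0" using invertible_mult_eq_0_iff[OF assms] by blast
    then show ?thesis
      using True v by (simp add: compose_def proj_map_point matrix_vector_mul_assoc)
  next
    case False
    then show ?thesis by (simp add: compose_def proj_map_def)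
  qed
qed

lemma proj_map_scale:
  fixes A B :: "'a::field ^ 'n ^ 'n"
  assumes "\<And>v. A *v v = c *s (B *v v)" "c \<noteq> 0"
  shows "proj_map A = proj_map B"
proof
  fix L :: "('a ^ 'n) set"
  show "proj_map A L = proj_map B L"
  proof (cases "L \<in> proj_space")
    case True
    then obtain v where v: "v \<noteq> 0" "L = proj_point v" by (auto simp: proj_space_def)
    then show ?thesis by (simp add: proj_map_point assms(1) proj_point_scale[OF assms(2)])
  qed (simp add: proj_map_def)
qed

text \<open>The common shape of all subgroups of symmetric groups, without reference to a degree.
  Being a group is not part of it.\<close>

definition perm_group :: "(nat \<Rightarrow> nat) set \<Rightarrow> (nat \<Rightarrow> nat) monoid" where
  "perm_group K = \<lparr>carrier = K, monoid.mult = (\<circ>), one = id\<rparr>"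

lemma sym_group_restrict: "(sym_group n)\<lparr>carrier := K\<rparr> = perm_group K"
  by (simp add: sym_group_def perm_group_def)

lemma carrier_perm_group [simp]: "carrier (perm_group K) = K"
  and mult_perm_group [simp]: "x \<otimes>\<^bsub>perm_group K\<^esub> y = x \<circ> y"
  by (simp_all add: perm_group_def)

text \<open>The map starts from the abstract model \<open>D\<close>, whose elements are explicit,
  and is inverted here. Closure of \<open>D\<close> suffices, so no group laws have to be proved for
  the model.\<close>

lemma perm_group_isoI:
  assumes bij: "bij_betw h (carrier D) K"
    and closed: "\<And>x y. x \<in> carrier D \<Longrightarrow> y \<in> carrier D \<Longrightarrow> x \<otimes>\<^bsub>D\<^esub> y \<in> carrier D"
    and mult: "\<And>x y. x \<in> carrier D \<Longrightarrow> y \<in> carrier D \<Longrightarrow> h (x \<otimes>\<^bsub>D\<^esub> y) = h x \<circ> h y"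
  shows "perm_group K \<cong> D"
proof -
  let ?g = "inv_into (carrier D) h"
  have g: "bij_betw ?g K (carrier D)" by (rule bij_betw_inv_into[OF bij])
  have hom: "?g (p \<circ> q) = ?g p \<otimes>\<^bsub>D\<^esub> ?g q" if "p \<in> K" "q \<in> K" for p q
  proof -
    have gp: "?g p \<in> carrier D" "h (?g p) = p" and gq: "?g q \<in> carrier D" "h (?g q) = q"
      using that bij bij_betw_inv_into_right[OF bij] bij_betwE[OF g] by auto
    have "p \<circ> q = h (?g p \<otimes>\<^bsub>D\<^esub> ?g q)" using mult gp gq by simp
    then show ?thesis using bij_betw_inv_into_left[OF bij closed[OF gp(1) gq(1)]] by simp
  qed
  have "?g \<in> iso (perm_group K) D"
    using g hom bij_betwE[OF g] by (auto simp: iso_def hom_def)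
  then show ?thesis by (auto simp: is_iso_def)
qed

lemma stabE:
  assumes "\<pi> \<in> stab y"
  obtains c where "\<pi> permutes {1..6}" "\<And>i. i \<in> {1..6} \<Longrightarrow> y (\<pi> i) = c * y i"
proof -
  from assms obtain c where "\<pi> permutes {1..6}" "\<forall>i\<in>{1..6}. y (\<pi> i) = c * y i"
    unfolding stab_def by blast
  then show ?thesis using that by blast
qed

lemma stab_comp:
  assumes "\<pi> \<in> stab y" "\<rho> \<in> stab y"
  shows "\<pi> \<circ> \<rho> \<in> stab y"
proof -
  obtain c where c: "\<pi> permutes {1..6}" "\<And>i. i \<in> {1..6} \<Longrightarrow> y (\<pi> i) = c * y i"
    using stabE[OF assms(1)] by blast
  obtain d where d: "\<rho> permutes {1..6}" "\<And>i. i \<in> {1..6} \<Longrightarrow> y (\<rho> i) = d * y i"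
    using stabE[OF assms(2)] by blast
  have "y ((\<pi> \<circ> \<rho>) i) = (c * d) * y i" if "i \<in> {1..6}" for i
    using c(2)[of "\<rho> i"] d(2)[of i] that permutes_in_image[OF d(1), of i] by simp
  then show ?thesis using permutes_compose[OF d(1) c(1)] unfolding stab_def by blast
qed

lemma node_perm_iso:
  fixes y :: "nat \<Rightarrow> 'a::field_char_0"
  assumes y: "nodal y"
  shows "node_perm \<in> iso (Aut (threefold y)) (perm_group (node_stab y))"
proof -
  have np: "node_perm (proj_map A) = \<sigma>" if "\<sigma> \<in> node_stab y" "maps_nodes A \<sigma>" for A :: "'a ^ 5 ^ 5" and \<sigma>
    using node_perm_eqI that by (auto simp: node_stab_def)
  note car = Aut_carrier_iff[OF y]
  have 1: "node_perm g \<in> node_stab y" if "g \<in> carrier (Aut (threefold y))" for g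
    using that np unfolding car by metis
  have 2: "inj_on node_perm (carrier (Aut (threefold y)))"
  proof (rule inj_onI)
    fix g h assume g: "g \<in> carrier (Aut (threefold y))" and h: "h \<in> carrier (Aut (threefold y))"
      and eq: "node_perm g = node_perm h"
    obtain A \<sigma> where A: "\<sigma> \<in> node_stab y" "invertible A" "maps_nodes A \<sigma>" "g = proj_map A"
      using g unfolding car by blast
    obtain B \<tau> where B: "\<tau> \<in> node_stab y" "invertible B" "maps_nodes B \<tau>" "h = proj_map B"
      using h unfolding car by blast
    have "maps_nodes B \<sigma>" using np[OF A(1,3)] np[OF B(1,3)] B(3) eq A(4) B(4) by metis
    then obtain c where c: "\<And>v. A *v v = c *s (B *v v)" using maps_nodes_unique[OF A(3) _ B(2)] by metis
    have "c \<noteq> 0" using c[of "node_vec 1"] invertible_mult_eq_0_iff[OF A(2)] node_vec_nonzero by fastforce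
    then show "g = h" using proj_map_scale[OF c] A(4) B(4) by simp
  qed
  have 3: "\<sigma> \<in> node_perm ` carrier (Aut (threefold y))" if \<sigma>: "\<sigma> \<in> node_stab y" for \<sigma>
  proof -
    have "\<sigma> permutes {1..6}" using \<sigma> by (simp add: node_stab_def)
    then obtain A :: "'a ^ 5 ^ 5" where A: "realizes A \<sigma> (outer_aut \<sigma>)"
      using outer_realized outer_outer_aut by metis
    then have "proj_map A \<in> carrier (Aut (threefold y))" "node_perm (proj_map A) = \<sigma>"
      using car realizesD(1,2)[OF A] \<sigma> np by blast+
    then show ?thesis by blast
  qed
  have 4: "node_perm (g \<otimes>\<^bsub>Aut (threefold y)\<^esub> h) = node_perm g \<circ> node_perm h"
    if g: "g \<in> carrier (Aut (threefold y))" and h: "h \<in> carrier (Aut (threefold y))" for g h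
  proof -
    obtain A \<sigma> where A: "\<sigma> \<in> node_stab y" "invertible A" "maps_nodes A \<sigma>" "g = proj_map A"
      using g unfolding car by blast
    obtain B \<tau> where B: "\<tau> \<in> node_stab y" "invertible B" "maps_nodes B \<tau>" "h = proj_map B"
      using h unfolding car by blast
    have perms: "\<sigma> permutes {1..6}" "\<tau> permutes {1..6}" using A(1) B(1) by (auto simp: node_stab_def)
    have "g \<otimes>\<^bsub>Aut (threefold y)\<^esub> h = compose proj_space g h"
      using proj_map_Bij[OF A(2)] proj_map_Bij[OF B(2)] A(4) B(4) by (simp add: Aut_def BijGroup_def)
    also have "\<dots> = proj_map (A ** B)" using proj_map_compose[OF B(2)] A(4) B(4) by simp
    finally have gh: "g \<otimes>\<^bsub>Aut (threefold y)\<^esub> h = proj_map (A ** B)" .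
    have "node_perm (proj_map (A ** B)) = \<sigma> \<circ> \<tau>"
      by (rule node_perm_eqI[OF maps_nodes_comp[OF A(3) B(3) perms(2)] permutes_compose[OF perms(2,1)]])
    then show ?thesis using gh np[OF A(1,3)] np[OF B(1,3)] A(4) B(4) by simp
  qed
  show ?thesis
    using 1 2 3 4 by (auto simp: iso_def hom_def bij_betw_def)
qed

lemma outer_aut_hom: "outer_aut \<in> hom (sym_group 6) (sym_group 6)"
  using outer_aut_iso by (simp add: iso_def)

lemma outer_aut_comp:
  "\<sigma> permutes {1..6} \<Longrightarrow> \<tau> permutes {1..6} \<Longrightarrow> outer_aut (\<sigma> \<circ> \<tau>) = outer_aut \<sigma> \<circ> outer_aut \<tau>"
  using hom_mult[OF outer_aut_hom] by (simp add: sym_group_def)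

lemma outer_aut_bij: "bij_betw outer_aut {p. p permutes {1..6}} {p. p permutes {1..6}}"
  using outer_aut_iso by (simp add: iso_def sym_group_def)

text \<open>The abstract group can be computed on the coordinates, where the stabilisers have a much
  simpler shape than on the nodes.\<close>

lemma Aut_iso_stab:
  fixes y :: "nat \<Rightarrow> 'a::field_char_0"
  assumes y: "nodal y"
  shows "Aut (threefold y) \<cong> perm_group (stab y)"
proof -
  have "bij_betw outer_aut (node_stab y) (stab y)"
  proof (rule bij_betw_subset[OF outer_aut_bij])
    show "node_stab y \<subseteq> {p. p permutes {1..6}}" by (auto simp: node_stab_def)
    show "outer_aut ` node_stab y = stab y"
    proof
      show "outer_aut ` node_stab y \<subseteq> stab y" by (auto simp: node_stab_def)
      show "stab y \<subseteq> outer_aut ` node_stab y"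
      proof
        fix \<pi> assume \<pi>: "\<pi> \<in> stab y"
        then have "\<pi> \<in> outer_aut ` {p. p permutes {1..6}}"
          using bij_betw_imp_surj_on[OF outer_aut_bij] by (auto simp: stab_def)
        then show "\<pi> \<in> outer_aut ` node_stab y" using \<pi> by (auto simp: node_stab_def)
      qed
    qed
  qed
  then have "outer_aut \<in> iso (perm_group (node_stab y)) (perm_group (stab y))"
    using outer_aut_comp by (auto simp: iso_def hom_def node_stab_def)
  then show ?thesis
    using node_perm_iso[OF y] iso_trans unfolding is_iso_def by blast
qed

lemma stab_subgroup:
  assumes y: "nodal y"
  shows "subgroup (node_stab y) (sym_group 6)"
proof -
  interpret group "sym_group 6" by (rule sym_group_is_group)
  have inv_mem: "inv' \<pi> \<in> stab y" if st: "\<pi> \<in> stab y" for \<pi>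
  proof -
    obtain c where c: "\<pi> permutes {1..6}" "\<And>i. i \<in> {1..6} \<Longrightarrow> y (\<pi> i) = c * y i"
      using stabE[OF st] by blast
    have "c \<noteq> 0" using nodal_scale_nonzero[OF y c] .
    then have "y (inv' \<pi> i) = (1 / c) * y i" if "i \<in> {1..6}" for i
      using c(2)[of "inv' \<pi> i"] that permutes_in_image[OF permutes_inv[OF c(1)], of i]
        permutes_inverses(1)[OF c(1), of i] by simp
    then show ?thesis using permutes_inv[OF c(1)] unfolding stab_def by blast
  qed
  have id: "outer_aut id = id" by (rule outer_aut_eqI[OF outer_id])
  have "id \<in> stab y" by (auto simp: stab_def permutes_id intro!: exI[of _ 1])
  show ?thesis
  proof (rule subgroupI)
    show "node_stab y \<subseteq> carrier (sym_group 6)" by (auto simp: node_stab_def sym_group_def)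
    have "id \<in> node_stab y" using id \<open>id \<in> stab y\<close> permutes_id by (simp add: node_stab_def)
    then show "node_stab y \<noteq> {}" by blast
  next
    fix \<sigma> assume \<sigma>: "\<sigma> \<in> node_stab y"
    then have p: "\<sigma> permutes {1..6}" "outer_aut \<sigma> \<in> stab y" by (auto simp: node_stab_def)
    have inv: "inv\<^bsub>sym_group 6\<^esub> \<sigma> = inv' \<sigma>"
      by (rule inv_equality) (use p(1) permutes_inv permutes_inv_o(2)[OF p(1)] in \<open>auto simp: sym_group_def\<close>)
    have "outer_aut (inv' \<sigma>) \<circ> outer_aut \<sigma> = id"
      using outer_aut_comp[OF permutes_inv[OF p(1)] p(1)] permutes_inv_o(2)[OF p(1)] id by simp
    moreover have o: "outer_aut \<sigma> permutes {1..6}" using p(2) by (simp add: stab_def)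
    ultimately have "outer_aut (inv' \<sigma>) = inv' (outer_aut \<sigma>)"
      using permutes_inv_o(1)[OF o] by (metis comp_assoc comp_id id_comp)
    then show "inv\<^bsub>sym_group 6\<^esub> \<sigma> \<in> node_stab y"
      using inv_mem[OF p(2)] permutes_inv[OF p(1)] by (simp add: inv node_stab_def)
  next
    fix \<sigma> \<tau> assume "\<sigma> \<in> node_stab y" "\<tau> \<in> node_stab y"
    then show "\<sigma> \<otimes>\<^bsub>sym_group 6\<^esub> \<tau> \<in> node_stab y"
      using stab_comp by (auto simp: node_stab_def sym_group_mult outer_aut_comp permutes_compose)
  qed
qed

text \<open>Generation is checked on the coordinate side: \<open>gen\<close> is applied to the outer
  image of the generated subgroup, and injectivity of the outer automorphism brings the inclusion
  back to the nodes.\<close>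

lemma Aut_acts_asI:
  fixes y :: "nat \<Rightarrow> 'a::field_char_0"
  assumes y: "nodal y"
    and S: "\<And>\<sigma>. \<sigma> \<in> S \<Longrightarrow> \<exists>\<pi>. outer \<sigma> \<pi> \<and> \<pi> \<in> stab y"
    and gen: "\<And>M. id \<in> M \<Longrightarrow> (\<And>p q. p \<in> M \<Longrightarrow> q \<in> M \<Longrightarrow> p \<circ> q \<in> M) \<Longrightarrow>
      (\<And>\<sigma> \<pi>. \<sigma> \<in> S \<Longrightarrow> outer \<sigma> \<pi> \<Longrightarrow> \<pi> \<in> M) \<Longrightarrow> stab y \<subseteq> M"
  shows "Aut_acts_as (threefold y) S"
proof -
  interpret group "sym_group 6" by (rule sym_group_is_group)
  have SC: "S \<subseteq> carrier (sym_group 6)" using S outer_permutes(1) by (auto simp: sym_group_def)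
  have "generate (sym_group 6) S \<subseteq> node_stab y"
  proof (rule generate_subgroup_incl[OF _ stab_subgroup[OF y]])
    show "S \<subseteq> node_stab y"
      using S outer_aut_eqI outer_permutes(1) by (fastforce simp: node_stab_def)
  qed
  moreover have "node_stab y \<subseteq> generate (sym_group 6) S"
  proof
    fix \<sigma> assume \<sigma>: "\<sigma> \<in> node_stab y"
    let ?M = "outer_aut ` generate (sym_group 6) S"
    have "stab y \<subseteq> ?M"
    proof (rule gen)
      have "id \<in> generate (sym_group 6) S" using generate.one[of "sym_group 6"] by (simp add: sym_group_one)
      moreover have "outer_aut id = id" by (rule outer_aut_eqI[OF outer_id])
      ultimately show "id \<in> ?M" by (metis image_eqI)
    next
      fix p q assume "p \<in> ?M" "q \<in> ?M"
      then obtain \<sigma> \<tau> where st: "\<sigma> \<in> generate (sym_group 6) S" "\<tau> \<in> generate (sym_group 6) S"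
        "p = outer_aut \<sigma>" "q = outer_aut \<tau>" by blast
      then have "\<sigma> permutes {1..6}" "\<tau> permutes {1..6}"
        using generate_in_carrier[OF SC] by (auto simp: sym_group_def)
      then have "p \<circ> q = outer_aut (\<sigma> \<circ> \<tau>)" using st outer_aut_comp by simp
      moreover have "\<sigma> \<circ> \<tau> \<in> generate (sym_group 6) S"
        using generate.eng[OF st(1,2)] by (simp add: sym_group_mult)
      ultimately show "p \<circ> q \<in> ?M" by blast
    next
      fix \<sigma> \<pi> assume "\<sigma> \<in> S" "outer \<sigma> \<pi>"
      then show "\<pi> \<in> ?M" using outer_aut_eqI generate.incl by (metis image_eqI)
    qed
    then obtain \<tau> where \<tau>: "\<tau> \<in> generate (sym_group 6) S" "outer_aut \<sigma> = outer_aut \<tau>"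
      using \<sigma> by (auto simp: node_stab_def)
    have "\<sigma> permutes {1..6}" "\<tau> permutes {1..6}"
      using \<sigma> generate_in_carrier[OF SC \<tau>(1)] by (auto simp: node_stab_def sym_group_def)
    then have "\<sigma> = \<tau>" using \<tau>(2) bij_betw_imp_inj_on[OF outer_aut_bij] by (auto dest: inj_onD)
    then show "\<sigma> \<in> generate (sym_group 6) S" using \<tau>(1) by simp
  qed
  ultimately have "subgroup_generated (sym_group 6) S = perm_group (node_stab y)"
    using SC by (simp add: subgroup_generated_def sym_group_restrict Int_absorb1)
  then show ?thesis unfolding Aut_acts_as_def using node_perm_iso[OF y] by simp
qed

text \<open>Permutations preserving a function are products of transpositions inside its level sets.
  Composing \<open>p\<close> with the transposition of \<open>i\<close> and \<open>p i\<close> fixes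
  \<open>i\<close> and keeps all fixed points of \<open>p\<close>, so the number of moved points
  drops.\<close>

lemma level_stabilizer_subset:
  assumes id: "id \<in> M" and comp: "\<And>p q. p \<in> M \<Longrightarrow> q \<in> M \<Longrightarrow> p \<circ> q \<in> M"
    and tr: "\<And>i j. i \<in> S \<Longrightarrow> j \<in> S \<Longrightarrow> i < j \<Longrightarrow> y i = y j \<Longrightarrow> swap i j \<in> M"
    and p: "p permutes S" "\<And>i. i \<in> S \<Longrightarrow> y (p i) = y i" and fin: "finite (S :: nat set)"
  shows "p \<in> M"
  using p
proof (induction "card {i \<in> S. p i \<noteq> i}" arbitrary: p rule: less_induct)
  case less
  show ?case
  proof (cases "p = id")
    case False
    then obtain i where i: "p i \<noteq> i" by (auto simp: fun_eq_iff)
    have iS: "i \<in> S" using i permutes_not_in[OF less.prems(1)] by metis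
    have piS: "p i \<in> S" using iS by (simp only: permutes_in_image[OF less.prems(1)])
    let ?t = "swap i (p i)"
    have t: "?t \<in> M"
      using tr[of i "p i"] tr[of "p i" i] less.prems(2)[OF iS] i iS piS
      by (metis linorder_neqE_nat transpose_commute)
    let ?q = "?t \<circ> p"
    have q: "?q permutes S" by (intro permutes_compose less.prems(1) permutes_swap_id iS piS)
    have yq: "y (?q j) = y j" if "j \<in> S" for j
      using less.prems(2)[OF that] less.prems(2)[OF iS] by (auto simp: Transposition.transpose_def)
    have "{j \<in> S. ?q j \<noteq> j} \<subset> {j \<in> S. p j \<noteq> j}"
    proof
      have "?q j = j" if "p j = j" for j
      proof -
        have "j \<noteq> i" using that i by blast
        moreover have "j \<noteq> p i" using that \<open>j \<noteq> i\<close> permutes_inj[OF less.prems(1)] by (metis injD)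
        ultimately show ?thesis using that by (simp add: Transposition.transpose_def)
      qed
      then show "{j \<in> S. ?q j \<noteq> j} \<subseteq> {j \<in> S. p j \<noteq> j}" by blast
      have "i \<in> {j \<in> S. p j \<noteq> j}" "i \<notin> {j \<in> S. ?q j \<noteq> j}" using i iS by simp_all
      then show "{j \<in> S. ?q j \<noteq> j} \<noteq> {j \<in> S. p j \<noteq> j}" by blast
    qed
    then have "card {j \<in> S. ?q j \<noteq> j} < card {j \<in> S. p j \<noteq> j}"
      using fin by (intro psubset_card_mono) auto
    then have "?q \<in> M" using less.hyps q yq by blast
    moreover have "p = ?t \<circ> ?q" by (simp add: fun_eq_iff)
    ultimately show ?thesis using comp[OF t] by metis
  qed (use id in simp)
qed

section \<open>Stabilisers in the eight cases\<close>

lemma outer_wordI: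
  assumes "p permutes {1..6}" "set w \<subseteq> {1..5}" "word_image adj_lists w = [p 1, p 2, p 3, p 4, p 5, p 6]"
    "word_image adj_image_lists w = xs"
  shows "outer p (perm6 xs)"
  using outer_word[OF assms(2)] permutes_6_eq_perm6[OF assms(1)] unfolding assms(3,4) by metis

abbreviation (input) common_involution :: "nat \<Rightarrow> nat" where
  "common_involution \<equiv> cycle_of_list [1,3] \<circ> cycle_of_list [2,5] \<circ> cycle_of_list [4,6]"

text \<open>The generators of the eight groups with their outer images. Cycle types change in the
  typical way: a triple transposition becomes a transposition, two 3-cycles become one, and a
  6-cycle becomes a 3-cycle times a transposition.\<close>

lemma outer_cycles:
  "outer (common_involution) (perm6 [2,1,3,4,5,6])"
  "outer (cycle_of_list [1,4,5] \<circ> cycle_of_list [2,6,3]) (perm6 [3,1,2,4,5,6])"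
  "outer (cycle_of_list [3,4,5,6]) (perm6 [2,6,1,4,5,3])"
  "outer (cycle_of_list [3,5]) (perm6 [3,6,1,5,4,2])"
  "outer (cycle_of_list [1,3,2,5] \<circ> cycle_of_list [4,6]) (perm6 [3,6,2,5,4,1])"
  "outer (cycle_of_list [1,2] \<circ> cycle_of_list [3,5] \<circ> cycle_of_list [4,6]) (perm6 [1,2,3,5,4,6])"
  "outer (cycle_of_list [1,6,5,2,4,3]) (perm6 [3,1,2,5,4,6])"
  "outer (cycle_of_list [2,4]) (perm6 [3,4,1,2,6,5])"
  "outer (cycle_of_list [1,5] \<circ> cycle_of_list [2,3,4,6]) (perm6 [3,4,5,2,6,1])"
  "outer (cycle_of_list [1,2,5,6,4]) (perm6 [4,1,2,5,3,6])"
proof -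
  show "outer (common_involution) (perm6 [2,1,3,4,5,6])"
    by (rule outer_wordI[where w = "[4,5,2,3,4,1,2]"])
       (auto intro!: permutes_compose permutes_swap_id simp: Transposition.transpose_def)
  show "outer (cycle_of_list [1,4,5] \<circ> cycle_of_list [2,6,3]) (perm6 [3,1,2,4,5,6])"
    by (rule outer_wordI[where w = "[3,4,5,1,2,3,4,3,1,2]"])
       (auto intro!: permutes_compose permutes_swap_id simp: Transposition.transpose_def)
  show "outer (cycle_of_list [3,4,5,6]) (perm6 [2,6,1,4,5,3])"
    by (rule outer_wordI[where w = "[3,4,5]"])
       (auto intro!: permutes_compose permutes_swap_id simp: Transposition.transpose_def)
  show "outer (cycle_of_list [3,5]) (perm6 [3,6,1,5,4,2])"
    by (rule outer_wordI[where w = "[3,4,3]"])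
       (auto intro!: permutes_compose permutes_swap_id simp: Transposition.transpose_def)
  show "outer (cycle_of_list [1,3,2,5] \<circ> cycle_of_list [4,6]) (perm6 [3,6,2,5,4,1])"
    by (rule outer_wordI[where w = "[4,5,1,2,3,4,1,2]"])
       (auto intro!: permutes_compose permutes_swap_id simp: Transposition.transpose_def)
  show "outer (cycle_of_list [1,2] \<circ> cycle_of_list [3,5] \<circ> cycle_of_list [4,6]) (perm6 [1,2,3,5,4,6])"
    by (rule outer_wordI[where w = "[4,5,3,4,1]"])
       (auto intro!: permutes_compose permutes_swap_id simp: Transposition.transpose_def)
  show "outer (cycle_of_list [1,6,5,2,4,3]) (perm6 [3,1,2,5,4,6])"
    by (rule outer_wordI[where w = "[5,2,3,4,2,3,1,2,1]"])
       (auto intro!: permutes_compose permutes_swap_id simp: Transposition.transpose_def)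
  show "outer (cycle_of_list [2,4]) (perm6 [3,4,1,2,6,5])"
    by (rule outer_wordI[where w = "[2,3,2]"])
       (auto intro!: permutes_compose permutes_swap_id simp: Transposition.transpose_def)
  show "outer (cycle_of_list [1,5] \<circ> cycle_of_list [2,3,4,6]) (perm6 [3,4,5,2,6,1])"
    by (rule outer_wordI[where w = "[2,3,4,5,1,2,3,4,2,1]"])
       (auto intro!: permutes_compose permutes_swap_id simp: Transposition.transpose_def)
  show "outer (cycle_of_list [1,2,5,6,4]) (perm6 [4,1,2,5,3,6])"
    by (rule outer_wordI[where w = "[4,5,1,2,3,2]"])
       (auto intro!: permutes_compose permutes_swap_id simp: Transposition.transpose_def)
qed

text \<open>The generation arguments are proved once for an arbitrary submonoid. They are then used
  for the outer image of a generated subgroup, for the image of an abstract model, and for the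
  permutations of a subset.\<close>

locale perm_submonoid =
  fixes M :: "(nat \<Rightarrow> nat) set"
  assumes id_mem: "id \<in> M" and comp_mem: "p \<in> M \<Longrightarrow> q \<in> M \<Longrightarrow> p \<circ> q \<in> M"
begin

lemma perm6_mem:
  assumes "perm6 xs \<in> M" "perm6 ys \<in> M" "length ys = 6" "set ys \<subseteq> {1..6}"
    "map (\<lambda>k. xs ! (k - 1)) ys = zs"
  shows "perm6 zs \<in> M"
  using comp_mem[OF assms(1,2)] perm6_comp[OF assms(3,4)] assms(5) by simp

lemma swap_mem_trans:
  assumes "swap i j \<in> M" "swap j k \<in> M" "i \<noteq> k" "j \<noteq> k"
  shows "swap i k \<in> M"
  using comp_mem[OF comp_mem[OF assms(1,2)] assms(1)] transpose_comp_triple[OF assms(3,4)] by simp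

lemma swap_mem_iff_perm6:
  assumes "i \<in> {1..6}" "j \<in> {1..6}"
  shows "swap i j \<in> M \<longleftrightarrow> perm6 (map (swap i j) [1,2,3,4,5,6]) \<in> M"
  using permutes_6_eq_perm6[OF permutes_swap_id[OF assms]] by simp

text \<open>Conjugation extends transpositions along a path to all pairs of its vertices, so a level
  set needs only one path of transpositions.\<close>

lemma swap_mem_chain:
  assumes "successively (\<lambda>i j. swap i j \<in> M) xs" "i \<in> set xs" "j \<in> set xs"
  shows "swap i j \<in> M"
  using assms
proof (induction xs arbitrary: i j rule: induct_list012)
  case (3 x y zs)
  have xy: "swap x y \<in> M" using "3.prems"(1) by simp
  have IH: "swap i j \<in> M" if "i \<in> set (y # zs)" "j \<in> set (y # zs)" for i j
    using "3.IH"(2)[OF _ that] "3.prems"(1) by simp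
  have x: "swap x k \<in> M" if "k \<in> set (y # zs)" for k
  proof (cases "k = x \<or> k = y")
    case True
    then show ?thesis using xy id_mem by auto
  next
    case False
    then show ?thesis using swap_mem_trans[OF xy IH[of y k]] that by auto
  qed
  show ?case
    using x[of i] x[of j] IH[of i j] "3.prems"(2,3) id_mem by (auto simp: transpose_commute[of _ x] simp flip: id_def)
qed (use id_mem in auto)

end

text \<open>The permutation carries a triple on which \<open>y\<close> equals \<open>t\<close> to
  one on which it equals \<open>c * t\<close>, and \<open>t\<close> is the only such value. It is
  nonzero, as \<open>3 * t\<close> is a triple sum.\<close>

lemma scale_eq_1_of_level:
  fixes y :: "nat \<Rightarrow> 'a::field_char_0"
  assumes y: "nodal y" and p: "p permutes {1..6}" "\<And>i. i \<in> {1..6} \<Longrightarrow> y (p i) = c * y i"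
    and T: "T \<subseteq> {1..6}" "card T = 3" "\<And>i. i \<in> T \<Longrightarrow> y i = t"
    and uniq: "\<And>U u. U \<subseteq> {1..6} \<Longrightarrow> card U = 3 \<Longrightarrow> (\<And>i. i \<in> U \<Longrightarrow> y i = u) \<Longrightarrow> u = t"
  shows "c = 1"
proof -
  have "sum y T = 3 * t" using T(2,3) by simp
  then have "t \<noteq> 0" using y T(1,2) by (auto simp: nodal_def no_zero_triple_def)
  have "c * t = t"
  proof (rule uniq)
    show "p ` T \<subseteq> {1..6}" using T(1) permutes_image[OF p(1)] by blast
    show "card (p ` T) = 3" using T(2) card_image[OF permutes_inj_on[OF p(1)]] by metis
    show "y i = c * t" if "i \<in> p ` T" for i using that p(2) T(1,3) by auto
  qed
  then show ?thesis using \<open>t \<noteq> 0\<close> by simp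
qed

lemma card_3_subset_level:
  fixes y :: "nat \<Rightarrow> 'a"
  assumes U: "U \<subseteq> {1..6::nat}" "card U = 3" "\<And>i. i \<in> U \<Longrightarrow> y i = u"
  obtains i j k where "i < j" "j < k" "i \<in> {1, 2, 3, 4, 5, 6}" "j \<in> {1, 2, 3, 4, 5, 6}" "k \<in> {1, 2, 3, 4, 5, 6}"
    "y i = u" "y j = u" "y k = u"
proof -
  have fin: "finite U" using U(1) finite_subset by blast
  define xs where "xs = sorted_list_of_set U"
  have len: "length xs = 3" and set: "set xs = U" and sorted: "sorted_wrt (<) xs"
    using fin U(2) by (simp_all add: xs_def)
  obtain i j k where xs: "xs = [i, j, k]"
    using len by (auto simp: eval_nat_numeral length_Suc_conv)
  have "i < j" "j < k" "i \<in> U" "j \<in> U" "k \<in> U" using sorted set unfolding xs by auto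
  then show ?thesis using that U(1,3) unfolding interval_6 by blast
qed

lemma perm6_stabI:
  assumes "outer \<sigma> (perm6 [a, b, c, d, e, f])"
    and "y a = m * y 1" "y b = m * y 2" "y c = m * y 3" "y d = m * y 4" "y e = m * y 5" "y f = m * y 6"
  shows "perm6 [a, b, c, d, e, f] \<in> stab y"
proof -
  have "\<forall>i\<in>{1..6}. y (perm6 [a, b, c, d, e, f] i) = m * y i"
    unfolding ball_interval_6 perm6_simps using assms(2-7) by blast
  then show ?thesis using outer_permutes(2)[OF assms(1)] unfolding stab_def by blast
qed

context perm_submonoid
begin

lemma stab_subset:
  assumes scale: "\<And>p c. p permutes {1..6} \<Longrightarrow> (\<And>i. i \<in> {1..6} \<Longrightarrow> y (p i) = c * y i) \<Longrightarrow> c = 1"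
    and tr: "\<And>i j. i \<in> {1..6} \<Longrightarrow> j \<in> {1..6} \<Longrightarrow> i < j \<Longrightarrow> y i = y j \<Longrightarrow> swap i j \<in> M"
  shows "stab y \<subseteq> M"
proof
  fix p assume "p \<in> stab y"
  then obtain c where c: "p permutes {1..6}" "\<And>i. i \<in> {1..6} \<Longrightarrow> y (p i) = c * y i"
    by (metis stabE)
  have "c = 1" using scale[OF c] .
  then have "\<And>i. i \<in> {1..6} \<Longrightarrow> y (p i) = y i" using c(2) by simp
  then show "p \<in> M" using level_stabilizer_subset[of M "{1..6}" y p, OF id_mem comp_mem tr c(1)] by blast
qed

lemma stab_subset_triple:
  fixes z :: "nat \<Rightarrow> 'a::field_char_0"
  assumes z: "nodal z" "z 2 = z 1" "z 3 = z 1"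
    and uniq: "\<And>i j k. i < j \<Longrightarrow> j < k \<Longrightarrow> i \<in> {1, 2, 3, 4, 5, 6} \<Longrightarrow> j \<in> {1, 2, 3, 4, 5, 6} \<Longrightarrow>
      k \<in> {1, 2, 3, 4, 5, 6} \<Longrightarrow> z j = z i \<Longrightarrow> z k = z i \<Longrightarrow> z i = z 1"
    and tr: "\<And>i j. i \<in> {1..6} \<Longrightarrow> j \<in> {1..6} \<Longrightarrow> i < j \<Longrightarrow> z i = z j \<Longrightarrow> swap i j \<in> M"
  shows "stab z \<subseteq> M"
proof (rule stab_subset[OF _ tr])
  fix p c assume p: "p permutes {1..6}" "\<And>i. i \<in> {1..6} \<Longrightarrow> z (p i) = c * z i"
  show "c = 1"
  proof (rule scale_eq_1_of_level[OF z(1) p, where T = "{1, 2, 3}" and t = "z 1"])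
    show "z i = z 1" if "i \<in> {1, 2, 3}" for i using z(2,3) that by auto
    fix U u assume "U \<subseteq> {1..6::nat}" "card U = 3" "\<And>i. i \<in> U \<Longrightarrow> z i = u"
    then obtain i j k where "i < j" "j < k" "i \<in> {1, 2, 3, 4, 5, 6}" "j \<in> {1, 2, 3, 4, 5, 6}"
        "k \<in> {1, 2, 3, 4, 5, 6}" "z i = u" "z j = u" "z k = u"
      by (rule card_3_subset_level)
    then show "u = z 1" using uniq[of i j k] by simp
  qed auto
qed

text \<open>Composition with the involution \<open>w\<close>, which negates \<open>y\<close>,
  reduces scalar -1 to scalar 1.\<close>

lemma stab_subset_signed:
  assumes scale: "\<And>p c. p permutes {1..6} \<Longrightarrow> (\<And>i. i \<in> {1..6} \<Longrightarrow> y (p i) = c * y i) \<Longrightarrow> c = 1 \<or> c = -1"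
    and tr: "\<And>i j. i \<in> {1..6} \<Longrightarrow> j \<in> {1..6} \<Longrightarrow> i < j \<Longrightarrow> y i = y j \<Longrightarrow> swap i j \<in> M"
    and w: "w \<in> M" "w permutes {1..6}" "w \<circ> w = id" "\<And>i. i \<in> {1..6} \<Longrightarrow> y (w i) = - y i"
  shows "stab y \<subseteq> M"
proof
  fix p assume "p \<in> stab y"
  then obtain c where c: "p permutes {1..6}" "\<And>i. i \<in> {1..6} \<Longrightarrow> y (p i) = c * y i"
    by (metis stabE)
  have level: "q \<in> M" if "q permutes {1..6}" "\<And>i. i \<in> {1..6} \<Longrightarrow> y (q i) = y i" for q
    using level_stabilizer_subset[of M "{1..6}" y q, OF id_mem comp_mem tr that] by blast
  show "p \<in> M"
  proof (cases "c = 1")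
    case True
    then show ?thesis using level[OF c(1)] c(2) by simp
  next
    case False
    then have "c = -1" using scale[OF c] by blast
    then have "y ((w \<circ> p) i) = y i" if "i \<in> {1..6}" for i
      using w(4)[of "p i"] c(2)[OF that] that by (simp add: permutes_in_image[OF c(1)] del: One_nat_def atLeastAtMost_iff)
    then have "w \<circ> p \<in> M" using level permutes_compose[OF c(1) w(2)] by blast
    moreover have "p = w \<circ> (w \<circ> p)" using w(3) by (metis comp_assoc id_comp)
    ultimately show ?thesis using comp_mem[OF w(1)] by metis
  qed
qed

end

section \<open>Normal forms of the coordinates and the scalars of their symmetries\<close>

definition type1 :: "(nat \<Rightarrow> 'a::field) \<Rightarrow> bool" where
  "type1 z \<longleftrightarrow> z 2 = z 1 \<and> distinct [z 1, z 3, z 4, z 5, z 6]"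
definition type2 :: "(nat \<Rightarrow> 'a::field) \<Rightarrow> bool" where
  "type2 z \<longleftrightarrow> z 2 = z 1 \<and> z 3 = z 1 \<and> distinct [z 1, z 4, z 5, z 6]"
text \<open>The indices carrying equal values are chosen to fit the prescribed relations and
  generators, here the set 1, 2, 3, 6.\<close>

definition type3 :: "(nat \<Rightarrow> 'a::field) \<Rightarrow> bool" where
  "type3 z \<longleftrightarrow> z 2 = z 1 \<and> z 3 = z 1 \<and> z 6 = z 1 \<and> distinct [z 1, z 4, z 5]"
definition type4 :: "(nat \<Rightarrow> 'a::field) \<Rightarrow> bool" where
  "type4 z \<longleftrightarrow> z 2 = z 1 \<and> z 3 = - z 1 \<and> z 6 = - z 1 \<and> z 5 = - z 4 \<and> z 4 \<noteq> z 1 \<and> z 4 \<noteq> - z 1"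
text \<open>The excluded configuration has an additional symmetry with scalar -1, exchanging the two
  pairs and the indices 3 and 6. After reordering it is \<open>type4\<close>.\<close>

definition type5 :: "(nat \<Rightarrow> 'a::field) \<Rightarrow> bool" where
  "type5 z \<longleftrightarrow> z 2 = z 1 \<and> z 5 = z 4 \<and> distinct [z 1, z 4, z 3, z 6] \<and> \<not> (z 4 = - z 1 \<and> z 6 = - z 3)"
definition type6 :: "(nat \<Rightarrow> 'a::field) \<Rightarrow> bool" where
  "type6 z \<longleftrightarrow> z 2 = z 1 \<and> z 3 = z 1 \<and> z 5 = z 4 \<and> distinct [z 1, z 4, z 6]"
definition type7 :: "(nat \<Rightarrow> 'a::field) \<Rightarrow> bool" where
  "type7 z \<longleftrightarrow> z 1 = -1 \<and> z 2 = -1 \<and> z 3 = 1 \<and> z 4 = 1 \<and> z 5 = -1 \<and> z 6 = 1"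
text \<open>Here and in \<open>type7\<close> the coefficients themselves are prescribed, which fixes
  the scale of \<open>z\<close>: the triple sums are 1 and -1.\<close>

definition type8 :: "(nat \<Rightarrow> 'a::field) \<Rightarrow> bool" where
  "type8 z \<longleftrightarrow> z 2 = z 1 \<and> z 3 = z 1 \<and> z 4 = z 1 \<and> z 5 = z 1 \<and> z 1 = 1/3 \<and> z 6 = - 5 / 3"

text \<open>Indices 1 and 2 carry the only repeated value, so \<open>c\<close> fixes it, and
  \<open>c\<close> different from 1 makes it zero. The other four values are then nonzero and no two
  are opposite, because the triple with index 1 would sum to zero. But a nontrivial fourth root of
  unity has -1 among its powers.\<close>

lemma scale_type1:
  fixes z :: "nat \<Rightarrow> 'a::field_char_0"
  assumes z: "nodal z" "type1 z" and p: "p permutes {1..6}" "\<And>i. i \<in> {1..6} \<Longrightarrow> z (p i) = c * z i"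
  shows "c = 1"
proof (rule ccontr)
  assume c1: "c \<noteq> 1"
  have eqs: "z 2 = z 1" and dist: "distinct [z 1, z 3, z 4, z 5, z 6]" using z(2) by (auto simp: type1_def)
  have pm: "p i \<in> {1..6}" if "i \<in> {1..6}" for i using that by (simp only: permutes_in_image[OF p(1)])
  have level: "i \<in> {1, 2}" if "i \<in> {1..6}" "z i = z 1" for i
    using that dist unfolding interval_6 by auto
  have "p 1 \<noteq> p 2" using permutes_inj[OF p(1)] by (simp add: inj_eq)
  have single: "i = j" if "i \<in> {1..6}" "j \<in> {1..6}" "z i = z j" "z i \<noteq> z 1" for i j
    using that eqs dist unfolding interval_6 by (elim insertE emptyE) (simp_all add: eqs)
  have "c * z 1 = z 1"
  proof (rule ccontr)
    assume "c * z 1 \<noteq> z 1"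
    then have "p 1 = p 2" using single[OF pm pm, of 1 2] p(2)[of 1] p(2)[of 2] eqs by auto
    then show False using \<open>p 1 \<noteq> p 2\<close> by blast
  qed
  then have z1: "z 1 = 0" using c1 by simp
  have c0: "c \<noteq> 0" using nodal_scale_nonzero[OF z(1) p] .
  have nz: "z i \<noteq> 0" if "i \<in> {3..6}" for i
    using dist that z1 by (auto simp: atLeastAtMost_iff numeral_eq_Suc le_Suc_eq)
  have neg: "\<not> (j \<in> {1..6} \<and> z j = - z i)" if "i \<in> {3..6}" for i j
  proof
    assume j: "j \<in> {1..6} \<and> z j = - z i"
    have "j \<noteq> i" "j \<noteq> 1" using j nz[OF that] z1 by auto
    then have "z 1 + z i + z j \<noteq> 0"
      using z(1) that j by (intro no_zero_tripleD) (auto simp: nodal_def)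
    then show False using z1 j by simp
  qed
  have img: "p ` {3..6} \<subseteq> {3..6}"
  proof
    fix j assume "j \<in> p ` {3..6}"
    then obtain i where i: "i \<in> {3..6}" "j = p i" by blast
    then have i6: "i \<in> {1..6}" by simp
    have "z j \<noteq> 0" using p(2)[OF i6] nz[OF i(1)] c0 i(2) by simp
    then have "j \<noteq> 1" "j \<noteq> 2" using z1 eqs by auto
    moreover have "j \<in> {1..6}" using pm[OF i6] i(2) by blast
    ultimately show "j \<in> {3..6}" by auto
  qed
  have inj: "inj_on p {3..6}" using permutes_inj_on[OF p(1)] .
  have "p ` {3..6} = {3..6}" using endo_inj_surj[OF _ img inj] by simp
  \<comment> \<open>The four nonzero values are permuted, so their product is multiplied both by 1
    and by \<open>c ^ 4\<close>.\<close>
  then have "(\<Prod>i\<in>{3..6}. z i) = (\<Prod>i\<in>{3..6}. z (p i))"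
    using prod.reindex[OF inj, of z] by simp
  also have "\<dots> = (\<Prod>i\<in>{3..6}. c * z i)" using p(2) by (intro prod.cong) auto
  also have "\<dots> = c ^ 4 * (\<Prod>i\<in>{3..6}. z i)" by (simp add: prod.distrib)
  finally have "c ^ 4 = 1" using nz by simp
  then have "(c ^ 2) ^ 2 = 1" by algebra
  then have "c ^ 2 = 1 \<or> c ^ 2 = -1" using power2_eq_1_iff[of "c ^ 2"] by blast
  then show False
  proof
    assume "c ^ 2 = 1"
    then have "c = -1" using c1 by (simp add: power2_eq_1_iff)
    then show False using neg[of 3 "p 3"] p(2)[of 3] pm[of 3] by simp
  next
    assume c2: "c ^ 2 = -1"
    have "z (p (p 3)) = c ^ 2 * z 3" using p(2)[of 3] p(2)[OF pm[of 3]] by (simp add: power2_eq_square)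
    then show False using neg[of 3 "p (p 3)"] c2 pm[OF pm[of 3]] by simp
  qed
qed

text \<open>Repeated values go to repeated values. If \<open>c\<close> is not 1 it exchanges the two
  of them, hence \<open>c\<close> is -1 and they are opposite. Then the value at 3 must be opposite
  to that at 6, the configuration excluded from \<open>type5\<close>.\<close>

lemma scale_type5:
  fixes z :: "nat \<Rightarrow> 'a::field_char_0"
  assumes z: "nodal z" "type5 z" and p: "p permutes {1..6}" "\<And>i. i \<in> {1..6} \<Longrightarrow> z (p i) = c * z i"
  shows "c = 1"
proof (rule ccontr)
  assume c1: "c \<noteq> 1"
  have eqs: "z 2 = z 1" "z 5 = z 4" and dist: "distinct [z 1, z 4, z 3, z 6]"
    using z(2) by (auto simp: type5_def)
  have pm: "p i \<in> {1..6}" if "i \<in> {1..6}" for i using that by (simp only: permutes_in_image[OF p(1)])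
  have c0: "c \<noteq> 0" using nodal_scale_nonzero[OF z(1) p] .
  have single: "i = j" if "i \<in> {1..6}" "j \<in> {1..6}" "z i = z j" "z i \<noteq> z 1" "z i \<noteq> z 4" for i j
    using that eqs dist unfolding interval_6 by (elim insertE emptyE) (simp_all add: eqs)
  have ne: "p 1 \<noteq> p 2" "p 4 \<noteq> p 5" using permutes_inj[OF p(1)] by (simp_all add: inj_eq)
  have d1: "c * z 1 = z 1 \<or> c * z 1 = z 4"
    using single[OF pm pm, of 1 2] p(2)[of 1] p(2)[of 2] eqs ne by auto
  have d4: "c * z 4 = z 1 \<or> c * z 4 = z 4"
    using single[OF pm pm, of 4 5] p(2)[of 4] p(2)[of 5] eqs ne by auto
  have z14: "z 1 \<noteq> z 4" using dist by simp
  have swap: "c * z 1 = z 4" "c * z 4 = z 1"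
    using d1 d4 z14 c1 c0 by auto
  then have "c * c * z 1 = z 1" by (simp add: mult.assoc)
  moreover have "z 1 \<noteq> 0" using swap z14 c0 by auto
  ultimately have "c ^ 2 = 1" by (simp add: power2_eq_square)
  then have c: "c = -1" using c1 by (simp add: power2_eq_1_iff)
  then have z4: "z 4 = - z 1" using swap by simp
  have "z 1 + z 3 + z 4 \<noteq> 0" using z(1) by (intro no_zero_tripleD) (auto simp: nodal_def)
  then have z3: "z 3 \<noteq> 0" using z4 by simp
  have "z (p 3) = - z 3" using p(2)[of 3] c by simp
  moreover have "p 3 \<in> {1, 2, 3, 4, 5, 6}" using pm[of 3] unfolding interval_6 by simp
  ultimately have "z 1 = - z 3 \<or> z 3 = - z 3 \<or> z 4 = - z 3 \<or> z 6 = - z 3" using eqs by auto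
  moreover have "z 1 \<noteq> - z 3" "z 4 \<noteq> - z 3" using dist z4 by (auto simp: equation_minus_iff)
  moreover have "z 3 \<noteq> - z 3" using z3 by (simp add: eq_neg_iff_add_eq_0 flip: mult_2)
  ultimately have "z 6 = - z 3" by blast
  then show False using z(2) z4 by (simp add: type5_def)
qed

lemma nodal_neq_neg:
  fixes z :: "nat \<Rightarrow> 'a::field_char_0"
  assumes "nodal z" "type4 z"
  shows "z 1 \<noteq> - z 1" "- z 1 \<noteq> z 1" "z 4 \<noteq> - z 4" "- z 4 \<noteq> z 4" "- z 4 \<noteq> - z 1" "- z 4 \<noteq> z 1"
proof -
  have nz: "no_zero_triple z" using assms(1) by (simp add: nodal_def)
  have "z 1 + z 3 + z 4 \<noteq> 0" by (rule no_zero_tripleD[OF nz]) auto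
  then have z4: "z 4 \<noteq> 0" using assms(2) by (auto simp: type4_def)
  have "z 1 + z 4 + z 5 \<noteq> 0" by (rule no_zero_tripleD[OF nz]) auto
  then have z1: "z 1 \<noteq> 0" using assms(2) by (auto simp: type4_def)
  have neg: "x \<noteq> - x" if "x \<noteq> 0" for x :: 'a using that by (simp add: eq_neg_iff_add_eq_0 flip: mult_2)
  show "z 1 \<noteq> - z 1" "- z 1 \<noteq> z 1" "z 4 \<noteq> - z 4" "- z 4 \<noteq> z 4"
    using neg[OF z1] neg[OF z4] by metis+
  show "- z 4 \<noteq> - z 1" "- z 4 \<noteq> z 1" using assms(2) by (auto simp: type4_def minus_equation_iff)
qed

text \<open>The values at 4 and 5 occur once each, so the repeated value at 1 and 2 can only go to
  itself or its negative.\<close>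

lemma scale_type4:
  fixes z :: "nat \<Rightarrow> 'a::field_char_0"
  assumes z: "nodal z" "type4 z" and p: "p permutes {1..6}" "\<And>i. i \<in> {1..6} \<Longrightarrow> z (p i) = c * z i"
  shows "c = 1 \<or> c = -1"
proof -
  note ne = nodal_neq_neg[OF z]
  have eqs: "z 2 = z 1" "z 3 = - z 1" "z 6 = - z 1" "z 5 = - z 4" "z 4 \<noteq> z 1" "z 4 \<noteq> - z 1"
    using z(2) by (simp_all add: type4_def)
  have pm: "p i \<in> {1..6}" if "i \<in> {1..6}" for i using that by (simp only: permutes_in_image[OF p(1)])
  have single: "i = j" if "i \<in> {1..6}" "j \<in> {1..6}" "z i = z j" "z i \<noteq> z 1" "z i \<noteq> - z 1" for i j
    using that eqs ne unfolding interval_6 by (elim insertE emptyE) (simp_all add: eqs)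
  have "p 1 \<noteq> p 2" using permutes_inj[OF p(1)] by (simp add: inj_eq)
  then have "c * z 1 = z 1 \<or> c * z 1 = - z 1"
    using single[OF pm pm, of 1 2] p(2)[of 1] p(2)[of 2] eqs(1) by auto
  moreover have "z 1 \<noteq> 0" using ne(1) by auto
  ultimately show ?thesis by (metis mult_cancel_right mult_minus1 mult_1)
qed

lemma scale_type7:
  fixes z :: "nat \<Rightarrow> 'a::field_char_0"
  assumes z: "nodal z" "type7 z" and p: "p permutes {1..6}" "\<And>i. i \<in> {1..6} \<Longrightarrow> z (p i) = c * z i"
  shows "c = 1 \<or> c = -1"
proof -
  have "(1::nat) \<in> {1..6}" by simp
  then have "p 1 \<in> {1..6}" by (simp only: permutes_in_image[OF p(1)])
  then have "z (p 1) = 1 \<or> z (p 1) = -1" using z(2) unfolding interval_6 type7_def by auto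
  then have "- c = 1 \<or> - c = -1" using p(2)[of 1] z(2) by (auto simp: type7_def)
  then show ?thesis by (auto simp: minus_equation_iff)
qed

text \<open>Lists pair each node generator with its coordinate image.\<close>

lemma Aut_acts_as_generatorsI:
  fixes z :: "nat \<Rightarrow> 'a::field_char_0"
  assumes z: "nodal z" and o: "list_all2 outer ss ps" and st: "set ps \<subseteq> stab z"
    and gen: "\<And>M. perm_submonoid M \<Longrightarrow> set ps \<subseteq> M \<Longrightarrow> stab z \<subseteq> M"
  shows "Aut_acts_as (threefold z) (set ss)"
proof (rule Aut_acts_asI[OF z])
  have len: "length ss = length ps" and outer: "\<And>n. n < length ps \<Longrightarrow> outer (ss ! n) (ps ! n)"
    using o by (simp_all add: list_all2_conv_all_nth)
  show "\<exists>\<pi>. outer \<sigma> \<pi> \<and> \<pi> \<in> stab z" if "\<sigma> \<in> set ss" for \<sigma>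
    using that len outer st by (metis in_set_conv_nth subsetD)
  fix M :: "(nat \<Rightarrow> nat) set"
  assume M: "id \<in> M" "\<And>p q. p \<in> M \<Longrightarrow> q \<in> M \<Longrightarrow> p \<circ> q \<in> M"
    and gens: "\<And>\<sigma> \<pi>. \<sigma> \<in> set ss \<Longrightarrow> outer \<sigma> \<pi> \<Longrightarrow> \<pi> \<in> M"
  have "set ps \<subseteq> M"
  proof
    fix \<pi> assume "\<pi> \<in> set ps"
    then show "\<pi> \<in> M" using len outer gens by (metis in_set_conv_nth)
  qed
  moreover have "perm_submonoid M" using M by (simp add: perm_submonoid_def)
  ultimately show "stab z \<subseteq> M" by (intro gen)
qed

section \<open>Generators of the stabilisers of the normal forms\<close>

lemma stab_subset_type1:
  fixes z :: "nat \<Rightarrow> 'a::field_char_0"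
  assumes z: "nodal z" "type1 z" and M: "perm_submonoid M"
    and gens: "perm6 [2,1,3,4,5,6] \<in> M"
  shows "stab z \<subseteq> M"
proof -
  interpret perm_submonoid M by (rule M)
  have chain: "successively (\<lambda>i j. swap i j \<in> M) [1,2]"
    using gens  by (simp add: swap_mem_iff_perm6 Transposition.transpose_def)
  note swaps = swap_mem_chain[OF chain]
  have tr: "swap i j \<in> M" if "i \<in> {1..6}" "j \<in> {1..6}" "i < j" "z i = z j" for i j
    using z(2) that unfolding interval_6 type1_def by (elim insertE emptyE) (auto intro: swaps)
  show ?thesis by (rule stab_subset[OF scale_type1[OF z] tr])
qed

lemma Aut_acts_as_type1:
  fixes z :: "nat \<Rightarrow> 'a::field_char_0"
  assumes z: "nodal z" "type1 z"
  shows "Aut_acts_as (threefold z) {common_involution}"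
proof -
  note o = outer_cycles(1)
  have st: "perm6 [2,1,3,4,5,6] \<in> stab z"
    by (rule perm6_stabI[OF outer_cycles(1), where m = "1"];
      use z(2) in \<open>simp add: type1_def\<close>)+
  have "Aut_acts_as (threefold z) (set [common_involution])"
    by (rule Aut_acts_as_generatorsI[OF z(1), where ps = "[perm6 [2,1,3,4,5,6]]"])
      (use o st stab_subset_type1[OF z] in \<open>simp_all del: cycle_of_list.simps o_apply\<close>)
  then show ?thesis by (simp only: list.set)
qed

text \<open>The intermediate products, here and for the later types, lead from the prescribed
  generators to transpositions forming a path through every level set of \<open>z\<close>.\<close>

lemma stab_subset_type2:
  fixes z :: "nat \<Rightarrow> 'a::field_char_0"
  assumes z: "nodal z" "type2 z" and M: "perm_submonoid M"
    and gens: "perm6 [2,1,3,4,5,6] \<in> M" "perm6 [3,1,2,4,5,6] \<in> M"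
  shows "stab z \<subseteq> M"
proof -
  interpret perm_submonoid M by (rule M)
  have "perm6 [1,3,2,4,5,6] \<in> M"
    by (rule perm6_mem[of "[3,1,2,4,5,6]" "[2,1,3,4,5,6]"]) (fact gens | fact | simp)+
  have "perm6 [2,3,1,4,5,6] \<in> M"
    by (rule perm6_mem[of "[3,1,2,4,5,6]" "[3,1,2,4,5,6]"]) (fact gens | fact | simp)+
  have "perm6 [3,2,1,4,5,6] \<in> M"
    by (rule perm6_mem[of "[1,3,2,4,5,6]" "[2,3,1,4,5,6]"]) (fact gens | fact | simp)+
  have chain: "successively (\<lambda>i j. swap i j \<in> M) [2,1,3]"
    using gens \<open>perm6 [3,2,1,4,5,6] \<in> M\<close> by (simp add: swap_mem_iff_perm6 Transposition.transpose_def)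
  note swaps = swap_mem_chain[OF chain]
  have tr: "swap i j \<in> M" if "i \<in> {1..6}" "j \<in> {1..6}" "i < j" "z i = z j" for i j
    using z(2) that unfolding interval_6 type2_def by (elim insertE emptyE) (auto intro: swaps)
  show ?thesis
  proof (rule stab_subset_triple[OF z(1) _ _ _ tr])
    show "z 2 = z 1" "z 3 = z 1" using z(2) by (simp_all add: type2_def)
    show "z i = z 1" if "i < j" "j < k" "i \<in> {1, 2, 3, 4, 5, 6}" "j \<in> {1, 2, 3, 4, 5, 6}"
        "k \<in> {1, 2, 3, 4, 5, 6}" "z j = z i" "z k = z i" for i j k
      using that z(2) unfolding type2_def by (elim insertE emptyE) auto
  qed
qed

lemma Aut_acts_as_type2:
  fixes z :: "nat \<Rightarrow> 'a::field_char_0"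
  assumes z: "nodal z" "type2 z"
  shows "Aut_acts_as (threefold z) {common_involution, cycle_of_list [1,4,5] \<circ> cycle_of_list [2,6,3]}"
proof -
  note o = outer_cycles(1) outer_cycles(2)
  have st: "perm6 [2,1,3,4,5,6] \<in> stab z" "perm6 [3,1,2,4,5,6] \<in> stab z"
    by (rule perm6_stabI[OF outer_cycles(1), where m = "1"] perm6_stabI[OF outer_cycles(2), where m = "1"];
      use z(2) in \<open>simp add: type2_def\<close>)+
  have "Aut_acts_as (threefold z) (set [common_involution, cycle_of_list [1,4,5] \<circ> cycle_of_list [2,6,3]])"
    by (rule Aut_acts_as_generatorsI[OF z(1), where ps = "[perm6 [2,1,3,4,5,6], perm6 [3,1,2,4,5,6]]"])
      (use o st stab_subset_type2[OF z] in \<open>simp_all del: cycle_of_list.simps o_apply\<close>)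
  then show ?thesis by (simp only: list.set)
qed

lemma stab_subset_type3:
  fixes z :: "nat \<Rightarrow> 'a::field_char_0"
  assumes z: "nodal z" "type3 z" and M: "perm_submonoid M"
    and gens: "perm6 [2,1,3,4,5,6] \<in> M" "perm6 [2,6,1,4,5,3] \<in> M"
  shows "stab z \<subseteq> M"
proof -
  interpret perm_submonoid M by (rule M)
  have "perm6 [6,2,1,4,5,3] \<in> M"
    by (rule perm6_mem[of "[2,6,1,4,5,3]" "[2,1,3,4,5,6]"]) (fact gens | fact | simp)+
  have "perm6 [6,3,2,4,5,1] \<in> M"
    by (rule perm6_mem[of "[2,6,1,4,5,3]" "[2,6,1,4,5,3]"]) (fact gens | fact | simp)+
  have "perm6 [3,1,6,4,5,2] \<in> M"
    by (rule perm6_mem[of "[6,3,2,4,5,1]" "[2,6,1,4,5,3]"]) (fact gens | fact | simp)+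
  have "perm6 [1,6,3,4,5,2] \<in> M"
    by (rule perm6_mem[of "[6,2,1,4,5,3]" "[3,1,6,4,5,2]"]) (fact gens | fact | simp)+
  have "perm6 [2,3,1,4,5,6] \<in> M"
    by (rule perm6_mem[of "[2,6,1,4,5,3]" "[1,6,3,4,5,2]"]) (fact gens | fact | simp)+
  have "perm6 [1,2,6,4,5,3] \<in> M"
    by (rule perm6_mem[of "[2,3,1,4,5,6]" "[3,1,6,4,5,2]"]) (fact gens | fact | simp)+
  have chain: "successively (\<lambda>i j. swap i j \<in> M) [1,2,6,3]"
    using gens \<open>perm6 [1,6,3,4,5,2] \<in> M\<close> \<open>perm6 [1,2,6,4,5,3] \<in> M\<close> by (simp add: swap_mem_iff_perm6 Transposition.transpose_def)
  note swaps = swap_mem_chain[OF chain]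
  have tr: "swap i j \<in> M" if "i \<in> {1..6}" "j \<in> {1..6}" "i < j" "z i = z j" for i j
    using z(2) that unfolding interval_6 type3_def by (elim insertE emptyE) (auto intro: swaps)
  show ?thesis
  proof (rule stab_subset_triple[OF z(1) _ _ _ tr])
    show "z 2 = z 1" "z 3 = z 1" using z(2) by (simp_all add: type3_def)
    show "z i = z 1" if "i < j" "j < k" "i \<in> {1, 2, 3, 4, 5, 6}" "j \<in> {1, 2, 3, 4, 5, 6}"
        "k \<in> {1, 2, 3, 4, 5, 6}" "z j = z i" "z k = z i" for i j k
      using that z(2) unfolding type3_def by (elim insertE emptyE) auto
  qed
qed

lemma Aut_acts_as_type3:
  fixes z :: "nat \<Rightarrow> 'a::field_char_0"
  assumes z: "nodal z" "type3 z"
  shows "Aut_acts_as (threefold z) {common_involution, cycle_of_list [3,4,5,6]}"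
proof -
  note o = outer_cycles(1) outer_cycles(3)
  have st: "perm6 [2,1,3,4,5,6] \<in> stab z" "perm6 [2,6,1,4,5,3] \<in> stab z"
    by (rule perm6_stabI[OF outer_cycles(1), where m = "1"] perm6_stabI[OF outer_cycles(3), where m = "1"];
      use z(2) in \<open>simp add: type3_def\<close>)+
  have "Aut_acts_as (threefold z) (set [common_involution, cycle_of_list [3,4,5,6]])"
    by (rule Aut_acts_as_generatorsI[OF z(1), where ps = "[perm6 [2,1,3,4,5,6], perm6 [2,6,1,4,5,3]]"])
      (use o st stab_subset_type3[OF z] in \<open>simp_all del: cycle_of_list.simps o_apply\<close>)
  then show ?thesis by (simp only: list.set)
qed

lemma stab_subset_type4:
  fixes z :: "nat \<Rightarrow> 'a::field_char_0"
  assumes z: "nodal z" "type4 z" and M: "perm_submonoid M"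
    and gens: "perm6 [3,6,1,5,4,2] \<in> M" "perm6 [3,6,2,5,4,1] \<in> M"
  shows "stab z \<subseteq> M"
proof -
  interpret perm_submonoid M by (rule M)
  have "perm6 [2,1,3,4,5,6] \<in> M"
    by (rule perm6_mem[of "[3,6,2,5,4,1]" "[3,6,1,5,4,2]"]) (fact gens | fact | simp)+
  have "perm6 [1,2,6,4,5,3] \<in> M"
    by (rule perm6_mem[of "[3,6,1,5,4,2]" "[3,6,2,5,4,1]"]) (fact gens | fact | simp)+
  have chain1: "successively (\<lambda>i j. swap i j \<in> M) [1,2]"
    using \<open>perm6 [2,1,3,4,5,6] \<in> M\<close> by (simp add: swap_mem_iff_perm6 Transposition.transpose_def)
  have chain2: "successively (\<lambda>i j. swap i j \<in> M) [3,6]"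
    using \<open>perm6 [1,2,6,4,5,3] \<in> M\<close> by (simp add: swap_mem_iff_perm6 Transposition.transpose_def)
  note swaps = swap_mem_chain[OF chain1] swap_mem_chain[OF chain2]
  have tr: "swap i j \<in> M" if "i \<in> {1..6}" "j \<in> {1..6}" "i < j" "z i = z j" for i j
    using z(2) that nodal_neq_neg[OF z] unfolding interval_6 type4_def by (elim insertE emptyE) (auto intro: swaps)
  \<comment> \<open>The outer image of the node transposition (3,5): an involution exchanging
    opposite values of \<open>z\<close>.\<close>
  let ?w = "perm6 [3,6,1,5,4,2]"
  have w: "?w permutes {1..6}" using outer_permutes(2)[OF outer_cycles(4)] .
  have "?w \<circ> ?w = perm6 [1,2,3,4,5,6]" by (subst perm6_comp) auto
  also have "\<dots> = id" using permutes_6_eq_perm6[OF permutes_id] by simp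
  finally have ww: "?w \<circ> ?w = id" .
  have "\<forall>i\<in>{1..6}. z (?w i) = - z i"
    using z(2) unfolding ball_interval_6 perm6_simps type4_def by auto
  then have neg: "z (?w i) = - z i" if "i \<in> {1..6}" for i using that by blast
  show ?thesis by (rule stab_subset_signed[where y = z and w = "?w", OF scale_type4[OF z] tr gens(1) w ww neg])
qed

lemma Aut_acts_as_type4:
  fixes z :: "nat \<Rightarrow> 'a::field_char_0"
  assumes z: "nodal z" "type4 z"
  shows "Aut_acts_as (threefold z) {cycle_of_list [3,5], cycle_of_list [1,3,2,5] \<circ> cycle_of_list [4,6]}"
proof -
  note o = outer_cycles(4) outer_cycles(5)
  have st: "perm6 [3,6,1,5,4,2] \<in> stab z" "perm6 [3,6,2,5,4,1] \<in> stab z"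
    by (rule perm6_stabI[OF outer_cycles(4), where m = "- 1"] perm6_stabI[OF outer_cycles(5), where m = "- 1"];
      use z(2) in \<open>simp add: type4_def\<close>)+
  have "Aut_acts_as (threefold z) (set [cycle_of_list [3,5], cycle_of_list [1,3,2,5] \<circ> cycle_of_list [4,6]])"
    by (rule Aut_acts_as_generatorsI[OF z(1), where ps = "[perm6 [3,6,1,5,4,2], perm6 [3,6,2,5,4,1]]"])
      (use o st stab_subset_type4[OF z] in \<open>simp_all del: cycle_of_list.simps o_apply\<close>)
  then show ?thesis by (simp only: list.set)
qed

lemma stab_subset_type5:
  fixes z :: "nat \<Rightarrow> 'a::field_char_0"
  assumes z: "nodal z" "type5 z" and M: "perm_submonoid M"
    and gens: "perm6 [1,2,3,5,4,6] \<in> M" "perm6 [2,1,3,4,5,6] \<in> M"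
  shows "stab z \<subseteq> M"
proof -
  interpret perm_submonoid M by (rule M)
  have chain1: "successively (\<lambda>i j. swap i j \<in> M) [1,2]"
    using gens  by (simp add: swap_mem_iff_perm6 Transposition.transpose_def)
  have chain2: "successively (\<lambda>i j. swap i j \<in> M) [4,5]"
    using gens  by (simp add: swap_mem_iff_perm6 Transposition.transpose_def)
  note swaps = swap_mem_chain[OF chain1] swap_mem_chain[OF chain2]
  have tr: "swap i j \<in> M" if "i \<in> {1..6}" "j \<in> {1..6}" "i < j" "z i = z j" for i j
    using z(2) that unfolding interval_6 type5_def by (elim insertE emptyE) (auto intro: swaps)
  show ?thesis by (rule stab_subset[OF scale_type5[OF z] tr])
qed

lemma Aut_acts_as_type5:
  fixes z :: "nat \<Rightarrow> 'a::field_char_0"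
  assumes z: "nodal z" "type5 z"
  shows "Aut_acts_as (threefold z) {cycle_of_list [1,2] \<circ> cycle_of_list [3,5] \<circ> cycle_of_list [4,6], common_involution}"
proof -
  note o = outer_cycles(6) outer_cycles(1)
  have st: "perm6 [1,2,3,5,4,6] \<in> stab z" "perm6 [2,1,3,4,5,6] \<in> stab z"
    by (rule perm6_stabI[OF outer_cycles(6), where m = "1"] perm6_stabI[OF outer_cycles(1), where m = "1"];
      use z(2) in \<open>simp add: type5_def\<close>)+
  have "Aut_acts_as (threefold z) (set [cycle_of_list [1,2] \<circ> cycle_of_list [3,5] \<circ> cycle_of_list [4,6], common_involution])"
    by (rule Aut_acts_as_generatorsI[OF z(1), where ps = "[perm6 [1,2,3,5,4,6], perm6 [2,1,3,4,5,6]]"])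
      (use o st stab_subset_type5[OF z] in \<open>simp_all del: cycle_of_list.simps o_apply\<close>)
  then show ?thesis by (simp only: list.set)
qed

lemma stab_subset_type6:
  fixes z :: "nat \<Rightarrow> 'a::field_char_0"
  assumes z: "nodal z" "type6 z" and M: "perm_submonoid M"
    and gens: "perm6 [2,1,3,4,5,6] \<in> M" "perm6 [3,1,2,5,4,6] \<in> M"
  shows "stab z \<subseteq> M"
proof -
  interpret perm_submonoid M by (rule M)
  have "perm6 [1,3,2,5,4,6] \<in> M"
    by (rule perm6_mem[of "[3,1,2,5,4,6]" "[2,1,3,4,5,6]"]) (fact gens | fact | simp)+
  have "perm6 [2,3,1,4,5,6] \<in> M"
    by (rule perm6_mem[of "[3,1,2,5,4,6]" "[3,1,2,5,4,6]"]) (fact gens | fact | simp)+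
  have "perm6 [1,2,3,5,4,6] \<in> M"
    by (rule perm6_mem[of "[2,3,1,4,5,6]" "[3,1,2,5,4,6]"]) (fact gens | fact | simp)+
  have "perm6 [3,1,2,4,5,6] \<in> M"
    by (rule perm6_mem[of "[1,2,3,5,4,6]" "[3,1,2,5,4,6]"]) (fact gens | fact | simp)+
  have "perm6 [2,3,1,5,4,6] \<in> M"
    by (rule perm6_mem[of "[3,1,2,4,5,6]" "[3,1,2,5,4,6]"]) (fact gens | fact | simp)+
  have "perm6 [3,2,1,4,5,6] \<in> M"
    by (rule perm6_mem[of "[1,3,2,5,4,6]" "[2,3,1,5,4,6]"]) (fact gens | fact | simp)+
  have chain1: "successively (\<lambda>i j. swap i j \<in> M) [2,1,3]"
    using gens \<open>perm6 [3,2,1,4,5,6] \<in> M\<close> by (simp add: swap_mem_iff_perm6 Transposition.transpose_def)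
  have chain2: "successively (\<lambda>i j. swap i j \<in> M) [4,5]"
    using \<open>perm6 [1,2,3,5,4,6] \<in> M\<close> by (simp add: swap_mem_iff_perm6 Transposition.transpose_def)
  note swaps = swap_mem_chain[OF chain1] swap_mem_chain[OF chain2]
  have tr: "swap i j \<in> M" if "i \<in> {1..6}" "j \<in> {1..6}" "i < j" "z i = z j" for i j
    using z(2) that unfolding interval_6 type6_def by (elim insertE emptyE) (auto intro: swaps)
  show ?thesis
  proof (rule stab_subset_triple[OF z(1) _ _ _ tr])
    show "z 2 = z 1" "z 3 = z 1" using z(2) by (simp_all add: type6_def)
    show "z i = z 1" if "i < j" "j < k" "i \<in> {1, 2, 3, 4, 5, 6}" "j \<in> {1, 2, 3, 4, 5, 6}"
        "k \<in> {1, 2, 3, 4, 5, 6}" "z j = z i" "z k = z i" for i j k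
      using that z(2) unfolding type6_def by (elim insertE emptyE) auto
  qed
qed

lemma Aut_acts_as_type6:
  fixes z :: "nat \<Rightarrow> 'a::field_char_0"
  assumes z: "nodal z" "type6 z"
  shows "Aut_acts_as (threefold z) {common_involution, cycle_of_list [1,6,5,2,4,3]}"
proof -
  note o = outer_cycles(1) outer_cycles(7)
  have st: "perm6 [2,1,3,4,5,6] \<in> stab z" "perm6 [3,1,2,5,4,6] \<in> stab z"
    by (rule perm6_stabI[OF outer_cycles(1), where m = "1"] perm6_stabI[OF outer_cycles(7), where m = "1"];
      use z(2) in \<open>simp add: type6_def\<close>)+
  have "Aut_acts_as (threefold z) (set [common_involution, cycle_of_list [1,6,5,2,4,3]])"
    by (rule Aut_acts_as_generatorsI[OF z(1), where ps = "[perm6 [2,1,3,4,5,6], perm6 [3,1,2,5,4,6]]"])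
      (use o st stab_subset_type6[OF z] in \<open>simp_all del: cycle_of_list.simps o_apply\<close>)
  then show ?thesis by (simp only: list.set)
qed

lemma stab_subset_type7:
  fixes z :: "nat \<Rightarrow> 'a::field_char_0"
  assumes z: "nodal z" "type7 z" and M: "perm_submonoid M"
    and gens: "perm6 [2,1,3,4,5,6] \<in> M" "perm6 [3,4,1,2,6,5] \<in> M" "perm6 [3,4,5,2,6,1] \<in> M"
  shows "stab z \<subseteq> M"
proof -
  interpret perm_submonoid M by (rule M)
  have "perm6 [5,2,3,4,1,6] \<in> M"
    by (rule perm6_mem[of "[3,4,5,2,6,1]" "[3,4,1,2,6,5]"]) (fact gens | fact | simp)+
  have "perm6 [4,3,1,2,6,5] \<in> M"
    by (rule perm6_mem[of "[3,4,1,2,6,5]" "[2,1,3,4,5,6]"]) (fact gens | fact | simp)+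
  have "perm6 [1,2,4,3,5,6] \<in> M"
    by (rule perm6_mem[of "[4,3,1,2,6,5]" "[3,4,1,2,6,5]"]) (fact gens | fact | simp)+
  have "perm6 [1,2,6,4,5,3] \<in> M"
    by (rule perm6_mem[of "[3,4,1,2,6,5]" "[3,4,5,2,6,1]"]) (fact gens | fact | simp)+
  have chain1: "successively (\<lambda>i j. swap i j \<in> M) [2,1,5]"
    using gens \<open>perm6 [5,2,3,4,1,6] \<in> M\<close> by (simp add: swap_mem_iff_perm6 Transposition.transpose_def)
  have chain2: "successively (\<lambda>i j. swap i j \<in> M) [4,3,6]"
    using \<open>perm6 [1,2,4,3,5,6] \<in> M\<close> \<open>perm6 [1,2,6,4,5,3] \<in> M\<close> by (simp add: swap_mem_iff_perm6 Transposition.transpose_def)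
  note swaps = swap_mem_chain[OF chain1] swap_mem_chain[OF chain2]
  have tr: "swap i j \<in> M" if "i \<in> {1..6}" "j \<in> {1..6}" "i < j" "z i = z j" for i j
    using z(2) that unfolding interval_6 type7_def by (elim insertE emptyE) (auto intro: swaps)
  \<comment> \<open>The outer image of the node transposition (2,4); it exchanges the two level sets
    1, 2, 5 and 3, 4, 6.\<close>
  let ?w = "perm6 [3,4,1,2,6,5]"
  have w: "?w permutes {1..6}" using outer_permutes(2)[OF outer_cycles(8)] .
  have "?w \<circ> ?w = perm6 [1,2,3,4,5,6]" by (subst perm6_comp) auto
  also have "\<dots> = id" using permutes_6_eq_perm6[OF permutes_id] by simp
  finally have ww: "?w \<circ> ?w = id" .
  have "\<forall>i\<in>{1..6}. z (?w i) = - z i"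
    using z(2) unfolding ball_interval_6 perm6_simps type7_def by auto
  then have neg: "z (?w i) = - z i" if "i \<in> {1..6}" for i using that by blast
  show ?thesis by (rule stab_subset_signed[where y = z and w = "?w", OF scale_type7[OF z] tr gens(2) w ww neg])
qed

lemma Aut_acts_as_type7:
  fixes z :: "nat \<Rightarrow> 'a::field_char_0"
  assumes z: "nodal z" "type7 z"
  shows "Aut_acts_as (threefold z) {common_involution, cycle_of_list [2,4], cycle_of_list [1,5] \<circ> cycle_of_list [2,3,4,6]}"
proof -
  note o = outer_cycles(1) outer_cycles(8) outer_cycles(9)
  have st: "perm6 [2,1,3,4,5,6] \<in> stab z" "perm6 [3,4,1,2,6,5] \<in> stab z" "perm6 [3,4,5,2,6,1] \<in> stab z"
    by (rule perm6_stabI[OF outer_cycles(1), where m = "1"] perm6_stabI[OF outer_cycles(8), where m = "- 1"] perm6_stabI[OF outer_cycles(9), where m = "- 1"];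
      use z(2) in \<open>simp add: type7_def\<close>)+
  have "Aut_acts_as (threefold z) (set [common_involution, cycle_of_list [2,4], cycle_of_list [1,5] \<circ> cycle_of_list [2,3,4,6]])"
    by (rule Aut_acts_as_generatorsI[OF z(1), where ps = "[perm6 [2,1,3,4,5,6], perm6 [3,4,1,2,6,5], perm6 [3,4,5,2,6,1]]"])
      (use o st stab_subset_type7[OF z] in \<open>simp_all del: cycle_of_list.simps o_apply\<close>)
  then show ?thesis by (simp only: list.set)
qed

lemma stab_subset_type8:
  fixes z :: "nat \<Rightarrow> 'a::field_char_0"
  assumes z: "nodal z" "type8 z" and M: "perm_submonoid M"
    and gens: "perm6 [2,1,3,4,5,6] \<in> M" "perm6 [4,1,2,5,3,6] \<in> M"
  shows "stab z \<subseteq> M"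
proof -
  interpret perm_submonoid M by (rule M)
  have "perm6 [1,4,2,5,3,6] \<in> M"
    by (rule perm6_mem[of "[4,1,2,5,3,6]" "[2,1,3,4,5,6]"]) (fact gens | fact | simp)+
  have "perm6 [5,4,1,3,2,6] \<in> M"
    by (rule perm6_mem[of "[4,1,2,5,3,6]" "[4,1,2,5,3,6]"]) (fact gens | fact | simp)+
  have "perm6 [3,5,4,2,1,6] \<in> M"
    by (rule perm6_mem[of "[5,4,1,3,2,6]" "[4,1,2,5,3,6]"]) (fact gens | fact | simp)+
  have "perm6 [2,3,5,1,4,6] \<in> M"
    by (rule perm6_mem[of "[3,5,4,2,1,6]" "[4,1,2,5,3,6]"]) (fact gens | fact | simp)+
  have "perm6 [4,2,3,1,5,6] \<in> M"
    by (rule perm6_mem[of "[1,4,2,5,3,6]" "[2,3,5,1,4,6]"]) (fact gens | fact | simp)+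
  have "perm6 [5,1,2,4,3,6] \<in> M"
    by (rule perm6_mem[of "[4,1,2,5,3,6]" "[4,2,3,1,5,6]"]) (fact gens | fact | simp)+
  have "perm6 [1,2,3,5,4,6] \<in> M"
    by (rule perm6_mem[of "[5,1,2,4,3,6]" "[2,3,5,1,4,6]"]) (fact gens | fact | simp)+
  have "perm6 [4,1,2,3,5,6] \<in> M"
    by (rule perm6_mem[of "[4,1,2,5,3,6]" "[1,2,3,5,4,6]"]) (fact gens | fact | simp)+
  have "perm6 [1,2,5,4,3,6] \<in> M"
    by (rule perm6_mem[of "[4,1,2,3,5,6]" "[2,3,5,1,4,6]"]) (fact gens | fact | simp)+
  have "perm6 [4,1,3,5,2,6] \<in> M"
    by (rule perm6_mem[of "[4,1,2,5,3,6]" "[1,2,5,4,3,6]"]) (fact gens | fact | simp)+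
  have "perm6 [1,3,2,4,5,6] \<in> M"
    by (rule perm6_mem[of "[4,1,3,5,2,6]" "[2,3,5,1,4,6]"]) (fact gens | fact | simp)+
  have chain: "successively (\<lambda>i j. swap i j \<in> M) [1,2,3,5,4]"
    using gens \<open>perm6 [1,3,2,4,5,6] \<in> M\<close> \<open>perm6 [1,2,5,4,3,6] \<in> M\<close> \<open>perm6 [1,2,3,5,4,6] \<in> M\<close> by (simp add: swap_mem_iff_perm6 Transposition.transpose_def)
  note swaps = swap_mem_chain[OF chain]
  have tr: "swap i j \<in> M" if "i \<in> {1..6}" "j \<in> {1..6}" "i < j" "z i = z j" for i j
    using z(2) that unfolding interval_6 type8_def by (elim insertE emptyE) (auto intro: swaps)
  show ?thesis
  proof (rule stab_subset_triple[OF z(1) _ _ _ tr])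
    show "z 2 = z 1" "z 3 = z 1" using z(2) by (simp_all add: type8_def)
    show "z i = z 1" if "i < j" "j < k" "i \<in> {1, 2, 3, 4, 5, 6}" "j \<in> {1, 2, 3, 4, 5, 6}"
        "k \<in> {1, 2, 3, 4, 5, 6}" "z j = z i" "z k = z i" for i j k
      using that z(2) unfolding type8_def by (elim insertE emptyE) auto
  qed
qed

lemma Aut_acts_as_type8:
  fixes z :: "nat \<Rightarrow> 'a::field_char_0"
  assumes z: "nodal z" "type8 z"
  shows "Aut_acts_as (threefold z) {common_involution, cycle_of_list [1,2,5,6,4]}"
proof -
  note o = outer_cycles(1) outer_cycles(10)
  have st: "perm6 [2,1,3,4,5,6] \<in> stab z" "perm6 [4,1,2,5,3,6] \<in> stab z"
    by (rule perm6_stabI[OF outer_cycles(1), where m = "1"] perm6_stabI[OF outer_cycles(10), where m = "1"];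
      use z(2) in \<open>simp add: type8_def\<close>)+
  have "Aut_acts_as (threefold z) (set [common_involution, cycle_of_list [1,2,5,6,4]])"
    by (rule Aut_acts_as_generatorsI[OF z(1), where ps = "[perm6 [2,1,3,4,5,6], perm6 [4,1,2,5,3,6]]"])
      (use o st stab_subset_type8[OF z] in \<open>simp_all del: cycle_of_list.simps o_apply\<close>)
  then show ?thesis by (simp only: list.set)
qed

section \<open>Automorphism groups in the eight cases\<close>

text \<open>The image of \<open>h\<close> is a submonoid of the stabiliser. Applying the generation
  lemma to it gives equality, so surjectivity of \<open>h\<close> needs only the generators.\<close>

lemma Aut_isoI:
  fixes z :: "nat \<Rightarrow> 'a::field_char_0" and D :: "('b, 'c) monoid_scheme"
  assumes z: "nodal z"
    and closed: "\<And>x y. x \<in> carrier D \<Longrightarrow> y \<in> carrier D \<Longrightarrow> x \<otimes>\<^bsub>D\<^esub> y \<in> carrier D"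
    and mult: "\<And>x y. x \<in> carrier D \<Longrightarrow> y \<in> carrier D \<Longrightarrow> h (x \<otimes>\<^bsub>D\<^esub> y) = h x \<circ> h y"
    and one: "e \<in> carrier D" "h e = id"
    and inj: "inj_on h (carrier D)"
    and stab: "\<And>x. x \<in> carrier D \<Longrightarrow> h x \<in> stab z"
    and gen: "perm_submonoid (h ` carrier D) \<Longrightarrow> stab z \<subseteq> h ` carrier D"
  shows "Aut (threefold z) \<cong> D"
proof -
  have "perm_submonoid (h ` carrier D)"
  proof
    show "id \<in> h ` carrier D" using one by (metis image_eqI)
    fix p q assume "p \<in> h ` carrier D" "q \<in> h ` carrier D"
    then obtain x y where "x \<in> carrier D" "y \<in> carrier D" "p = h x" "q = h y" by blast
    then show "p \<circ> q \<in> h ` carrier D" using mult closed by (metis image_eqI)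
  qed
  then have "h ` carrier D = stab z" using gen stab by blast
  then have "bij_betw h (carrier D) (stab z)" using inj by (simp add: bij_betw_def)
  from perm_group_isoI[OF this closed mult] have "perm_group (stab z) \<cong> D" by blast
  then show ?thesis using Aut_iso_stab[OF z] iso_trans by blast
qed

lemma id_mem_stab: "id \<in> stab y"
  unfolding stab_def by (simp add: permutes_id exI[of _ 1])

lemma funpow_mem_stab: "p \<in> stab y \<Longrightarrow> p ^^ n \<in> stab y"
  by (induction n) (simp_all add: id_mem_stab stab_comp)

lemma perm6_id: "perm6 [1,2,3,4,5,6] = id"
  using permutes_6_eq_perm6[OF permutes_id] by simp

lemma carrier_mod_2: "carrier (integer_mod_group 2) = {0, 1}"
  by (auto simp: carrier_integer_mod_group)

lemma stab_type1:
  fixes z :: "nat \<Rightarrow> 'a::field_char_0"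
  assumes "type1 z"
  shows "perm6 [2,1,3,4,5,6] \<in> stab z"
  by (rule perm6_stabI[OF outer_cycles(1), where m = 1]) (use assms in \<open>simp_all add: type1_def\<close>)

lemma Aut_type1:
  fixes z :: "nat \<Rightarrow> 'a::field_char_0"
  assumes z: "nodal z" "type1 z"
  shows "Aut (threefold z) \<cong> integer_mod_group 2"
proof (rule Aut_isoI[OF z(1), where h = "\<lambda>s. if s = 0 then id else perm6 [2,1,3,4,5,6]" and e = 0])
  let ?t = "perm6 [2,1,3,4,5,6]"
  let ?h = "\<lambda>s::int. if s = 0 then id else ?t"
  have tt: "?t \<circ> ?t = id" using perm6_id by (subst perm6_comp) auto
  have "?t 1 \<noteq> id (1::nat)" by (simp add: perm6_def)
  then have ne: "?t \<noteq> id" by metis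
  show "?h (x \<otimes>\<^bsub>integer_mod_group 2\<^esub> y) = ?h x \<circ> ?h y"
    if "x \<in> carrier (integer_mod_group 2)" "y \<in> carrier (integer_mod_group 2)" for x y
    using that tt unfolding carrier_mod_2 by auto
  show "inj_on ?h (carrier (integer_mod_group 2))"
    using ne unfolding carrier_mod_2 by (auto simp: inj_on_def)
  show "?h x \<in> stab z" for x
    using id_mem_stab stab_type1[OF z(2)] by (simp only: split: if_split) blast
  assume M: "perm_submonoid (?h ` carrier (integer_mod_group 2))"
  show "stab z \<subseteq> ?h ` carrier (integer_mod_group 2)"
    by (rule stab_subset_type1[OF z M]) (simp add: carrier_mod_2)
qed (auto simp: carrier_mod_2)

lemma Aut_type5:
  fixes z :: "nat \<Rightarrow> 'a::field_char_0"
  assumes z: "nodal z" "type5 z"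
  shows "Aut (threefold z) \<cong> integer_mod_group 2 \<times>\<times> integer_mod_group 2"
proof -
  define t u where tu_def: "t = perm6 [2,1,3,4,5,6]" "u = perm6 [1,2,3,5,4,6]"
  let ?D = "integer_mod_group 2 \<times>\<times> integer_mod_group 2"
  define h where "h = (\<lambda>(r::int, s::int). (if r = 0 then id else t) \<circ> (if s = 0 then id else u))"
  have car: "carrier ?D = {(0, 0), (0, 1), (1, 0), (1, 1)}" by (auto simp: carrier_mod_2)
  have tt: "t \<circ> t = id" "u \<circ> u = id" unfolding tu_def using perm6_id by (subst perm6_comp; auto)+
  have tu: "u \<circ> t = t \<circ> u" unfolding tu_def by (subst (1 2) perm6_comp) auto
  have tu': "u \<circ> (t \<circ> p) = t \<circ> (u \<circ> p)" "t \<circ> (t \<circ> p) = p" "u \<circ> (u \<circ> p) = p" for p :: "nat \<Rightarrow> nat"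
    unfolding comp_assoc[symmetric] tt tu id_comp by (rule refl)+
  have e: "h (0, 0) = id" by (simp add: h_def)
  show ?thesis
  proof (rule Aut_isoI[OF z(1), where h = h and e = "(0, 0)", OF _ _ _ e])
    show "x \<otimes>\<^bsub>?D\<^esub> y \<in> carrier ?D" "h (x \<otimes>\<^bsub>?D\<^esub> y) = h x \<circ> h y"
      if "x \<in> carrier ?D" "y \<in> carrier ?D" for x y
      using that unfolding car by (auto simp: h_def tt tu tu' comp_assoc)
    \<comment> \<open>The images of 1 and 4 already separate the four elements.\<close>
    have "distinct (map ((\<lambda>p. (p 1, p 4)) \<circ> h) [(0, 0), (0, 1), (1, 0), (1, 1)])"
      by (simp add: h_def tu_def perm6_def)
    then have "inj_on h (set [(0, 0), (0, 1), (1, 0), (1, 1)])"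
      unfolding distinct_map by (blast intro: inj_on_imageI2)
    then show "inj_on h (carrier ?D)" unfolding car by simp
    have "t \<in> stab z"
      unfolding tu_def by (rule perm6_stabI[OF outer_cycles(1), where m = 1]) (use z(2) in \<open>simp_all add: type5_def\<close>)
    moreover have "u \<in> stab z"
      unfolding tu_def by (rule perm6_stabI[OF outer_cycles(6), where m = 1]) (use z(2) in \<open>simp_all add: type5_def\<close>)
    ultimately show "h x \<in> stab z" for x
      unfolding h_def split_beta by (intro stab_comp) (simp_all only: id_mem_stab split: if_split, simp_all)
    assume M: "perm_submonoid (h ` carrier ?D)"
    have "h (0, 1) = u" "h (1, 0) = t" by (simp_all add: h_def)
    moreover have "(0, 1) \<in> carrier ?D" "(1, 0) \<in> carrier ?D" unfolding car by simp_all
    ultimately have "u \<in> h ` carrier ?D" "t \<in> h ` carrier ?D" by (metis image_eqI)+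
    then show "stab z \<subseteq> h ` carrier ?D" by (rule stab_subset_type5[OF z M, folded tu_def])
  qed (simp add: car)
qed

section \<open>Dihedral groups\<close>

lemma funpow_eq_of_mod_eq:
  fixes \<rho> :: "'a \<Rightarrow> 'a"
  assumes n: "\<rho> ^^ n = id" and ab: "a mod int n = b mod int n" "0 \<le> a" "0 \<le> b"
  shows "\<rho> ^^ nat a = \<rho> ^^ nat b"
proof -
  have red: "\<rho> ^^ m = \<rho> ^^ (m mod n)" for m
  proof -
    have "\<rho> ^^ m = \<rho> ^^ (n * (m div n) + m mod n)" by simp
    also have "\<dots> = (\<rho> ^^ n) ^^ (m div n) \<circ> \<rho> ^^ (m mod n)" by (simp only: funpow_add funpow_mult mult.commute)
    finally show ?thesis using n by simp
  qed
  have "nat a mod n = nat b mod n" using ab by (metis nat_int nat_mod_distrib of_nat_0_le_iff)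
  then show ?thesis using red[of "nat a"] red[of "nat b"] by simp
qed

text \<open>Iterates have natural exponents, so \<open>n - 1\<close> plays the role of -1 in the
  relation between \<open>\<tau>\<close> and \<open>\<rho>\<close>.\<close>

lemma dihedral_hom:
  fixes \<rho> \<tau> :: "nat \<Rightarrow> nat"
  assumes n: "n > 0" "\<rho> ^^ n = id" and \<tau>: "\<tau> \<circ> \<tau> = id" "\<tau> \<circ> \<rho> = \<rho> ^^ (n - 1) \<circ> \<tau>"
  defines "h \<equiv> \<lambda>(r::int, s::int). \<rho> ^^ nat r \<circ> \<tau> ^^ nat s"
  assumes x: "x \<in> carrier (dihedral_group n)" and y: "y \<in> carrier (dihedral_group n)"
  shows "x \<otimes>\<^bsub>dihedral_group n\<^esub> y \<in> carrier (dihedral_group n)"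
    and "h (x \<otimes>\<^bsub>dihedral_group n\<^esub> y) = h x \<circ> h y"
proof -
  let ?n = "int n"
  obtain r s where xs: "x = (r, s)" by force
  obtain r' s' where ys: "y = (r', s')" by force
  have car: "carrier (dihedral_group n) = {0..<?n} \<times> {0, 1}"
    using n(1) by (auto simp: dihedral_group_def semidirect_product_def carrier_integer_mod_group)
  have rs: "0 \<le> r" "r < ?n" "s \<in> {0, 1}" "0 \<le> r'" "r' < ?n" "s' \<in> {0, 1}"
    using x y unfolding car xs ys by auto
  have r'car: "r' \<in> carrier (integer_mod_group n)" using rs n(1) by (simp add: carrier_integer_mod_group)
  have xy: "x \<otimes>\<^bsub>dihedral_group n\<^esub> y = ((r + (if s = 0 then r' else (- r') mod ?n)) mod ?n, (s + s') mod 2)"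
    unfolding xs ys using r'car by (simp add: dihedral_group_def semidirect_product_def)
  show "x \<otimes>\<^bsub>dihedral_group n\<^esub> y \<in> carrier (dihedral_group n)"
    unfolding xy car using n(1) rs by auto
  have conj: "\<tau> \<circ> \<rho> ^^ k = \<rho> ^^ ((n - 1) * k) \<circ> \<tau>" for k
  proof (induction k)
    case (Suc k)
    have "\<tau> \<circ> \<rho> ^^ Suc k = (\<tau> \<circ> \<rho>) \<circ> \<rho> ^^ k" by (simp add: comp_assoc)
    also have "\<dots> = \<rho> ^^ (n - 1) \<circ> (\<tau> \<circ> \<rho> ^^ k)" unfolding \<tau>(2) by (simp add: comp_assoc)
    also have "\<dots> = \<rho> ^^ (n - 1) \<circ> \<rho> ^^ ((n - 1) * k) \<circ> \<tau>" unfolding Suc by (simp add: comp_assoc)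
    also have "\<dots> = \<rho> ^^ ((n - 1) * Suc k) \<circ> \<tau>" by (simp add: funpow_add)
    finally show ?case .
  qed simp
  have \<tau>2: "\<tau> ^^ 2 = id" using \<tau>(1) by (simp add: numeral_2_eq_2)
  have ss: "\<tau> ^^ nat ((s + s') mod 2) = \<tau> ^^ nat s \<circ> \<tau> ^^ nat s'"
    using rs(3,6) \<tau>(1) by auto
  show "h (x \<otimes>\<^bsub>dihedral_group n\<^esub> y) = h x \<circ> h y"
  proof (cases "s = 0")
    case True
    have "\<rho> ^^ nat ((r + r') mod ?n) = \<rho> ^^ nat (r + r')"
      by (rule funpow_eq_of_mod_eq[OF n(2)]) (use rs n(1) in auto)
    also have "\<dots> = \<rho> ^^ nat r \<circ> \<rho> ^^ nat r'" using rs by (simp add: nat_add_distrib funpow_add)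
    finally show ?thesis unfolding xy using True ss by (simp add: h_def xs ys comp_assoc)
  next
    case False
    then have s: "s = 1" using rs by auto
    \<comment> \<open>The model subtracts \<open>r'\<close> modulo \<open>n\<close>, while moving
      \<open>\<tau>\<close> past the power of \<open>\<rho>\<close> adds
      \<open>(n - 1) * r'\<close>. The exponents differ by a multiple of \<open>n\<close>.\<close>
    have "\<rho> ^^ nat ((r + (- r') mod ?n) mod ?n) = \<rho> ^^ nat (r + (?n - 1) * r')"
    proof (rule funpow_eq_of_mod_eq[OF n(2)])
      have "(r + (?n - 1) * r') = (r + - r') + ?n * r'" by (simp add: algebra_simps)
      then show "(r + (- r') mod ?n) mod ?n mod ?n = (r + (?n - 1) * r') mod ?n"
        by (simp only: mod_mod_trivial mod_add_right_eq mod_mult_self2)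
    qed (use rs n(1) in auto)
    also have "\<dots> = \<rho> ^^ (nat r + (n - 1) * nat r')"
      using rs n(1) by (simp add: nat_add_distrib nat_mult_distrib nat_diff_distrib)
    also have "\<dots> = \<rho> ^^ nat r \<circ> \<rho> ^^ ((n - 1) * nat r')" by (rule funpow_add)
    finally have 1: "\<rho> ^^ nat ((r + (- r') mod ?n) mod ?n) = \<rho> ^^ nat r \<circ> \<rho> ^^ ((n - 1) * nat r')" .
    have "h (x \<otimes>\<^bsub>dihedral_group n\<^esub> y) = \<rho> ^^ nat r \<circ> (\<rho> ^^ ((n - 1) * nat r') \<circ> \<tau>) \<circ> \<tau> ^^ nat s'"
      unfolding xy h_def prod.case ss using s 1 by (simp add: comp_assoc)
    also have "\<dots> = h x \<circ> h y"
      unfolding conj[symmetric] h_def xs ys prod.case using s by (simp add: comp_assoc)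
    finally show ?thesis .
  qed
qed

lemma Aut_dihedral:
  fixes z :: "nat \<Rightarrow> 'a::field_char_0"
  assumes z: "nodal z" and n: "n > 1" "\<rho> ^^ n = id" and \<tau>: "\<tau> \<circ> \<tau> = id" "\<tau> \<circ> \<rho> = \<rho> ^^ (n - 1) \<circ> \<tau>"
    and st: "\<rho> \<in> stab z" "\<tau> \<in> stab z"
    and gen: "\<And>M. perm_submonoid M \<Longrightarrow> \<rho> \<in> M \<Longrightarrow> \<tau> \<in> M \<Longrightarrow> stab z \<subseteq> M"
    and inj: "inj_on (\<lambda>(r::int, s::int). \<rho> ^^ nat r \<circ> \<tau> ^^ nat s) ({0..<int n} \<times> {0, 1})"
  shows "Aut (threefold z) \<cong> dihedral_group n"
proof -
  define h where "h = (\<lambda>(r::int, s::int). \<rho> ^^ nat r \<circ> \<tau> ^^ nat s)"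
  have car: "carrier (dihedral_group n) = {0..<int n} \<times> {0, 1}"
    using n(1) by (auto simp: dihedral_group_def semidirect_product_def carrier_integer_mod_group)
  note hom = dihedral_hom[OF _ n(2) \<tau>, folded h_def]
  have e: "h (0, 0) = id" by (simp add: h_def)
  show ?thesis
  proof (rule Aut_isoI[OF z, where h = h and e = "(0, 0)", OF hom(1) hom(2) _ e])
    show "inj_on h (carrier (dihedral_group n))" using inj unfolding car h_def .
    show "h x \<in> stab z" for x
      unfolding h_def split_beta by (intro stab_comp funpow_mem_stab st)
    assume "perm_submonoid (h ` carrier (dihedral_group n))"
    moreover have "\<rho> = h (1, 0)" "\<tau> = h (0, 1)" by (simp_all add: h_def)
    moreover have "(1, 0) \<in> carrier (dihedral_group n)" "(0, 1) \<in> carrier (dihedral_group n)"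
      using n(1) by (simp_all add: car)
    ultimately show "stab z \<subseteq> h ` carrier (dihedral_group n)" using gen by blast
  qed (use n(1) in \<open>simp_all add: car\<close>)
qed

lemma Aut_type4:
  fixes z :: "nat \<Rightarrow> 'a::field_char_0"
  assumes z: "nodal z" "type4 z"
  shows "Aut (threefold z) \<cong> dihedral_group 4"
proof (rule Aut_dihedral[OF z(1)])
  let ?\<tau> = "perm6 [3,6,1,5,4,2]" and ?\<rho> = "perm6 [3,6,2,5,4,1]"
  show "?\<rho> ^^ 4 = id" by (simp add: eval_nat_numeral perm6_comp flip: perm6_id)
  show "?\<tau> \<circ> ?\<tau> = id" by (simp add: perm6_comp flip: perm6_id)
  show "?\<tau> \<circ> ?\<rho> = ?\<rho> ^^ (4 - 1) \<circ> ?\<tau>" by (simp add: eval_nat_numeral perm6_comp)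
  show "?\<tau> \<in> stab z"
    by (rule perm6_stabI[OF outer_cycles(4), where m = "- 1"]) (use z(2) in \<open>simp_all add: type4_def\<close>)
  show "?\<rho> \<in> stab z"
    by (rule perm6_stabI[OF outer_cycles(5), where m = "- 1"]) (use z(2) in \<open>simp_all add: type4_def\<close>)
  show "stab z \<subseteq> M" if "perm_submonoid M" "?\<rho> \<in> M" "?\<tau> \<in> M" for M
    using stab_subset_type4[OF z] that by blast
  have "{0..<int 4} = {0, 1, 2, 3}" by auto
  then have set: "{0..<int 4} \<times> {0, 1} = set [(0, 0), (0, 1), (1, 0), (1, 1), (2, 0), (2, 1), (3, 0), (3, 1)]" by simp
  let ?h = "\<lambda>(r::int, s::int). ?\<rho> ^^ nat r \<circ> ?\<tau> ^^ nat s"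
  have "distinct (map ((\<lambda>p. (p 1, p 3)) \<circ> ?h) [(0, 0), (0, 1), (1, 0), (1, 1), (2, 0), (2, 1), (3, 0), (3, 1)])"
    by (simp add: eval_nat_numeral perm6_def)
  then show "inj_on ?h ({0..<int 4} \<times> {0, 1})"
    unfolding set distinct_map by (blast intro: inj_on_imageI2)
qed simp

lemma Aut_type6:
  fixes z :: "nat \<Rightarrow> 'a::field_char_0"
  assumes z: "nodal z" "type6 z"
  shows "Aut (threefold z) \<cong> dihedral_group 6"
proof (rule Aut_dihedral[OF z(1)])
  let ?\<tau> = "perm6 [2,1,3,4,5,6]" and ?\<rho> = "perm6 [3,1,2,5,4,6]"
  show "?\<rho> ^^ 6 = id" by (simp add: eval_nat_numeral perm6_comp flip: perm6_id)
  show "?\<tau> \<circ> ?\<tau> = id" by (simp add: perm6_comp flip: perm6_id)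
  show "?\<tau> \<circ> ?\<rho> = ?\<rho> ^^ (6 - 1) \<circ> ?\<tau>" by (simp add: eval_nat_numeral perm6_comp)
  show "?\<tau> \<in> stab z"
    by (rule perm6_stabI[OF outer_cycles(1), where m = 1]) (use z(2) in \<open>simp_all add: type6_def\<close>)
  show "?\<rho> \<in> stab z"
    by (rule perm6_stabI[OF outer_cycles(7), where m = 1]) (use z(2) in \<open>simp_all add: type6_def\<close>)
  show "stab z \<subseteq> M" if "perm_submonoid M" "?\<rho> \<in> M" "?\<tau> \<in> M" for M
    using stab_subset_type6[OF z] that by blast
  have "{0..<int 6} = {0, 1, 2, 3, 4, 5}" by auto
  then have set: "{0..<int 6} \<times> {0, 1} = set [(0, 0), (0, 1), (1, 0), (1, 1), (2, 0), (2, 1), (3, 0), (3, 1), (4, 0), (4, 1), (5, 0), (5, 1)]" by simp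
  let ?h = "\<lambda>(r::int, s::int). ?\<rho> ^^ nat r \<circ> ?\<tau> ^^ nat s"
  have "distinct (map ((\<lambda>p. (p 1, p 2, p 4)) \<circ> ?h) [(0, 0), (0, 1), (1, 0), (1, 1), (2, 0), (2, 1), (3, 0), (3, 1), (4, 0), (4, 1), (5, 0), (5, 1)])"
    by (simp add: eval_nat_numeral perm6_def)
  then show "inj_on ?h ({0..<int 6} \<times> {0, 1})"
    unfolding set distinct_map by (blast intro: inj_on_imageI2)
qed simp

section \<open>Symmetric groups of level sets\<close>

lemma perm6_mem_permutes:
  assumes "{a, b, c, d, e, f} = {1, 2, 3, 4, 5, 6}"
    and "1 \<in> T \<or> a = 1" "2 \<in> T \<or> b = 2" "3 \<in> T \<or> c = 3" "4 \<in> T \<or> d = 4" "5 \<in> T \<or> e = 5" "6 \<in> T \<or> f = 6"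
  shows "perm6 [a, b, c, d, e, f] \<in> {p. p permutes T}"
proof -
  have "perm6 [a, b, c, d, e, f] permutes {1..6}"
    using assms(1) by (intro perm6_permutes) (simp_all only: list.set interval_6, simp)
  moreover have "\<forall>i\<in>{1..6}. i \<in> T \<or> perm6 [a, b, c, d, e, f] i = i"
    unfolding ball_interval_6 perm6_simps using assms(2-7) by blast
  ultimately have "perm6 [a, b, c, d, e, f] permutes T" using permutes_superset by blast
  then show ?thesis by simp
qed

lemma perm_submonoid_permutes: "perm_submonoid {p. p permutes T}"
  by unfold_locales (auto simp: permutes_id permutes_compose)

lemma permutes_level_mem_stab:
  assumes p: "p permutes T" and T: "T \<subseteq> {1..6}" "\<And>i. i \<in> T \<Longrightarrow> z i = t"
  shows "p \<in> stab z"
proof -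
  have "z (p i) = 1 * z i" for i
  proof (cases "i \<in> T")
    case True
    then have "p i \<in> T" by (simp only: permutes_in_image[OF p])
    then show ?thesis using T(2) True by simp
  next
    case False
    then show ?thesis using permutes_not_in[OF p] by simp
  qed
  then show ?thesis using permutes_subset[OF p T(1)] unfolding stab_def by blast
qed

lemma permutes_conj_involution:
  assumes p: "p permutes S" and q: "\<And>i. q (q i) = i"
  shows "q \<circ> p \<circ> q permutes q ` S"
proof (rule bij_imp_permutes)
  have "inj q" using q by (metis injI)
  then have "inj (q \<circ> p \<circ> q)" using permutes_inj[OF p] by (simp add: inj_compose)
  have "q ` q ` S = S" by (simp add: image_image q)
  then have "(q \<circ> p \<circ> q) ` q ` S = q ` S"
    using permutes_image[OF p] by (simp only: image_comp[symmetric])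
  moreover note \<open>inj (q \<circ> p \<circ> q)\<close>
  ultimately show "bij_betw (q \<circ> p \<circ> q) (q ` S) (q ` S)"
    by (simp add: bij_betw_def inj_on_subset[OF _ subset_UNIV])
  show "(q \<circ> p \<circ> q) i = i" if "i \<notin> q ` S" for i
  proof -
    have "q i \<notin> S" using that q by (metis imageI)
    then show ?thesis using permutes_not_in[OF p] q by simp
  qed
qed

text \<open>\<open>sym_group n\<close> acts on an initial segment, but the level set
  \<open>T\<close> need not be one. Conjugation by the involution \<open>q\<close> moves one to the
  other.\<close>

lemma Aut_sym_group:
  fixes z :: "nat \<Rightarrow> 'a::field_char_0"
  assumes z: "nodal z" and q: "q permutes {1..6}" "q ` {1..n} = T" "q \<circ> q = id" "n \<le> 6"
    and level: "\<And>i. i \<in> T \<Longrightarrow> z i = t" and gen: "stab z \<subseteq> {p. p permutes T}"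
  shows "Aut (threefold z) \<cong> sym_group n"
proof -
  have qq: "q (q i) = i" for i using q(3) by (metis comp_apply id_apply)
  have T6: "T \<subseteq> {1..6}" using q(2,4) permutes_image[OF q(1)] by auto
  note conj = permutes_conj_involution[where q = q, OF _ qq]
  let ?h = "\<lambda>p. q \<circ> p \<circ> q"
  have eq: "stab z = {p. p permutes T}" using gen permutes_level_mem_stab[of _ T z t, OF _ T6 level] by blast
  have "perm_group {p. p permutes T} \<cong> sym_group n"
  proof (rule perm_group_isoI[where h = ?h])
    show "bij_betw ?h (carrier (sym_group n)) {p. p permutes T}"
    proof (rule bij_betw_byWitness[where f' = ?h])
      show "?h ` carrier (sym_group n) \<subseteq> {p. p permutes T}"
        using conj[of _ "{1..n}"] unfolding q(2) sym_group_def by auto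
      have "q ` T = {1..n}" unfolding q(2)[symmetric] by (simp add: image_image qq)
      then show "?h ` {p. p permutes T} \<subseteq> carrier (sym_group n)"
        using conj[of _ T] unfolding sym_group_def by auto
    qed (auto simp: fun_eq_iff qq)
  qed (auto simp: sym_group_def permutes_compose fun_eq_iff qq)
  then show ?thesis using iso_trans[OF Aut_iso_stab[OF z]] unfolding eq by blast
qed

lemma Aut_type2:
  fixes z :: "nat \<Rightarrow> 'a::field_char_0"
  assumes z: "nodal z" "type2 z"
  shows "Aut (threefold z) \<cong> sym_group 3"
proof (rule Aut_sym_group[OF z(1) permutes_id])
  show "z i = z 1" if "i \<in> {1, 2, 3}" for i using z(2) that by (auto simp: type2_def)
  show "stab z \<subseteq> {p. p permutes {1, 2, 3}}"
    by (rule stab_subset_type2[OF z perm_submonoid_permutes]; rule perm6_mem_permutes) auto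
qed auto

lemma Aut_type8:
  fixes z :: "nat \<Rightarrow> 'a::field_char_0"
  assumes z: "nodal z" "type8 z"
  shows "Aut (threefold z) \<cong> sym_group 5"
proof (rule Aut_sym_group[OF z(1) permutes_id])
  show "z i = z 1" if "i \<in> {1, 2, 3, 4, 5}" for i using z(2) that by (auto simp: type8_def)
  show "stab z \<subseteq> {p. p permutes {1, 2, 3, 4, 5}}"
    by (rule stab_subset_type8[OF z perm_submonoid_permutes]; rule perm6_mem_permutes) auto
qed (auto simp: interval_5)

lemma Aut_type3:
  fixes z :: "nat \<Rightarrow> 'a::field_char_0"
  assumes z: "nodal z" "type3 z"
  shows "Aut (threefold z) \<cong> sym_group 4"
proof (rule Aut_sym_group[OF z(1), where q = "swap 4 6" and T = "{1, 2, 3, 6}"])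
  show "swap 4 6 permutes {1..6::nat}" by (rule permutes_swap_id) auto
  have "{1..4::nat} = {1, 2, 3, 4}" by auto
  then show "swap 4 6 ` {1..4} = {1, 2, 3, 6::nat}"
    by (auto simp: Transposition.transpose_def)
  show "z i = z 1" if "i \<in> {1, 2, 3, 6}" for i using z(2) that by (auto simp: type3_def)
  show "stab z \<subseteq> {p. p permutes {1, 2, 3, 6}}"
    by (rule stab_subset_type3[OF z perm_submonoid_permutes]; rule perm6_mem_permutes) auto
qed auto

section \<open>The group exchanging two levels of size three\<close>

lemma permutes_disjoint_commute:
  assumes "p permutes S" "q permutes T" "S \<inter> T = {}"
  shows "p \<circ> q = q \<circ> p"
proof
  fix i
  consider "i \<in> S" | "i \<in> T" | "i \<notin> S" "i \<notin> T" by blast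
  then show "(p \<circ> q) i = (q \<circ> p) i"
  proof cases
    case 1
    then have "p i \<in> S" by (simp only: permutes_in_image[OF assms(1)])
    then have "i \<notin> T" "p i \<notin> T" using 1 assms(3) by blast+
    then show ?thesis using permutes_not_in[OF assms(2)] by simp
  next
    case 2
    then have "q i \<in> T" by (simp only: permutes_in_image[OF assms(2)])
    then have "i \<notin> S" "q i \<notin> S" using 2 assms(3) by blast+
    then show ?thesis using permutes_not_in[OF assms(1)] by simp
  next
    case 3
    then show ?thesis using permutes_not_in[OF assms(1)] permutes_not_in[OF assms(2)] by simp
  qed
qed

text \<open>\<open>A\<close> moves permutations of 1, 2, 3 to the level 1, 2, 5 by means of
  \<open>q\<close>. \<open>B\<close> is \<open>A\<close> conjugated by \<open>w\<close>, which
  exchanges the levels, so that conjugation by \<open>w\<close> swaps the factors as the semidirect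
  product requires.\<close>

lemma Aut_type7:
  fixes z :: "nat \<Rightarrow> 'a::field_char_0"
  assumes z: "nodal z" "type7 z"
  shows "Aut (threefold z) \<cong> sym3_squared_C2"
proof -
  define w where "w = perm6 [3,4,1,2,6,5]"
  define q where "q = perm6 [1,2,5,4,3,6]"
  have ww: "w (w i) = i" for i :: nat
  proof -
    have "w \<circ> w = perm6 [1,2,3,4,5,6]" unfolding w_def by (subst perm6_comp) auto
    then show ?thesis unfolding perm6_id by (metis comp_apply id_apply)
  qed
  have qq: "q (q i) = i" for i :: nat
  proof -
    have "q \<circ> q = perm6 [1,2,3,4,5,6]" unfolding q_def by (subst perm6_comp) auto
    then show ?thesis unfolding perm6_id by (metis comp_apply id_apply)
  qed
  define A where "A p = q \<circ> p \<circ> q" for p :: "nat \<Rightarrow> nat"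
  define B where "B p = w \<circ> A p \<circ> w" for p
  define h where "h = (\<lambda>((a, b), s::int). A a \<circ> B b \<circ> (if s = 0 then id else w))"
  let ?P = "{p. p permutes {1..3::nat}}"
  have i3: "{1..3::nat} = {1, 2, 3}" by auto
  have car: "carrier sym3_squared_C2 = (?P \<times> ?P) \<times> {0, 1}"
    by (simp add: sym3_squared_C2_def semidirect_product_def sym_group_def carrier_mod_2)
  have mult: "((a, b), s) \<otimes>\<^bsub>sym3_squared_C2\<^esub> ((a', b'), s') =
      ((if s = 0 then (a \<circ> a', b \<circ> b') else (a \<circ> b', b \<circ> a')), (s + s') mod 2)" for a b s a' b' s'
    by (simp add: sym3_squared_C2_def semidirect_product_def sym_group_def DirProd_def)
  have Aperm: "A p permutes {1, 2, 5}" if "p \<in> ?P" for p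
  proof -
    have "q ` {1..3} = {1, 2, 5}" unfolding i3 q_def by (auto simp: perm6_def)
    then show ?thesis using permutes_conj_involution[of p "{1..3}" q] qq that by (simp add: A_def)
  qed
  have Bperm: "B p permutes {3, 4, 6}" if "p \<in> ?P" for p
  proof -
    have "w ` {1, 2, 5} = {3, 4, 6}" unfolding w_def by (auto simp: perm6_def)
    then show ?thesis using permutes_conj_involution[OF Aperm[OF that], of w] ww by (simp add: B_def)
  qed
  have Acomp: "A (p \<circ> r) = A p \<circ> A r" for p r by (simp add: A_def fun_eq_iff qq)
  have Bcomp: "B (p \<circ> r) = B p \<circ> B r" for p r by (simp add: B_def Acomp fun_eq_iff ww)
  have wA: "w \<circ> A p = B p \<circ> w" and wB: "w \<circ> B p = A p \<circ> w" for p
    by (simp_all add: B_def fun_eq_iff ww)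
  have AB: "A a \<circ> B b = B b \<circ> A a" if "a \<in> ?P" "b \<in> ?P" for a b
    by (rule permutes_disjoint_commute[OF Aperm[OF that(1)] Bperm[OF that(2)]]) auto
  have Aid: "A id = id" and Bid: "B id = id" by (simp_all add: A_def B_def fun_eq_iff qq ww)
  have e: "h ((id, id), 0) = id" by (simp add: h_def Aid Bid)
  have level: "z i = - 1" if "i \<in> {1, 2, 5}" for i using z(2) that by (auto simp: type7_def)
  have level': "z i = 1" if "i \<in> {3, 4, 6}" for i using z(2) that by (auto simp: type7_def)
  have wst: "w \<in> stab z"
    unfolding w_def by (rule perm6_stabI[OF outer_cycles(8), where m = "- 1"])
      (use z(2) in \<open>simp_all add: type7_def\<close>)
  show ?thesis
  proof (rule Aut_isoI[OF z(1), where h = h and e = "((id, id), 0)", OF _ _ _ e])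
    fix x y assume xy: "x \<in> carrier sym3_squared_C2" "y \<in> carrier sym3_squared_C2"
    obtain a b s where x: "x = ((a, b), s)" by (metis surj_pair)
    obtain a' b' s' where y: "y = ((a', b'), s')" by (metis surj_pair)
    have m: "a \<in> ?P" "b \<in> ?P" "a' \<in> ?P" "b' \<in> ?P" "s \<in> {0, 1}" "s' \<in> {0, 1}"
      using xy unfolding x y car by auto
    show "x \<otimes>\<^bsub>sym3_squared_C2\<^esub> y \<in> carrier sym3_squared_C2"
      unfolding x y mult car using m by (auto intro: permutes_compose)
    show "h (x \<otimes>\<^bsub>sym3_squared_C2\<^esub> y) = h x \<circ> h y"
    proof (cases "s = 0")
      case True
      have "A (a \<circ> a') \<circ> B (b \<circ> b') = A a \<circ> (A a' \<circ> B b) \<circ> B b'"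
        by (simp add: Acomp Bcomp comp_assoc)
      also have "\<dots> = A a \<circ> B b \<circ> (A a' \<circ> B b')"
        unfolding AB[OF m(3,2)] by (simp add: comp_assoc)
      finally have 1: "A (a \<circ> a') \<circ> B (b \<circ> b') = A a \<circ> B b \<circ> (A a' \<circ> B b')" .
      have "h (x \<otimes>\<^bsub>sym3_squared_C2\<^esub> y) = (A (a \<circ> a') \<circ> B (b \<circ> b')) \<circ> (if s' = 0 then id else w)"
        unfolding x y mult using True m(6) by (auto simp: h_def)
      also have "\<dots> = h x \<circ> h y" unfolding 1 x y using True by (simp add: h_def comp_assoc)
      finally show ?thesis .
    next
      case False
      then have s: "s = 1" using m(5) by blast
      have wws: "w \<circ> w = id" using ww by (simp add: fun_eq_iff)
      have "A (a \<circ> b') \<circ> B (b \<circ> a') = A a \<circ> (A b' \<circ> B b) \<circ> B a'"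
        by (simp add: Acomp Bcomp comp_assoc)
      also have "\<dots> = A a \<circ> B b \<circ> (A b' \<circ> B a')"
        unfolding AB[OF m(4,2)] by (simp add: comp_assoc)
      also have "A b' \<circ> B a' = B a' \<circ> A b'" by (rule AB[OF m(4,3)])
      finally have 1: "A (a \<circ> b') \<circ> B (b \<circ> a') = A a \<circ> B b \<circ> (B a' \<circ> A b')" .
      have 2: "w \<circ> (A a' \<circ> B b') = B a' \<circ> A b' \<circ> w"
        by (metis comp_assoc wA wB)
      have "h (x \<otimes>\<^bsub>sym3_squared_C2\<^esub> y)
          = (A (a \<circ> b') \<circ> B (b \<circ> a')) \<circ> (w \<circ> (if s' = 0 then id else w))"
        unfolding x y mult using s m(6) wws by (auto simp: h_def)
      also have "\<dots> = A a \<circ> B b \<circ> (B a' \<circ> A b' \<circ> w) \<circ> (if s' = 0 then id else w)"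
        unfolding 1 by (simp add: comp_assoc)
      also have "\<dots> = h x \<circ> h y"
        unfolding 2[symmetric] x y using s by (simp add: h_def comp_assoc)
      finally show ?thesis .
    qed
  next
    show "inj_on h (carrier sym3_squared_C2)"
    proof (rule inj_onI)
      fix x y assume xy: "x \<in> carrier sym3_squared_C2" "y \<in> carrier sym3_squared_C2" and eq: "h x = h y"
      obtain a b s where x: "x = ((a, b), s)" by (metis surj_pair)
      obtain a' b' s' where y: "y = ((a', b'), s')" by (metis surj_pair)
      have m: "a \<in> ?P" "b \<in> ?P" "a' \<in> ?P" "b' \<in> ?P" "s \<in> {0, 1}" "s' \<in> {0, 1}"
        using xy unfolding x y car by auto
      \<comment> \<open>\<open>A\<close> and \<open>B\<close> preserve both levels and
        \<open>w\<close> exchanges them, so the level containing the image of 1 recovers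
        \<open>s\<close>.\<close>
      have side: "h ((a, b), s) 1 \<in> {1, 2, 5} \<longleftrightarrow> s = 0" if "a \<in> ?P" "b \<in> ?P" for a b s
      proof -
        have "w 1 = 3" by (simp add: w_def perm6_def)
        have "B b 1 = 1" using permutes_not_in[OF Bperm[OF that(2)], of 1] by simp
        moreover have "A a 1 \<in> {1, 2, 5}" by (simp only: permutes_in_image[OF Aperm[OF that(1)]]) simp
        moreover have B3: "B b 3 \<in> {3, 4, 6}" by (simp only: permutes_in_image[OF Bperm[OF that(2)]]) simp
        then have "A a (B b 3) = B b 3" by (intro permutes_not_in[OF Aperm[OF that(1)]]) auto
        ultimately show ?thesis using B3 \<open>w 1 = 3\<close> by (cases "s = 0") (auto simp: h_def)
      qed
      have s: "s = s'" using side[OF m(1,2), of s] side[OF m(3,4), of s'] eq m(5,6) unfolding x y by auto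
      have "A a \<circ> B b \<circ> (if s = 0 then id else w) = A a' \<circ> B b' \<circ> (if s = 0 then id else w)"
        using eq unfolding x y s h_def by simp
      then have AB_eq: "A a (B b i) = A a' (B b' i)" for i
        using ww by (cases "s = 0") (simp_all add: fun_eq_iff, metis)
      have Aeq: "A a i = A a' i" for i
      proof (cases "i \<in> {1, 2, 5}")
        case True
        then have "B b i = i" "B b' i = i"
          by (intro permutes_not_in[OF Bperm] m; auto)+
        then show ?thesis using AB_eq[of i] by simp
      next
        case False
        then show ?thesis using permutes_not_in[OF Aperm] m by metis
      qed
      have "B b i = B b' i" for i
        using AB_eq[of i] Aeq permutes_inj[OF Aperm[OF m(1)]] by (metis injD)
      then have "w (A b (w (w i))) = w (A b' (w (w i)))" for i unfolding B_def comp_apply by metis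
      then have Aeq': "A b i = A b' i" for i using ww by metis
      have "a i = a' i" "b i = b' i" for i
        using Aeq[of "q i"] Aeq'[of "q i"] qq unfolding A_def comp_apply by metis+
      then show "x = y" unfolding x y s by auto
    qed
  next
    fix x assume "x \<in> carrier sym3_squared_C2"
    moreover obtain a b s where x: "x = ((a, b), s)" by (metis surj_pair)
    ultimately have m: "a \<in> ?P" "b \<in> ?P" unfolding x car by auto
    have "A a \<in> stab z" by (rule permutes_level_mem_stab[OF Aperm[OF m(1)] _ level]) auto
    moreover have "B b \<in> stab z" by (rule permutes_level_mem_stab[OF Bperm[OF m(2)] _ level']) auto
    ultimately show "h x \<in> stab z" unfolding x h_def prod.case
      using id_mem_stab wst by (intro stab_comp) (auto simp del: id_apply)
  next
    assume M: "perm_submonoid (h ` carrier sym3_squared_C2)"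
    have t: "swap i j \<in> ?P" if "i \<in> {1..3}" "j \<in> {1..3}" for i j
      using permutes_swap_id[OF that] by simp
    have idP: "id \<in> ?P" by (simp add: permutes_id)
    have tr: "swap 1 2 = perm6 [2,1,3,4,5,6]" "swap 1 3 = perm6 [3,2,1,4,5,6]"
      using permutes_6_eq_perm6[OF permutes_swap_id, of 1 2] permutes_6_eq_perm6[OF permutes_swap_id, of 1 3]
      by (auto simp: Transposition.transpose_def)
    show "stab z \<subseteq> h ` carrier sym3_squared_C2"
    proof (rule stab_subset_type7[OF z M])
      have "A (swap 1 2) = perm6 [2,1,3,4,5,6]"
        unfolding A_def q_def tr by (simp add: perm6_comp)
      then have "h ((swap 1 2, id), 0) = perm6 [2,1,3,4,5,6]"
        unfolding h_def prod.case Bid by simp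
      moreover have "((swap 1 2, id), 0) \<in> carrier sym3_squared_C2"
        using t[of 1 2] idP by (simp add: car)
      ultimately show "perm6 [2,1,3,4,5,6] \<in> h ` carrier sym3_squared_C2" by (metis image_eqI)
      have "h ((id, id), 1) = perm6 [3,4,1,2,6,5]" by (simp add: h_def Aid Bid w_def)
      moreover have "((id, id), 1) \<in> carrier sym3_squared_C2" using idP by (simp add: car)
      ultimately show "perm6 [3,4,1,2,6,5] \<in> h ` carrier sym3_squared_C2" by (metis image_eqI)
      have "A (swap 1 3) \<circ> w = perm6 [3,4,5,2,6,1]"
        unfolding A_def q_def tr w_def by (simp add: perm6_comp)
      then have "h ((swap 1 3, id), 1) = perm6 [3,4,5,2,6,1]"
        unfolding h_def prod.case Bid by simp
      moreover have "((swap 1 3, id), 1) \<in> carrier sym3_squared_C2"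
        using t[of 1 3] idP by (simp add: car)
      ultimately show "perm6 [3,4,5,2,6,1] \<in> h ` carrier sym3_squared_C2" by (metis image_eqI)
    qed
  qed (simp add: car permutes_id)
qed

section \<open>Classification\<close>

definition moving :: "(nat \<Rightarrow> 'a::field) \<Rightarrow> bool" where
  "moving y \<longleftrightarrow> (\<forall>i\<in>{1..6}. \<exists>\<sigma>\<in>node_stab y. \<sigma> i \<noteq> i)"

lemma nodal_perm:
  assumes "nodal y" "q permutes {1..6}"
  shows "nodal (y \<circ> q)"
  using outer_surj[OF assms(2)] nodal_comp[OF assms(1)] by blast

lemma outer_injective:
  assumes "outer \<sigma> \<pi>" "outer \<tau> \<pi>"
  shows "\<sigma> = \<tau>"
proof -
  have "outer_aut \<sigma> = outer_aut \<tau>" using outer_aut_eqI assms by metis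
  then show ?thesis
    using bij_betw_imp_inj_on[OF outer_aut_bij] outer_permutes(1)[OF assms(1)] outer_permutes(1)[OF assms(2)]
    by (auto dest: inj_onD)
qed

lemma outer_inv:
  assumes "outer \<sigma> \<pi>"
  shows "outer (inv' \<sigma>) (inv' \<pi>)"
proof -
  note p = outer_permutes[OF assms]
  obtain \<rho> where \<rho>: "outer (inv' \<sigma>) \<rho>" using outer_total[OF permutes_inv[OF p(1)]] by blast
  have "outer id (\<rho> \<circ> \<pi>)" using outer_comp[OF \<rho> assms] permutes_inv_o(2)[OF p(1)] by simp
  then have "\<rho> \<circ> \<pi> = id" using outer_functional outer_id by blast
  then have "\<rho> = inv' \<pi>" using permutes_inv_o(1)[OF p(2)] by (metis comp_assoc comp_id id_comp)
  then show ?thesis using \<rho> by simp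
qed

text \<open>Permuting \<open>y\<close> by \<open>q\<close> conjugates its stabiliser by
  \<open>q\<close>, and on the nodes by the partner \<open>\<tau>\<close> of \<open>q\<close>.
  Conjugation only relabels fixed nodes.\<close>

lemma moving_perm:
  assumes m: "moving y" and q: "q permutes {1..6}"
  shows "moving (y \<circ> q)"
proof -
  obtain \<tau> where \<tau>: "outer \<tau> q" using outer_surj[OF q] by blast
  note tp = outer_permutes(1)[OF \<tau>]
  have qi: "q (inv' q i) = i" for i using permutes_inverses(1)[OF q] .
  show ?thesis
    unfolding moving_def
  proof
    fix i :: nat assume i: "i \<in> {1..6}"
    have "\<tau> i \<in> {1..6}" using i by (simp only: permutes_in_image[OF tp])
    then obtain \<sigma> where \<sigma>: "\<sigma> \<in> node_stab y" "\<sigma> (\<tau> i) \<noteq> \<tau> i" using m unfolding moving_def by blast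
    define \<pi> where "\<pi> = outer_aut \<sigma>"
    have o: "outer \<sigma> \<pi>" and st: "\<pi> \<in> stab y" using \<sigma>(1) outer_outer_aut by (auto simp: node_stab_def \<pi>_def)
    let ?\<sigma> = "inv' \<tau> \<circ> \<sigma> \<circ> \<tau>" and ?\<pi> = "inv' q \<circ> \<pi> \<circ> q"
    have o': "outer ?\<sigma> ?\<pi>" by (intro outer_comp outer_inv \<tau> o)
    obtain c where c: "\<And>i. i \<in> {1..6} \<Longrightarrow> y (\<pi> i) = c * y i" using stabE[OF st] by blast
    have "(y \<circ> q) (?\<pi> k) = c * (y \<circ> q) k" if "k \<in> {1..6}" for k
    proof -
      have "q k \<in> {1..6}" using that by (simp only: permutes_in_image[OF q])
      then show ?thesis using c by (simp add: qi)
    qed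
    then have "?\<pi> \<in> stab (y \<circ> q)" using outer_permutes(2)[OF o'] unfolding stab_def by blast
    then have "?\<sigma> \<in> node_stab (y \<circ> q)"
      using outer_permutes(1)[OF o'] outer_aut_eqI[OF o'] by (simp add: node_stab_def)
    moreover have "?\<sigma> i \<noteq> i"
    proof
      assume "?\<sigma> i = i"
      then have "\<tau> (inv' \<tau> (\<sigma> (\<tau> i))) = \<tau> i" by simp
      then show False using \<sigma>(2) permutes_inverses(1)[OF tp] by simp
    qed
    ultimately show "\<exists>\<sigma>\<in>node_stab (y \<circ> q). \<sigma> i \<noteq> i" by blast
  qed
qed

text \<open>Any partner of \<open>\<pi>\<close> may be exhibited, because \<open>outer\<close> is
  injective.\<close>

lemma not_movingI:
  assumes m: "moving y" and i: "i \<in> {1..6}"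
    and P: "\<And>\<pi>. \<pi> \<in> stab y \<Longrightarrow> \<exists>\<sigma>. outer \<sigma> \<pi> \<and> \<sigma> i = i"
  shows False
proof -
  obtain \<sigma> where \<sigma>: "\<sigma> \<in> node_stab y" "\<sigma> i \<noteq> i" using m i unfolding moving_def by blast
  then have "outer \<sigma> (outer_aut \<sigma>)" "outer_aut \<sigma> \<in> stab y"
    using outer_outer_aut by (auto simp: node_stab_def)
  then show False using P outer_injective \<sigma>(2) by metis
qed

section \<open>Pairwise distinct coordinates\<close>

lemma ex_perm_of_list:
  assumes "distinct xs" "set xs \<subseteq> {1..6::nat}"
  obtains q where "q permutes {1..6}" "\<And>m. m < length xs \<Longrightarrow> q (Suc m) = xs ! m"
proof
  let ?r = "sorted_list_of_set ({1..6} - set xs)"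
  let ?ys = "xs @ ?r"
  have ys: "distinct ?ys" "set ?ys = {1..6}" using assms by auto
  have len: "length ?ys = 6" using distinct_card[OF ys(1)] ys(2) by simp
  show "perm6 ?ys permutes {1..6}" by (rule perm6_permutes[OF len ys(2)])
  fix m assume m: "m < length xs"
  then have "Suc m \<in> {1..6}" using len by auto
  then show "perm6 ?ys (Suc m) = xs ! m" using m by (simp only: perm6_def if_True diff_Suc_1 nth_append)
qed

lemma pow_5_eq_1:
  fixes c :: "'a::field"
  assumes "c ^ 5 = 1" "c ^ k = 1" "0 < k" "k < 5"
  shows "c = 1"
proof -
  have "k \<in> {1, 2, 3, 4}" using assms(3,4) by auto
  then show ?thesis
  proof (elim insertE emptyE)
    assume "k = 2"
    then have "c ^ 5 = c" using assms(2) by (simp add: power_Suc numeral_eq_Suc power2_eq_square)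
    then show ?thesis using assms(1) by simp
  next
    assume "k = 3"
    then have c3: "c ^ 3 = 1" using assms(2) by simp
    have "c ^ 6 = (c ^ 3) ^ 2" "c ^ 6 = c ^ 5 * c" by algebra+
    then show ?thesis using assms(1) c3 by simp
  next
    assume "k = 4"
    then have "c ^ 5 = c" using assms(2) by (simp add: numeral_eq_Suc)
    then show ?thesis using assms(1) by simp
  qed (use assms(2) in simp)
qed

text \<open>The product of the values over \<open>Q\<close> is unchanged by the permutation and
  nonzero.\<close>

lemma scale_prod:
  fixes y :: "nat \<Rightarrow> 'a::field"
  assumes p: "inj_on p Q" "p ` Q \<subseteq> Q" and fin: "finite Q" and c: "\<And>i. i \<in> Q \<Longrightarrow> y (p i) = c * y i"
    and nz: "\<And>i. i \<in> Q \<Longrightarrow> y i \<noteq> 0"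
  shows "c ^ card Q = 1"
proof -
  have "p ` Q = Q" using endo_inj_surj[OF fin p(2,1)] .
  then have "prod y Q = prod (y \<circ> p) Q" using prod.reindex[OF p(1), of y] by simp
  also have "\<dots> = (\<Prod>i\<in>Q. c * y i)" using c by (intro prod.cong) auto
  also have "\<dots> = c ^ card Q * prod y Q" by (simp add: prod.distrib)
  finally show ?thesis using nz fin by simp
qed

text \<open>The scalars are 1 and -1, and distinct values make a permutation unique for its scalar.
  If -1 occurs, the values form three opposite pairs; the permutation exchanging each pair is the
  partner of a transposition of nodes, which fixes the other four.\<close>

lemma not_moving_no_zero:
  fixes y :: "nat \<Rightarrow> 'a::field_char_0"
  assumes y: "nodal y" "moving y" and inj: "inj_on y {1..6}" and nz: "\<And>i. i \<in> {1..6} \<Longrightarrow> y i \<noteq> 0"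
  shows False
proof -
  have sq: "c = 1 \<or> c = -1" if p: "p permutes {1..6}" "\<And>i. i \<in> {1..6} \<Longrightarrow> y (p i) = c * y i" for p c
  proof (rule ccontr)
    assume c: "\<not> ?thesis"
    have pm: "p i \<in> {1..6}" if "i \<in> {1..6}" for i using that by (simp only: permutes_in_image[OF p(1)])
    have "c ^ card {1..6::nat} = 1"
    proof (rule scale_prod[where y = y and p = p])
      show "p ` {1..6} \<subseteq> {1..6}" using pm by blast
      show "inj_on p {1..6}" by (rule permutes_inj_on[OF p(1)])
    qed (use p(2) nz in \<open>blast | simp\<close>)+
    then have c6: "c ^ 6 = 1" by simp
    define w where "w = c ^ 2"
    have w: "w \<noteq> 1" using c by (simp add: w_def power2_eq_1_iff)
    have "(w - 1) * (1 + w + w ^ 2) = 0" using c6 unfolding w_def by algebra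
    then have w3: "1 + w + w ^ 2 = 0" using w by simp
    have "w ^ 2 \<noteq> 1"
    proof
      assume "w ^ 2 = 1"
      then have "w = - 2" using w3 by (simp add: eq_neg_iff_add_eq_0 add_ac)
      with \<open>w ^ 2 = 1\<close> show False by simp
    qed
    have "w ^ 2 \<noteq> w" using w w3 by (auto simp: power2_eq_square)
    \<comment> \<open>\<open>w\<close> is a primitive cube root of unity, and the values at 1,
      \<open>a\<close>, \<open>b\<close> are \<open>y 1\<close> times 1, \<open>w\<close>,
      \<open>w ^ 2\<close>: a triple of sum zero.\<close>
    define a b where "a = p (p 1)" and "b = p (p a)"
    have "(1::nat) \<in> {1..6}" by simp
    note pm1 = pm[OF this] pm[OF pm[OF this]]
    have a6: "a \<in> {1..6}" unfolding a_def by (rule pm1(2))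
    have ya: "y a = w * y 1"
      unfolding a_def w_def using p(2)[OF pm1(1)] p(2)[of 1] by (simp add: power2_eq_square)
    have yb: "y b = w ^ 2 * y 1"
      unfolding b_def using p(2)[OF pm[OF a6]] p(2)[OF a6] ya by (simp add: power2_eq_square w_def)
    have b6: "b \<in> {1..6}" unfolding b_def by (intro pm a6)
    have y1: "y 1 \<noteq> 0" using nz[of 1] by simp
    have "distinct [1, a, b]"
      using ya yb y1 w \<open>w ^ 2 \<noteq> 1\<close> \<open>w ^ 2 \<noteq> w\<close> by (auto simp: power2_eq_square)
    then have "y 1 + y a + y b \<noteq> 0"
      using y(1) a6 b6 by (intro no_zero_tripleD) (auto simp: nodal_def)
    moreover have "y 1 + y a + y b = (1 + w + w ^ 2) * y 1" unfolding ya yb by algebra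
    ultimately show False using w3 by simp
  qed
  have id1: "p = id" if p: "p permutes {1..6}" "\<And>i. i \<in> {1..6} \<Longrightarrow> y (p i) = 1 * y i" for p
  proof (rule permutes_6_eqI[OF p(1) permutes_id])
    fix i :: nat assume i: "i \<in> {1..6}"
    have "p i \<in> {1..6}" using i by (simp only: permutes_in_image[OF p(1)])
    then show "p i = id i" using inj_onD[OF inj _ _ i] p(2)[OF i] by simp
  qed
  show False
  proof (cases "\<exists>p. p permutes {1..6} \<and> (\<forall>i\<in>{1..6}. y (p i) = - y i)")
    case False
    show False
    proof (rule not_movingI[OF y(2), of 1])
      fix \<pi> assume "\<pi> \<in> stab y"
      then obtain c where c: "\<pi> permutes {1..6}" "\<And>i. i \<in> {1..6} \<Longrightarrow> y (\<pi> i) = c * y i"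
        using stabE by blast
      have "c = 1" using sq[OF c] c False by auto
      then have "\<pi> = id" using id1 c by blast
      then show "\<exists>\<sigma>. outer \<sigma> \<pi> \<and> \<sigma> 1 = 1" using outer_id by (intro exI[of _ id]) simp
    qed simp
  next
    case True
    then obtain p where p: "p permutes {1..6}" "\<And>i. i \<in> {1..6} \<Longrightarrow> y (p i) = - y i" by blast
    have pm: "p i \<in> {1..6}" if "i \<in> {1..6}" for i using that by (simp only: permutes_in_image[OF p(1)])
    have pp: "p (p i) = i" if "i \<in> {1..6}" for i
      using inj_onD[OF inj _ pm[OF pm[OF that]] that] p(2)[OF that] p(2)[OF pm[OF that]] by simp
    have ne: "p i \<noteq> i" if "i \<in> {1..6}" for i
    proof
      assume "p i = i"
      then have "y i = - y i" using p(2)[OF that] by simp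
      then show False using nz[OF that] by (simp add: eq_neg_iff_add_eq_0 flip: mult_2)
    qed
    have "card {1, p 1} \<le> 2" by (simp add: card_insert_if)
    then have "\<not> {1..6} \<subseteq> {1, p 1}" using card_mono[of "{1, p 1}" "{1..6}"] by fastforce
    then obtain m where m: "m \<in> {1..6}" "m \<noteq> 1" "m \<noteq> p 1" by blast
    have "card {1, p 1, m, p m} \<le> 4" by (simp add: card_insert_if)
    then have "\<not> {1..6} \<subseteq> {1, p 1, m, p m}" using card_mono[of "{1, p 1, m, p m}" "{1..6}"] by fastforce
    then obtain n where n: "n \<in> {1..6}" "n \<noteq> 1" "n \<noteq> p 1" "n \<noteq> m" "n \<noteq> p m" by blast
    have one: "(1::nat) \<in> {1..6}" by simp
    have pinj: "p i = p j \<longleftrightarrow> i = j" for i j using permutes_inj[OF p(1)] by (simp add: inj_eq)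
    have cross: "p i = j \<longleftrightarrow> i = p j" if "i \<in> {1..6}" "j \<in> {1..6}" for i j
      using pp that by metis
    let ?L = "[1, p 1, m, p m, n, p n]"
    have "distinct ?L"
      using m n ne[OF one] ne[OF m(1)] ne[OF n(1)] pinj cross[OF one m(1)] cross[OF one n(1)]
        cross[OF m(1) n(1)] cross[OF m(1) one] cross[OF n(1) one] cross[OF n(1) m(1)] by auto
    moreover have "set ?L \<subseteq> {1..6}" using one m(1) n(1) pm by simp
    ultimately obtain q where q: "q permutes {1..6}" and qL: "\<And>k. k < length ?L \<Longrightarrow> q (Suc k) = ?L ! k"
      using ex_perm_of_list by blast
    define z where "z = y \<circ> q"
    have zq: "q 1 = 1" "q 2 = p 1" "q 3 = m" "q 4 = p m" "q 5 = n" "q 6 = p n"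
      using qL[of 0] qL[of 1] qL[of 2] qL[of 3] qL[of 4] qL[of 5] by (simp_all add: eval_nat_numeral)
    have neg: "z 2 = - z 1" "z 1 = - z 2" "z 4 = - z 3" "z 3 = - z 4" "z 6 = - z 5" "z 5 = - z 6"
      using p(2)[OF one] p(2)[OF m(1)] p(2)[OF n(1)] unfolding z_def comp_apply zq by simp_all
    have zinj: "inj_on z {1..6}"
      unfolding z_def using permutes_inj_on[OF q] permutes_image[OF q] inj by (simp add: comp_inj_on)
    \<comment> \<open>The word \<open>[1,2,1]\<close> is the node transposition (1,3), which fixes
      node 2.\<close>
    have o: "outer (perm6 [3,2,1,4,5,6]) (perm6 [2,1,4,3,6,5])"
      using outer_word[of "[1,2,1]"] by simp
    show False
    proof (rule not_movingI[OF moving_perm[OF y(2) q, folded z_def], of 2])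
      fix \<pi> assume "\<pi> \<in> stab z"
      then obtain c where c: "\<pi> permutes {1..6}" "\<And>i. i \<in> {1..6} \<Longrightarrow> z (\<pi> i) = c * z i"
        using stabE by blast
      have zperm: "\<pi>' = \<rho>" if "\<pi>' permutes {1..6}" "\<rho> permutes {1..6}" "\<And>i. i \<in> {1..6} \<Longrightarrow> z (\<pi>' i) = z (\<rho> i)" for \<pi>' \<rho>
      proof (rule permutes_6_eqI[OF that(1,2)])
        fix i :: nat assume i: "i \<in> {1..6}"
        have "\<pi>' i \<in> {1..6}" "\<rho> i \<in> {1..6}"
          using i by (simp_all only: permutes_in_image[OF that(1)] permutes_in_image[OF that(2)])
        then show "\<pi>' i = \<rho> i" using inj_onD[OF zinj that(3)[OF i]] by blast
      qed
      have "c = 1 \<or> c = -1"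
      proof (rule sq)
        show "q \<circ> \<pi> \<circ> inv' q permutes {1..6}" by (intro permutes_compose permutes_inv q c)
        fix i :: nat assume "i \<in> {1..6}"
        then have "inv' q i \<in> {1..6}" by (simp only: permutes_in_image[OF permutes_inv[OF q]])
        then show "y ((q \<circ> \<pi> \<circ> inv' q) i) = c * y i"
          using c(2)[of "inv' q i"] permutes_inverses(1)[OF q, of i] by (simp add: z_def)
      qed
      then show "\<exists>\<sigma>. outer \<sigma> \<pi> \<and> \<sigma> 2 = 2"
      proof
        assume "c = 1"
        then have "\<pi> = id" using zperm[OF c(1) permutes_id] c(2) by simp
        then show ?thesis using outer_id by (intro exI[of _ id]) simp
      next
        assume "c = -1"
        have "\<forall>i\<in>{1..6}. z (perm6 [2,1,4,3,6,5] i) = - z i"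
          unfolding ball_interval_6 perm6_simps using neg by simp
        then have "\<pi> = perm6 [2,1,4,3,6,5]"
          using zperm[OF c(1) outer_permutes(2)[OF o]] c(2) \<open>c = -1\<close> by simp
        then show ?thesis using o perm6_simps(2)[of 3 2 1 4 5 6] by (intro exI[of _ "perm6 [3,2,1,4,5,6]"]) simp
      qed
    qed simp
  qed
qed

text \<open>The other five values are nonzero, so scalars are fifth roots of unity. A nontrivial one
  permutes these five values cyclically, and the whole stabiliser commutes with that
  5-cycle.\<close>

lemma not_moving_zero_6:
  fixes y :: "nat \<Rightarrow> 'a::field_char_0"
  assumes y: "nodal y" "moving y" and inj: "inj_on y {1..6}" and y6: "y 6 = 0"
  shows False
proof -
  have nz: "y i \<noteq> 0" if "i \<in> {1..5}" for i
  proof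
    assume "y i = 0"
    then have "i = 6" using inj_onD[OF inj, of i 6] y6 that by simp
    then show False using that by simp
  qed
  have fix6: "p 6 = 6" if p: "p permutes {1..6}" "\<And>i. i \<in> {1..6} \<Longrightarrow> y (p i) = c * y i" for p c
  proof -
    have "(6::nat) \<in> {1..6}" by simp
    moreover from this have "p 6 \<in> {1..6}" by (simp only: permutes_in_image[OF p(1)])
    ultimately show ?thesis using inj_onD[OF inj, of "p 6" 6] p(2)[of 6] y6 by simp
  qed
  have pm5: "p i \<in> {1..5}" if p: "p permutes {1..6}" "\<And>i. i \<in> {1..6} \<Longrightarrow> y (p i) = c * y i" and i: "i \<in> {1..5}" for p c i
  proof -
    have "i \<in> {1..6}" using i by simp
    then have "p i \<in> {1..6}" by (simp only: permutes_in_image[OF p(1)])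
    moreover have "p i \<noteq> 6"
    proof
      assume "p i = 6"
      then have "i = 6" using fix6[OF p] permutes_inj[OF p(1)] by (metis injD)
      then show False using i by simp
    qed
    ultimately show ?thesis by auto
  qed
  have c5: "c ^ 5 = 1" if p: "p permutes {1..6}" "\<And>i. i \<in> {1..6} \<Longrightarrow> y (p i) = c * y i" for p c
  proof -
    have "c ^ card {1..5::nat} = 1"
    proof (rule scale_prod[where y = y and p = p])
      show "inj_on p {1..5}" by (rule permutes_inj_on[OF p(1)])
      show "p ` {1..5} \<subseteq> {1..5}" using pm5[OF p] by blast
      show "y (p i) = c * y i" if "i \<in> {1..5}" for i using p(2) that by simp
    qed (use nz in simp_all)
    then show ?thesis by simp
  qed
  show False
  proof (cases "\<exists>p c. p permutes {1..6} \<and> (\<forall>i\<in>{1..6}. y (p i) = c * y i) \<and> c \<noteq> 1")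
    case False
    show False
    proof (rule not_movingI[OF y(2), of 1])
      fix \<pi> assume "\<pi> \<in> stab y"
      then obtain c where c: "\<pi> permutes {1..6}" "\<And>i. i \<in> {1..6} \<Longrightarrow> y (\<pi> i) = c * y i"
        using stabE by blast
      then have "c = 1" using False by blast
      have "\<pi> = id"
      proof (rule permutes_6_eqI[OF c(1) permutes_id])
        fix i :: nat assume i: "i \<in> {1..6}"
        have "\<pi> i \<in> {1..6}" using i by (simp only: permutes_in_image[OF c(1)])
        then show "\<pi> i = id i" using inj_onD[OF inj _ _ i] c(2)[OF i] \<open>c = 1\<close> by simp
      qed
      then show "\<exists>\<sigma>. outer \<sigma> \<pi> \<and> \<sigma> 1 = 1" using outer_id by (intro exI[of _ id]) simp
    qed simp
  next
    case True
    then obtain p c where p: "p permutes {1..6}" "\<And>i. i \<in> {1..6} \<Longrightarrow> y (p i) = c * y i" and c: "c \<noteq> 1" by blast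
    have c0: "c \<noteq> 0" using nodal_scale_nonzero[OF y(1) p] .
    \<comment> \<open>The orbit of index 1. Its five members are distinct since \<open>c\<close> has
      order 5, and listing them in this order makes the symmetry the standard 5-cycle
      \<open>?r\<close>.\<close>
    define x where "x k = (p ^^ k) 1" for k
    have x5: "x k \<in> {1..5}" for k
    proof (induction k)
      case (Suc k)
      then show ?case using pm5[OF p, of "x k"] by (simp add: x_def)
    qed (simp add: x_def)
    have yx: "y (x k) = c ^ k * y 1" for k
    proof (induction k)
      case (Suc k)
      have "x k \<in> {1..6}" using x5[of k] by simp
      then show ?case using p(2)[of "x k"] Suc by (simp add: x_def)
    qed (simp add: x_def)
    have y1: "y 1 \<noteq> 0" using nz[of 1] by simp
    have xne: "x k \<noteq> x l" if "k < l" "l < 5" for k l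
    proof
      assume "x k = x l"
      then have "c ^ k = c ^ k * c ^ (l - k)" using yx[of k] yx[of l] y1 that by (simp flip: power_add)
      then have "c ^ (l - k) = 1" using c0 by simp
      moreover have "0 < l - k" "l - k < 5" using that by auto
      ultimately show False using pow_5_eq_1[OF c5[OF p]] c by blast
    qed
    have x6: "x k \<noteq> 6" for k using x5[of k] by auto
    let ?L = "[x 0, x 1, x 2, x 3, x 4, 6]"
    have "distinct ?L" using xne[of 0] xne[of 1] xne[of 2] xne[of 3 4] x6 by simp
    moreover have "set ?L \<subseteq> {1..6}"
      using x5[of 0] x5[of 1] x5[of 2] x5[of 3] x5[of 4] by simp
    ultimately obtain q where q: "q permutes {1..6}" and qL: "\<And>k. k < length ?L \<Longrightarrow> q (Suc k) = ?L ! k"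
      using ex_perm_of_list by blast
    have zq: "q 1 = x 0" "q 2 = x 1" "q 3 = x 2" "q 4 = x 3" "q 5 = x 4" "q 6 = 6"
      using qL[of 0] qL[of 1] qL[of 2] qL[of 3] qL[of 4] qL[of 5] by (simp_all add: eval_nat_numeral)
    define z where "z = y \<circ> q"
    have zinj: "inj_on z {1..6}"
      unfolding z_def using permutes_inj_on[OF q] permutes_image[OF q] inj by (simp add: comp_inj_on)
    \<comment> \<open>The partner \<open>?s\<close> is a 5-cycle of nodes fixing only node
      5.\<close>
    let ?r = "perm6 [2,3,4,5,1,6]" and ?s = "perm6 [2,6,1,3,5,4]"
    have o: "outer ?s ?r" using outer_word[of "[4,5,4,3,1,2]"] by simp
    note rp = outer_permutes(2)[OF o]
    have c5': "c ^ 5 = 1" using c5[OF p] .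
    have "\<forall>i\<in>{1..6}. z (?r i) = c * z i"
      unfolding ball_interval_6 perm6_simps z_def comp_apply zq yx using c5' y6
      by (simp add: eval_nat_numeral mult.assoc)
    then have zr: "z (?r i) = c * z i" if "i \<in> {1..6}" for i using that by blast
    show False
    proof (rule not_movingI[OF moving_perm[OF y(2) q, folded z_def], of 5])
      fix \<pi> assume "\<pi> \<in> stab z"
      then obtain d where d: "\<pi> permutes {1..6}" "\<And>i. i \<in> {1..6} \<Longrightarrow> z (\<pi> i) = d * z i"
        using stabE by blast
      obtain \<sigma> where \<sigma>: "outer \<sigma> \<pi>" using outer_surj[OF d(1)] by blast
      \<comment> \<open>Scalars commute, so \<open>\<pi>\<close> commutes with the 5-cycle, and \<open>\<sigma>\<close> preserves
        the only fixed node of its counterpart.\<close>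
      have "\<pi> \<circ> ?r = ?r \<circ> \<pi>"
      proof (rule permutes_6_eqI)
        show "\<pi> \<circ> ?r permutes {1..6}" "?r \<circ> \<pi> permutes {1..6}" by (intro permutes_compose d rp)+
        fix i :: nat assume i: "i \<in> {1..6}"
        have m: "?r i \<in> {1..6}" "\<pi> i \<in> {1..6}"
          using i by (simp_all only: permutes_in_image[OF rp] permutes_in_image[OF d(1)])
        have m2: "\<pi> (?r i) \<in> {1..6}" "?r (\<pi> i) \<in> {1..6}"
          using m by (simp_all only: permutes_in_image[OF rp] permutes_in_image[OF d(1)])
        have "z (\<pi> (?r i)) = z (?r (\<pi> i))" using d(2)[OF m(1)] zr[OF m(2)] d(2)[OF i] zr[OF i] by simp
        then show "(\<pi> \<circ> ?r) i = (?r \<circ> \<pi>) i" using inj_onD[OF zinj _ m2] by simp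
      qed
      then have "\<sigma> \<circ> ?s = ?s \<circ> \<sigma>"
        using outer_injective[OF outer_comp[OF \<sigma> o]] outer_comp[OF o \<sigma>] by simp
      moreover have "?s 5 = 5" by (rule perm6_simps)
      ultimately have fixed: "?s (\<sigma> 5) = \<sigma> 5" by (metis comp_apply)
      have "(5::nat) \<in> {1..6}" by simp
      then have "\<sigma> 5 \<in> {1..6}" by (simp only: permutes_in_image[OF outer_permutes(1)[OF \<sigma>]])
      then have "\<sigma> 5 \<in> {1, 2, 3, 4, 5, 6}" unfolding interval_6 .
      then have "\<sigma> 5 = 5" using fixed by (elim insertE emptyE) (simp_all add: perm6_def)
      then show "\<exists>\<sigma>. outer \<sigma> \<pi> \<and> \<sigma> 5 = 5" using \<sigma> by blast
    qed simp
  qed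
qed

lemma not_moving_of_inj:
  fixes y :: "nat \<Rightarrow> 'a::field_char_0"
  assumes y: "nodal y" "moving y"
  shows "\<not> inj_on y {1..6}"
proof
  assume inj: "inj_on y {1..6}"
  show False
  proof (cases "\<exists>j\<in>{1..6}. y j = 0")
    case True
    then obtain j where j: "j \<in> {1..6}" "y j = 0" by blast
    let ?q = "swap j 6"
    have q: "?q permutes {1..6}" by (rule permutes_swap_id) (use j in auto)
    have "inj_on (y \<circ> ?q) {1..6}"
      using permutes_inj_on[OF q] permutes_image[OF q] inj by (simp add: comp_inj_on)
    then show False
      using not_moving_zero_6[OF nodal_perm[OF y(1) q] moving_perm[OF y(2) q]] j(2) by simp
  next
    case False
    then show False using not_moving_no_zero[OF y inj] by blast
  qed
qed

section \<open>Coincidences among the coordinates\<close>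

definition classified :: "(nat \<Rightarrow> 'a::field) \<Rightarrow> bool" where
  "classified y \<longleftrightarrow> (\<exists>q c z. q permutes {1..6} \<and> c \<noteq> 0 \<and> (\<forall>i\<in>{1..6}. z i = c * y (q i)) \<and>
     (type1 z \<or> type2 z \<or> type3 z \<or> type4 z \<or> type5 z \<or> type6 z \<or> type7 z \<or> type8 z))"

lemma classified_perm:
  assumes r: "r permutes {1..6}" and c: "classified (y \<circ> r)"
  shows "classified y"
proof -
  obtain q c z where *: "q permutes {1..6}" "c \<noteq> 0" "\<forall>i\<in>{1..6}. z i = c * y (r (q i))"
    "type1 z \<or> type2 z \<or> type3 z \<or> type4 z \<or> type5 z \<or> type6 z \<or> type7 z \<or> type8 z"
    using c unfolding classified_def comp_apply by blast
  have "r \<circ> q permutes {1..6}" by (rule permutes_compose[OF *(1) r])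
  then show ?thesis using * unfolding classified_def by (metis comp_apply)
qed

lemma classifiedI:
  assumes "type1 y \<or> type2 y \<or> type3 y \<or> type4 y \<or> type5 y \<or> type6 y \<or> type7 y \<or> type8 y"
  shows "classified y"
  unfolding classified_def using assms permutes_id
  by (intro exI[of _ id] exI[of _ 1] exI[of _ y]) simp

lemma classified_scaleI:
  assumes "type7 (\<lambda>i. c * y i) \<or> type8 (\<lambda>i. c * y i)" "c \<noteq> 0"
  shows "classified y"
  unfolding classified_def using assms permutes_id
  by (intro exI[of _ id] exI[of _ c] exI[of _ "\<lambda>i. c * y i"]) auto

lemma nodal_tripleD:
  assumes "nodal y" "distinct [i, j, k]" "i \<in> {1..6}" "j \<in> {1..6}" "k \<in> {1..6}"
  shows "y i + y j + y k \<noteq> 0"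
  using assms no_zero_tripleD unfolding nodal_def by blast

lemma nodal_sum:
  assumes "nodal y"
  shows "y 1 + y 2 + y 3 + y 4 + y 5 + y 6 = 0"
  using assms unfolding nodal_def sum_interval_6 by blast

text \<open>Sum zero makes the remaining value -5 times the repeated one; the factor
  \<open>1 / (3 * y 1)\<close> reaches the scale of \<open>type8\<close>.\<close>

lemma classified_five:
  fixes y :: "nat \<Rightarrow> 'a::field_char_0"
  assumes y: "nodal y" and eq: "y 2 = y 1" "y 3 = y 1" "y 4 = y 1" "y 6 = y 1"
  shows "classified y"
proof -
  let ?q = "swap 5 (6::nat)"
  have "y 1 + y 2 + y 3 \<noteq> 0" by (rule nodal_tripleD[OF y]) auto
  then have t: "y 1 \<noteq> 0" using eq by auto
  have "y 5 = - 5 * y 1" using nodal_sum[OF y] unfolding eq by algebra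
  then have "type8 (\<lambda>i. (1 / (3 * y 1)) * (y \<circ> ?q) i)"
    using t eq by (simp add: type8_def Transposition.transpose_def field_simps)
  then have "classified (y \<circ> ?q)" using t by (intro classified_scaleI[of "1 / (3 * y 1)"]) simp_all
  then show ?thesis by (rule classified_perm[rotated]) (rule permutes_swap_id; simp)
qed

lemma classified_four:
  fixes y :: "nat \<Rightarrow> 'a::field_char_0"
  assumes y: "nodal y" and eq: "y 2 = y 1" "y 3 = y 1" "y 6 = y 1"
  shows "classified y"
proof -
  consider "y 4 = y 1" | "y 5 = y 1" | "y 4 = y 5" "y 4 \<noteq> y 1"
    | "y 1 \<noteq> y 4" "y 1 \<noteq> y 5" "y 4 \<noteq> y 5" by metis
  then show ?thesis
  proof cases
    case 1
    then show ?thesis using classified_five[OF y] eq by simp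
  next
    case 2
    let ?q = "swap 4 (5::nat)"
    have q: "?q permutes {1..6}" by (rule permutes_swap_id) auto
    have "classified (y \<circ> ?q)"
      by (rule classified_five[OF nodal_perm[OF y q]]) (use eq 2 in \<open>simp_all add: Transposition.transpose_def\<close>)
    then show ?thesis by (rule classified_perm[OF q])
  next
    case 3
    \<comment> \<open>Four plus two equal values are impossible: half of the total sum is a triple
      sum.\<close>
    have "2 * (y 1 + y 2 + y 4) = 0" using nodal_sum[OF y] unfolding eq 3(1)[symmetric] by algebra
    moreover have "y 1 + y 2 + y 4 \<noteq> 0" by (rule nodal_tripleD[OF y]) auto
    ultimately show ?thesis by (metis mult_eq_0_iff zero_neq_numeral)
  next
    case 4
    then have "type3 y" using eq by (simp add: type3_def)
    then show ?thesis by (intro classifiedI) blast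
  qed
qed

lemma classified_three_two:
  fixes y :: "nat \<Rightarrow> 'a::field_char_0"
  assumes y: "nodal y" and eq: "y 2 = y 1" "y 3 = y 1" "y 5 = y 4" and ne: "y 4 \<noteq> y 1" "y 6 \<noteq> y 1"
  shows "classified y"
proof (cases "y 6 = y 4")
  case True
  let ?q = "swap 3 (5::nat)"
  have q: "?q permutes {1..6}" by (rule permutes_swap_id) auto
  have "y 1 + y 2 + y 3 \<noteq> 0" by (rule nodal_tripleD[OF y]) auto
  then have t: "y 1 \<noteq> 0" using eq by auto
  have "3 * (y 1 + y 4) = 0" using nodal_sum[OF y] unfolding eq True by algebra
  then have "y 1 + y 4 = 0" by (metis mult_eq_0_iff zero_neq_numeral)
  then have "y 4 = - y 1" by (simp add: eq_neg_iff_add_eq_0 add.commute)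
  \<comment> \<open>Two levels of size three have opposite values. Swapping 3 and 5 and dividing by
    \<open>- y 1\<close> gives the prescribed arrangement of signs.\<close>
  then have "type7 (\<lambda>i. (- 1 / y 1) * (y \<circ> ?q) i)"
    using t eq True by (simp add: type7_def Transposition.transpose_def)
  then have "classified (y \<circ> ?q)" using t by (intro classified_scaleI[of "- 1 / y 1"]) simp_all
  then show ?thesis by (rule classified_perm[OF q])
next
  case False
  then have "type6 y" using eq ne by (simp add: type6_def)
  then show ?thesis by (intro classifiedI) blast
qed

lemma classified_three:
  fixes y :: "nat \<Rightarrow> 'a::field_char_0"
  assumes y: "nodal y" and eq: "y 2 = y 1" "y 3 = y 1"
  shows "classified y"
proof -
  have perm: "classified y" if "i \<in> {4, 5, 6}" "j \<in> {4, 5, 6}" "classified (y \<circ> swap i j)" for i j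
    by (rule classified_perm[OF _ that(3)], rule permutes_swap_id) (use that in auto)
  have np: "nodal (y \<circ> swap i j)" if "i \<in> {4, 5, 6}" "j \<in> {4, 5, 6}" for i j
    by (rule nodal_perm[OF y permutes_swap_id]) (use that in auto)
  consider "y 6 = y 1" | "y 4 = y 1" | "y 5 = y 1"
    | "y 5 = y 4" "y 4 \<noteq> y 1" "y 6 \<noteq> y 1" | "y 6 = y 4" "y 4 \<noteq> y 1" "y 5 \<noteq> y 1"
    | "y 6 = y 5" "y 4 \<noteq> y 1" "y 5 \<noteq> y 1"
    | "y 1 \<noteq> y 4" "y 1 \<noteq> y 5" "y 1 \<noteq> y 6" "y 4 \<noteq> y 5" "y 4 \<noteq> y 6" "y 5 \<noteq> y 6"
    by metis
  then show ?thesis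
  proof cases
    case 1
    then show ?thesis using classified_four[OF y eq] by simp
  next
    case 2
    have "classified (y \<circ> swap 4 6)"
      by (rule classified_four[OF np]) (use eq 2 in \<open>simp_all add: Transposition.transpose_def\<close>)
    then show ?thesis by (rule perm[rotated 2]) auto
  next
    case 3
    have "classified (y \<circ> swap 5 6)"
      by (rule classified_four[OF np]) (use eq 3 in \<open>simp_all add: Transposition.transpose_def\<close>)
    then show ?thesis by (rule perm[rotated 2]) auto
  next
    case 4
    then show ?thesis using classified_three_two[OF y eq] by simp
  next
    case 5
    have "classified (y \<circ> swap 5 6)"
      by (rule classified_three_two[OF np]) (use eq 5 in \<open>simp_all add: Transposition.transpose_def\<close>)
    then show ?thesis by (rule perm[rotated 2]) auto
  next
    case 6
    have "classified (y \<circ> swap 4 6)"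
      by (rule classified_three_two[OF np]) (use eq 6 in \<open>simp_all add: Transposition.transpose_def\<close>)
    then show ?thesis by (rule perm[rotated 2]) auto
  next
    case 7
    then have "type2 y" using eq by (simp add: type2_def)
    then show ?thesis by (intro classifiedI) blast
  qed
qed

lemma classified_triple:
  fixes y :: "nat \<Rightarrow> 'a::field_char_0"
  assumes y: "nodal y" and ijk: "distinct [i, j, k]" "{i, j, k} \<subseteq> {1..6}" and eq: "y j = y i" "y k = y i"
  shows "classified y"
proof -
  obtain q where q: "q permutes {1..6}" and qL: "\<And>m. m < length [i, j, k] \<Longrightarrow> q (Suc m) = [i, j, k] ! m"
    using ex_perm_of_list[OF ijk(1)] ijk(2) by auto
  have q': "q 1 = i" "q 2 = j" "q 3 = k"
    using qL[of 0] qL[of 1] qL[of 2] by (simp_all add: eval_nat_numeral)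
  have "classified (y \<circ> q)"
    by (rule classified_three[OF nodal_perm[OF y q]]; unfold comp_apply q' eq; rule refl)
  then show ?thesis by (rule classified_perm[OF q])
qed

text \<open>A third pair cannot occur, since half of the total would be a vanishing triple sum. What
  remains is \<open>type5\<close> unless the six values cancel in opposite pairs, which is
  \<open>type4\<close>.\<close>

lemma classified_pairs:
  fixes y :: "nat \<Rightarrow> 'a::field_char_0"
  assumes y: "nodal y" and eq: "y 2 = y 1" "y 5 = y 4"
    and ne: "y 4 \<noteq> y 1" "y 3 \<noteq> y 1" "y 6 \<noteq> y 1" "y 3 \<noteq> y 4" "y 6 \<noteq> y 4"
  shows "classified y"
proof -
  have "y 1 + y 3 + y 4 \<noteq> 0" by (rule nodal_tripleD[OF y]) auto
  moreover have "2 * (y 1 + y 3 + y 4) = 0" if "y 6 = y 3"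
    using nodal_sum[OF y] unfolding eq that by algebra
  ultimately have ne36: "y 6 \<noteq> y 3" by (metis mult_eq_0_iff zero_neq_numeral)
  show ?thesis
  proof (cases "y 4 = - y 1 \<and> y 6 = - y 3")
    case True
    \<comment> \<open>With values t, t, u, -t, -t, -u this reordering gives t, t, -t, u, -u,
      -t.\<close>
    let ?q = "perm6 [1,2,4,3,6,5]"
    have q: "?q permutes {1..6}" by (rule perm6_permutes) (simp_all only: interval_6, auto)
    have "type4 (y \<circ> ?q)"
      unfolding type4_def comp_apply perm6_simps using True eq ne ne36 by auto
    then have "classified (y \<circ> ?q)" by (intro classifiedI) blast
    then show ?thesis by (rule classified_perm[OF q])
  next
    case False
    then have "type5 y" unfolding type5_def using eq ne ne36 by auto
    then show ?thesis by (intro classifiedI) blast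
  qed
qed

lemma classified_pair:
  fixes y :: "nat \<Rightarrow> 'a::field_char_0"
  assumes y: "nodal y" and eq: "y 2 = y 1"
  shows "classified y"
proof (rule ccontr)
  assume neg: "\<not> classified y"
  have no3: "\<not> (y j = y i \<and> y k = y i)" if "distinct [i, j, k]" "{i, j, k} \<subseteq> {1..6}" for i j k
    using classified_triple[OF y that] neg by blast
  have ne1: "y i \<noteq> y 1" if "i \<in> {3, 4, 5, 6}" for i using no3[of 1 2 i] eq that by auto
  have no2: "y j \<noteq> y i" if d: "distinct [1, 2, k, i, j, l]" "{1, 2, k, i, j, l} \<subseteq> {1..6}" for i j k l
  proof
    assume ij: "y j = y i"
    obtain q where q: "q permutes {1..6}"
      and qL: "\<And>m. m < length [1, 2, k, i, j, l] \<Longrightarrow> q (Suc m) = [1, 2, k, i, j, l] ! m"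
      using ex_perm_of_list[OF d(1)] d(2) by auto
    have q': "q 1 = 1" "q 2 = 2" "q 3 = k" "q 4 = i" "q 5 = j" "q 6 = l"
      using qL[of 0] qL[of 1] qL[of 2] qL[of 3] qL[of 4] qL[of 5] by (simp_all add: eval_nat_numeral)
    have m: "i \<in> {3, 4, 5, 6}" "k \<in> {3, 4, 5, 6}" "l \<in> {3, 4, 5, 6}"
      using d unfolding interval_6 by auto
    have "classified (y \<circ> q)"
    proof (rule classified_pairs[OF nodal_perm[OF y q]]; unfold comp_apply q')
      show "y k \<noteq> y i" using no3[of i j k] ij d by auto
      show "y l \<noteq> y i" using no3[of i j l] ij d by auto
    qed (use eq ij ne1 m in auto)
    then show False using neg classified_perm[OF q] by blast
  qed
  \<comment> \<open>Each use of \<open>no2\<close> separates the two middle indices; the first and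
    last are the remaining two of 3, 4, 5, 6.\<close>
  have "type1 y"
    using eq ne1[of 3] ne1[of 4] ne1[of 5] ne1[of 6] no2[of 5 3 4 6] no2[of 4 3 5 6] no2[of 4 3 6 5]
      no2[of 3 4 5 6] no2[of 3 4 6 5] no2[of 3 5 6 4]
    by (simp add: type1_def)
  then show False using neg classifiedI by blast
qed

lemma classification:
  fixes y :: "nat \<Rightarrow> 'a::field_char_0"
  assumes y: "nodal y" "moving y"
  shows "classified y"
proof -
  obtain i j where ij: "i \<in> {1..6}" "j \<in> {1..6}" "i \<noteq> j" "y i = y j"
    using not_moving_of_inj[OF y] unfolding inj_on_def by blast
  obtain q where q: "q permutes {1..6}" and qL: "\<And>m. m < length [i, j] \<Longrightarrow> q (Suc m) = [i, j] ! m"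
    using ex_perm_of_list[of "[i, j]"] ij by auto
  have q': "q 1 = i" "q 2 = j" using qL[of 0] qL[of 1] by (simp_all add: eval_nat_numeral)
  have "classified (y \<circ> q)"
    by (rule classified_pair[OF nodal_perm[OF y(1) q]]) (unfold comp_apply q', rule ij(4)[symmetric])
  then show ?thesis by (rule classified_perm[OF q])
qed

section \<open>Back to the threefold\<close>

lemma nodal_scale:
  fixes y :: "nat \<Rightarrow> 'a::field"
  assumes y: "nodal y" and c: "c \<noteq> 0" and z: "\<And>i. i \<in> {1..6} \<Longrightarrow> z i = c * y i"
  shows "nodal z" and "threefold z = threefold y"
proof -
  have form: "cubic_form (ycoeffs z) v = 0 \<longleftrightarrow> cubic_form (ycoeffs y) v = 0" for v
    using cubic_form_ycoeffs_scale[of z c y v, OF z] c by simp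
  have "trisecant_free (cubic_form (ycoeffs z)) r \<longleftrightarrow> trisecant_free (cubic_form (ycoeffs y)) r" for r
    unfolding trisecant_free_def form ..
  moreover have sum: "sum z T = c * sum y T" if "T \<subseteq> {1..6}" for T
    using z that by (auto simp: sum_distrib_left intro!: sum.cong)
  then have "sum z {1..6} = 0" "no_zero_triple z"
    using y c by (auto simp: nodal_def no_zero_triple_def)
  ultimately show "nodal z" using y unfolding nodal_def by blast
  show "threefold z = threefold y" by (simp add: threefold_def hypersurface_def mpoly_eval_cubic form)
qed

lemma moving_of_no_fixed_node:
  fixes y :: "nat \<Rightarrow> 'a::field_char_0"
  assumes y: "nodal y" and no_fixed: "\<forall>i\<in>{1..6}. \<exists>g\<in>carrier (Aut (threefold y)). g (node i) \<noteq> node i"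
  shows "moving y"
  unfolding moving_def
proof
  fix i :: nat assume i: "i \<in> {1..6}"
  then obtain g where g: "g \<in> carrier (Aut (threefold y))" "g (node i) \<noteq> node i" using no_fixed by blast
  obtain A \<sigma> where A: "\<sigma> \<in> node_stab y" "maps_nodes A \<sigma>" "g = proj_map A"
    using g(1) unfolding Aut_carrier_iff[OF y] by blast
  have "\<sigma> i \<noteq> i" using g(2) proj_map_node[OF A(2) i] A(3) by metis
  then show "\<exists>\<sigma>\<in>node_stab y. \<sigma> i \<noteq> i" using A(1) by blast
qed

lemma ex_map_to_perm:
  fixes y :: "nat \<Rightarrow> 'a::field_char_0"
  assumes y: "nodal y" and q: "q permutes {1..6}"
  obtains \<sigma> g where "g \<in> PGL" "permutes_nodes_by g \<sigma>" "g ` threefold y = threefold (y \<circ> q)"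
proof -
  \<comment> \<open>Cubics are pulled back, so the image threefold belongs to
    \<open>y \<circ> q\<close> when the matrix is paired with the inverse of
    \<open>q\<close>.\<close>
  obtain \<tau> where \<tau>: "outer \<tau> (inv' q)" using outer_surj[OF permutes_inv[OF q]] by blast
  obtain A :: "'a ^ 5 ^ 5" where A: "realizes A \<tau> (inv' q)" using outer_realized[OF \<tau>] .
  have "sum (y \<circ> q) {1..6} = 0" using sum_zero_nodal[OF nodal_perm[OF y q]] .
  from realizesD(3)[OF A this]
  have "cubic_form (ycoeffs y) v = 0 \<longleftrightarrow> cubic_form (ycoeffs (y \<circ> q)) (A *v v) = 0" for v
    using permutes_inv_o(1)[OF q] by (simp only: comp_assoc comp_id)
  then have "proj_map A ` threefold y = threefold (y \<circ> q)"
    unfolding threefold_def proj_map_image_hypersurface_iff[OF realizesD(1)[OF A]] by blast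
  moreover have "proj_map A \<in> PGL" using realizesD(1)[OF A] unfolding PGL_def by blast
  moreover have "permutes_nodes_by (proj_map A) \<tau>"
    using proj_map_node[OF realizesD(2)[OF A]] outer_permutes(1)[OF \<tau>] unfolding permutes_nodes_by_def by blast
  ultimately show ?thesis using that by blast
qed

lemma ycoeffs_nth:
  "ycoeffs z $ 1 = z 3 + z 4 + z 5" "ycoeffs z $ 2 = z 1 + z 5 + z 6" "ycoeffs z $ 3 = z 2 + z 3 + z 6"
  "ycoeffs z $ 4 = z 1 + z 2 + z 3" "ycoeffs z $ 5 = z 1 + z 4 + z 6"
  by (simp_all add: ycoeffs_def vec5_nth)

lemma ycoeffs_type1:
  fixes z :: "nat \<Rightarrow> 'a::field_char_0"
  assumes "nodal z" "type1 z"
  defines "b \<equiv> ycoeffs z"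
  shows "b$1 + b$2 + b$4 + b$5 = 0"
proof -
  have e: "z 2 = z 1" using assms(2) unfolding type1_def by auto
  have s: "z 6 = - (z 1 + z 1 + z 3 + z 4 + z 5)"
    using nodal_sum[OF assms(1)] unfolding e by (intro eq_neg_iff_add_eq_0[THEN iffD2]) (simp add: add_ac)
  show "b$1 + b$2 + b$4 + b$5 = 0"
    unfolding b_def ycoeffs_nth by (simp_all add: e s del: One_nat_def)
qed

lemma ycoeffs_type2:
  fixes z :: "nat \<Rightarrow> 'a::field_char_0"
  assumes "nodal z" "type2 z"
  defines "b \<equiv> ycoeffs z"
  shows "b$1 + b$3 = 0" "b$2 - b$3 + b$4 + b$5 = 0"
proof -
  have e: "z 2 = z 1" "z 3 = z 1" using assms(2) unfolding type2_def by auto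
  have s: "z 6 = - (z 1 + z 1 + z 1 + z 4 + z 5)"
    using nodal_sum[OF assms(1)] unfolding e by (intro eq_neg_iff_add_eq_0[THEN iffD2]) (simp add: add_ac)
  show "b$1 + b$3 = 0" "b$2 - b$3 + b$4 + b$5 = 0"
    unfolding b_def ycoeffs_nth by (simp_all add: e s del: One_nat_def)
qed

lemma ycoeffs_type3:
  fixes z :: "nat \<Rightarrow> 'a::field_char_0"
  assumes "nodal z" "type3 z"
  defines "b \<equiv> ycoeffs z"
  shows "b$1 + b$4 = 0" "b$2 + b$5 = 0" "b$3 - b$4 = 0"
proof -
  have e: "z 2 = z 1" "z 3 = z 1" "z 6 = z 1" using assms(2) unfolding type3_def by auto
  have s: "z 5 = - (z 1 + z 1 + z 1 + z 1 + z 4)"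
    using nodal_sum[OF assms(1)] unfolding e by (intro eq_neg_iff_add_eq_0[THEN iffD2]) (simp add: add_ac)
  show "b$1 + b$4 = 0" "b$2 + b$5 = 0" "b$3 - b$4 = 0"
    unfolding b_def ycoeffs_nth by (simp_all add: e s del: One_nat_def)
qed

lemma ycoeffs_type4:
  fixes z :: "nat \<Rightarrow> 'a::field_char_0"
  assumes "nodal z" "type4 z"
  defines "b \<equiv> ycoeffs z"
  shows "b$1 + b$4 = 0" "b$2 + b$5 = 0" "b$3 + b$4 = 0"
proof -
  have e: "z 2 = z 1" "z 3 = - z 1" "z 6 = - z 1" "z 5 = - z 4" using assms(2) unfolding type4_def by auto
  show "b$1 + b$4 = 0" "b$2 + b$5 = 0" "b$3 + b$4 = 0"
    unfolding b_def ycoeffs_nth by (simp_all add: e del: One_nat_def)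
qed

lemma ycoeffs_type5:
  fixes z :: "nat \<Rightarrow> 'a::field_char_0"
  assumes "nodal z" "type5 z"
  defines "b \<equiv> ycoeffs z"
  shows "b$1 + b$4 + 2 * b$5 = 0" "b$2 - b$5 = 0"
proof -
  have e: "z 2 = z 1" "z 5 = z 4" using assms(2) unfolding type5_def by auto
  have s: "z 6 = - (z 1 + z 1 + z 3 + z 4 + z 4)"
    using nodal_sum[OF assms(1)] unfolding e by (intro eq_neg_iff_add_eq_0[THEN iffD2]) (simp add: add_ac)
  show "b$1 + b$4 + 2 * b$5 = 0" "b$2 - b$5 = 0"
    unfolding b_def ycoeffs_nth by (simp_all add: e s del: One_nat_def)
qed

lemma ycoeffs_type6:
  fixes z :: "nat \<Rightarrow> 'a::field_char_0"
  assumes "nodal z" "type6 z"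
  defines "b \<equiv> ycoeffs z"
  shows "b$1 + b$4 + 2 * b$5 = 0" "b$2 - b$5 = 0" "b$3 - b$4 - 2 * b$5 = 0"
proof -
  have e: "z 2 = z 1" "z 3 = z 1" "z 5 = z 4" using assms(2) unfolding type6_def by auto
  have s: "z 6 = - (z 1 + z 1 + z 1 + z 4 + z 4)"
    using nodal_sum[OF assms(1)] unfolding e by (intro eq_neg_iff_add_eq_0[THEN iffD2]) (simp add: add_ac)
  show "b$1 + b$4 + 2 * b$5 = 0" "b$2 - b$5 = 0" "b$3 - b$4 - 2 * b$5 = 0"
    unfolding b_def ycoeffs_nth by (simp_all add: e s del: One_nat_def)
qed

lemma ycoeffs_type7:
  fixes z :: "nat \<Rightarrow> 'a::field_char_0"
  assumes "nodal z" "type7 z"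
  defines "b \<equiv> ycoeffs z"
  shows "b$1 = 1" "b$3 = 1" "b$5 = 1" "b$2 = -1" "b$4 = -1"
proof -
  have e: "z 1 = -1" "z 2 = -1" "z 3 = 1" "z 4 = 1" "z 5 = -1" "z 6 = 1" using assms(2) unfolding type7_def by auto
  show "b$1 = 1" "b$3 = 1" "b$5 = 1" "b$2 = -1" "b$4 = -1"
    unfolding b_def ycoeffs_nth by (simp_all add: e del: One_nat_def)
qed

lemma ycoeffs_type8:
  fixes z :: "nat \<Rightarrow> 'a::field_char_0"
  assumes "nodal z" "type8 z"
  defines "b \<equiv> ycoeffs z"
  shows "b$1 = 1" "b$4 = 1" "b$2 = -1" "b$3 = -1" "b$5 = -1"
proof -
  have e: "z 1 = 1 / 3" "z 2 = 1 / 3" "z 3 = 1 / 3" "z 4 = 1 / 3" "z 5 = 1 / 3" "z 6 = - 5 / 3" using assms(2) unfolding type8_def by auto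
  show "b$1 = 1" "b$4 = 1" "b$2 = -1" "b$3 = -1" "b$5 = -1"
    unfolding b_def ycoeffs_nth by (simp_all add: e del: One_nat_def)
qed

theorem proposition7p3:
  fixes a :: "'k::{alg_closed_field, field_char_0} ^ 5"
  assumes only_nodes: "singular_locus (cubic a) = nodes (cubic a)"
    and six_nodes: "nodes (cubic a) = node ` {1..6}"
    and no_fixed_node:
      "\<forall>i\<in>{1..6}. \<exists>g\<in>carrier (Aut (hypersurface (cubic a))). g (node i) \<noteq> node i"
  shows "\<exists>\<sigma> g b X.
    g \<in> PGL \<and> permutes_nodes_by g \<sigma> \<and>
    X = hypersurface (cubic b) \<and> g ` hypersurface (cubic a) = X \<and>
    ((b$1 + b$2 + b$4 + b$5 = 0 \<and>
      Aut X \<cong> integer_mod_group 2 \<and>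
      Aut_acts_as X
        {cycle_of_list [1,3] \<circ> cycle_of_list [2,5] \<circ> cycle_of_list [4,6]})
    \<or> (b$1 + b$3 = 0 \<and> b$2 - b$3 + b$4 + b$5 = 0 \<and>
      Aut X \<cong> sym_group 3 \<and>
      Aut_acts_as X
        {cycle_of_list [1,3] \<circ> cycle_of_list [2,5] \<circ> cycle_of_list [4,6],
         cycle_of_list [1,4,5] \<circ> cycle_of_list [2,6,3]})
    \<or> (b$1 + b$4 = 0 \<and> b$2 + b$5 = 0 \<and> b$3 - b$4 = 0 \<and>
      Aut X \<cong> sym_group 4 \<and>
      Aut_acts_as X
        {cycle_of_list [1,3] \<circ> cycle_of_list [2,5] \<circ> cycle_of_list [4,6],
         cycle_of_list [3,4,5,6]})
    \<or> (b$1 + b$4 = 0 \<and> b$2 + b$5 = 0 \<and> b$3 + b$4 = 0 \<and>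
      Aut X \<cong> dihedral_group 4 \<and>
      Aut_acts_as X
        {cycle_of_list [3,5],
         cycle_of_list [1,3,2,5] \<circ> cycle_of_list [4,6]})
    \<or> (b$1 + b$4 + 2 * b$5 = 0 \<and> b$2 - b$5 = 0 \<and>
      Aut X \<cong> integer_mod_group 2 \<times>\<times> integer_mod_group 2 \<and>
      Aut_acts_as X
        {cycle_of_list [1,2] \<circ> cycle_of_list [3,5] \<circ> cycle_of_list [4,6],
         cycle_of_list [1,3] \<circ> cycle_of_list [2,5] \<circ> cycle_of_list [4,6]})
    \<or> (b$1 + b$4 + 2 * b$5 = 0 \<and> b$2 - b$5 = 0 \<and> b$3 - b$4 - 2 * b$5 = 0 \<and>
      Aut X \<cong> dihedral_group 6 \<and>
      Aut_acts_as X
        {cycle_of_list [1,3] \<circ> cycle_of_list [2,5] \<circ> cycle_of_list [4,6],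
         cycle_of_list [1,6,5,2,4,3]})
    \<or> (b$1 = 1 \<and> b$3 = 1 \<and> b$5 = 1 \<and> b$2 = -1 \<and> b$4 = -1 \<and>
      Aut X \<cong> sym3_squared_C2 \<and>
      Aut_acts_as X
        {cycle_of_list [1,3] \<circ> cycle_of_list [2,5] \<circ> cycle_of_list [4,6],
         cycle_of_list [2,4],
         cycle_of_list [1,5] \<circ> cycle_of_list [2,3,4,6]})
    \<or> (b$1 = 1 \<and> b$4 = 1 \<and> b$2 = -1 \<and> b$3 = -1 \<and> b$5 = -1 \<and>
      Aut X \<cong> sym_group 5 \<and>
      Aut_acts_as X
        {cycle_of_list [1,3] \<circ> cycle_of_list [2,5] \<circ> cycle_of_list [4,6],
         cycle_of_list [1,2,5,6,4]}))"
proof -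
  obtain y where y0: "sum y {1..6} = 0" and ya: "ycoeffs y = a" using ex_ycoeffs .
  have X: "hypersurface (cubic a) = threefold y" by (simp add: threefold_def ya)
  have "singular_locus (cubic a) = node ` {1..6}" using only_nodes six_nodes by simp
  then have y: "nodal y" using nodalI[OF y0] by (simp add: ya)
  have "moving y" using moving_of_no_fixed_node[OF y] no_fixed_node unfolding X by blast
  then obtain q c z where q: "q permutes {1..6}" and c: "c \<noteq> 0" and z: "\<forall>i\<in>{1..6}. z i = c * y (q i)"
    and types: "type1 z \<or> type2 z \<or> type3 z \<or> type4 z \<or> type5 z \<or> type6 z \<or> type7 z \<or> type8 z"
    using classification[OF y] unfolding classified_def by blast
  have z': "z i = c * (y \<circ> q) i" if "i \<in> {1..6}" for i using z that by simp
  \<comment> \<open>Rescaling changes the equation but not the threefold, so the projective map only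
    has to realize the permutation \<open>q\<close>.\<close>
  note nz = nodal_scale[OF nodal_perm[OF y q] c z']
  obtain \<sigma> g where g: "g \<in> PGL" "permutes_nodes_by g \<sigma>" "g ` threefold y = threefold z"
    using ex_map_to_perm[OF y q] nz(2) by metis
  have Xz: "threefold z = hypersurface (cubic (ycoeffs z))" by (simp add: threefold_def)
  show ?thesis
    by (intro exI conjI, rule g(1), rule g(2), rule Xz, unfold X, rule g(3))
       (use types ycoeffs_type1[OF nz(1)] ycoeffs_type2[OF nz(1)] ycoeffs_type3[OF nz(1)] ycoeffs_type4[OF nz(1)]
          ycoeffs_type5[OF nz(1)] ycoeffs_type6[OF nz(1)] ycoeffs_type7[OF nz(1)] ycoeffs_type8[OF nz(1)]
          Aut_acts_as_type1[OF nz(1)] Aut_acts_as_type2[OF nz(1)] Aut_acts_as_type3[OF nz(1)] Aut_acts_as_type4[OF nz(1)]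
          Aut_acts_as_type5[OF nz(1)] Aut_acts_as_type6[OF nz(1)] Aut_acts_as_type7[OF nz(1)] Aut_acts_as_type8[OF nz(1)]
          Aut_type1[OF nz(1)] Aut_type2[OF nz(1)] Aut_type3[OF nz(1)] Aut_type4[OF nz(1)]
          Aut_type5[OF nz(1)] Aut_type6[OF nz(1)] Aut_type7[OF nz(1)] Aut_type8[OF nz(1)]
        in metis)
qed

end
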